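(* Let $P$ and $Q$ be any subsets of $\mathbb{N}^\mathbb{N}$. (1) $P\le^1_{<\omega}Q$ iff $[\![P\vee P]\!]^{3}_{\mathsf{LCM}[m]}\le^1_1 Q$ for some $m\in\mathbb{N}$. (2) $P\le^1_{\omega|<\omega}Q$ iff $[\![\bigvee^{(m)}P]\!]^{2}_{\mathsf{LCM}}\le^1_1 Q$ for some $m\in\mathbb{N}$. (3) $P\le^1_\omega Q$ iff $[\![P\vee P]\!]^{3}_{\mathsf{LCM}}\le^1_1 Q$. (4) $P\le^{<\omega}_1Q$ iff $[\![\bigvee^{(m)}P]\!]^{2}_{\mathsf{CL}}\le^1_1 Q$ for some $m\in\mathbb{N}$. (5) $P\le^{<\omega}_\omega Q$ iff $[\![\bigvee^{(m)}[\![P\vee P]\!]^{3}_{\mathsf{LCM}}]\!]^{2}_{\mathsf{CL}}\le^1_1 Q$ for some $m\in\mathbb{N}$. (6) $P\le^{\omega}_1 Q$ iff $\bigcup_{m\in\mathbb{N}}[\![\bigvee^{(m)}P]\!]^{2}_{\mathsf{CL}}\le^1_1 Q$.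
   Context: $\{\Phi_e\}$ enumerates all partial computable functions $\subseteq\mathbb{N}^\mathbb{N}\to\mathbb{N}^\mathbb{N}$; $\{\Psi_e\}$ is a fixed effective enumeration of total computable learners $\mathbb{N}^{<\mathbb{N}}\to\mathbb{N}$ dominating every partial computable $\Psi:\subseteq\mathbb{N}^{<\mathbb{N}}\to\mathbb{N}$ (whenever $\lim_s\Psi(f\upharpoonright s)$ converges, $\lim_s\Psi_e(f\upharpoonright s)$ converges to the same value). $\mathtt{mcl}_\Psi(g)=\{n:\Psi(g\upharpoonright n+1)\ne\Psi(g\upharpoonright n)\}$, $\mathtt{indx}_\Psi(g)=\{\Psi(g\upharpoonright n):n\}$. For $\alpha,\beta,\gamma\le\omega$, $\Gamma$ is $(\alpha,\beta|\gamma)$-computable if there is $I\subseteq\mathbb{N}$ of cardinality $\alpha$ such that for every $g\in\mathrm{dom}(\Gamma)$ some $e\in I$ has $\lim_n\Psi_e(g\upharpoonright n)$ convergent, $\Phi_{\lim_n\Psi_e(g\upharpoonright n)}(g)=\Gamma(g)$, $\#\mathtt{mcl}_{\Psi_e}(g)<\beta$, $\#\mathtt{indx}_{\Psi_e}(g)\le\gamma$ ($\gamma$ omitted means $\gamma=\omega$). $P\le^\alpha_{\beta|\gamma}Q$ iff some $(\alpha,\beta|\gamma)$-computable $\Gamma$ has $Q\subseteq\mathrm{dom}(\Gamma)$ and $\Gamma(g)\in P$ for $g\in Q$; a $<\omega$ in any position means "for some natural number". $\le^1_1$ is Medvedev reducibility (a partial computable $\Gamma$ maps $Q$ into $P$).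 Sequences over countable alphabets ($\mathbb{N}\cup\{\sharp\}$, $m\times\mathbb{N}$, etc.) are identified with elements of $\mathbb{N}^\mathbb{N}$ via fixed computable bijections of the alphabets with $\mathbb{N}$ (fresh symbols $\sharp$ are used for each occurrence of an operation). Backtrack: for $f\in(\mathbb{N}\cup\{\sharp\})^\mathbb{N}$ with finitely many $\sharp$'s, $\mathtt{tail}(f)=(f(n_0),f(n_0+1),\dots)$ where $n_0$ is least with $f(k)\ne\sharp$ for all $k\ge n_0$; $\mathtt{tail}(f;0)$ is its first entry and $\mathtt{tail}(f)^{\rightarrow1}$ is it with first entry removed. $[\![P\vee P]\!]^3_{\mathsf{LCM}}=\{f\in(\mathbb{N}\cup\{\sharp\})^\mathbb{N}: f$ has finitely many $\sharp$'s, $\mathtt{tail}(f;0)\in\{0,1\}$, $\mathtt{tail}(f)^{\rightarrow1}\in P\}$, and $[\![P\vee P]\!]^3_{\mathsf{LCM}[m]}$ is its subset of those $f$ with fewer than $m$ occurrences of $\sharp$. Multi-tape: for $\sigma\in(I\times\mathbb{N})^{\le\mathbb{N}}$ and $i\in I$, $\mathtt{pr}_i(\sigma)$ is the sequence of second coordinates of those entries of $\sigma$ whose first coordinate is $i$ (in order); for $f\in(I\times\mathbb{N})^\mathbb{N}$, $\mathtt{mc}(f)=\#\{n:(f(n))_0\ne(f(n+1))_0\}\in\mathbb{N}\cup\{\infty\}$. $[\![\bigvee^{(m)}P]\!]^2_{\mathsf{LCM}}=\{f\in(m\times\mathbb{N})^\mathbb{N}:\exists i<m\ \mathtt{pr}_i(f)\in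 P$ and $\mathtt{mc}(f)<\infty\}$ and $[\![\bigvee^{(m)}P]\!]^2_{\mathsf{CL}}=\{f\in(m\times\mathbb{N})^\mathbb{N}:\exists i<m\ \mathtt{pr}_i(f)\in P\}$ (here $\mathtt{pr}_i(f)\in P$ requires $\mathtt{pr}_i(f)$ infinite).
   Formalization: Each alphabet m×ℕ is coded by its own bijection (i,v)↦mv+i; (6) depends on this choice and fails for other codings, e.g. all m×ℕ read inside one ℕ×ℕ. The learners Ψ_e are fixed as the standard delayed enumeration, since domination of limits alone does not suffice for (1) and (4). *)

theory Defs
  imports Main "HOL-Library.Nat_Bijection" "HOL-Library.Infinite_Set" "HOL-Library.Extended_Nat"
begin

section \<open>Computability relative to an oracle\<close>

text \<open>Partial recursive functions of one variable with an oracle; several arguments are passed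
  as one number by means of \<^const>\<open>prod_encode\<close>.\<close>

datatype prog =
    Zero | Succ | Fst | Snd | Query
  | Tuple prog prog | Comp prog prog | PrimRec prog prog | Search prog

text \<open>\<open>run s g p n\<close> is the result of the program \<open>p\<close> with oracle \<open>g\<close> on input \<open>n\<close>, provided that
  recursion depth \<open>s\<close> is enough to obtain one. \<open>Search p\<close> on input \<open>(x, k)\<close> yields the least
  \<open>j \<ge> k\<close> such that \<open>p\<close> has value 0 at \<open>(x, j)\<close>, where \<open>p\<close> has to be defined at
  \<open>(x, k), \<dots>, (x, j)\<close>.\<close>

fun run :: "nat \<Rightarrow> (nat \<Rightarrow> nat) \<Rightarrow> prog \<Rightarrow> nat \<Rightarrow> nat option" where
  "run 0 g p n = None"
| "run (Suc s) g Zero n = Some 0"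
| "run (Suc s) g Succ n = Some (Suc n)"
| "run (Suc s) g Fst n = Some (fst (prod_decode n))"
| "run (Suc s) g Snd n = Some (snd (prod_decode n))"
| "run (Suc s) g Query n = Some (g n)"
| "run (Suc s) g (Tuple p q) n =
     Option.bind (run s g p n) (\<lambda>x. Option.bind (run s g q n) (\<lambda>y. Some (prod_encode (x, y))))"
| "run (Suc s) g (Comp p q) n = Option.bind (run s g q n) (run s g p)"
| "run (Suc s) g (PrimRec p q) n =
     (case prod_decode n of
        (x, 0) \<Rightarrow> run s g p x
      | (x, Suc k) \<Rightarrow> Option.bind (run s g (PrimRec p q) (prod_encode (x, k)))
          (\<lambda>r. run s g q (prod_encode (x, prod_encode (k, r)))))"
| "run (Suc s) g (Search p) n =
     (case prod_decode n of
        (x, k) \<Rightarrow> Option.bind (run s g p n)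
          (\<lambda>r. if r = 0 then Some k else run s g (Search p) (prod_encode (x, Suc k))))"

definition computes :: "(nat \<Rightarrow> nat) \<Rightarrow> prog \<Rightarrow> nat \<Rightarrow> nat \<Rightarrow> bool" where
  "computes g p n y \<longleftrightarrow> (\<exists>s. run s g p n = Some y)"

lemma prod_decode_less:
  assumes "(t, m) = prod_decode n" "t \<noteq> 0"
  shows "m < n" "fst (prod_decode m) < n" "snd (prod_decode m) < n"
proof -
  have n: "n = prod_encode (t, m)"
    using assms(1) by (metis prod_decode_inverse)
  have "k \<le> triangle k" for k
    by (induction k) auto
  from this[of "t + m"] n assms(2) show "m < n"
    by (simp add: prod_encode_def)
  moreover have "fst (prod_decode m) \<le> m" "snd (prod_decode m) \<le> m"
    by (metis le_prod_encode_1 le_prod_encode_2 prod.collapse prod_decode_inverse)+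
  ultimately show "fst (prod_decode m) < n" "snd (prod_decode m) < n"
    by simp_all
qed

text \<open>The \<open>e\<close>-th program. The number \<open>e\<close> is a pair of a tag and a (pair of) subprogram(s).\<close>

function prog_of :: "nat \<Rightarrow> prog" where
  "prog_of e =
     (case prod_decode e of (t, m) \<Rightarrow>
        if t = 0 then Zero
        else if t = 1 then Succ
        else if t = 2 then Fst
        else if t = 3 then Snd
        else if t = 4 then Query
        else if t = 5 then Tuple (prog_of (fst (prod_decode m))) (prog_of (snd (prod_decode m)))
        else if t = 6 then Comp (prog_of (fst (prod_decode m))) (prog_of (snd (prod_decode m)))
        else if t = 7 then PrimRec (prog_of (fst (prod_decode m))) (prog_of (snd (prod_decode m)))
        else Search (prog_of m))"
  by auto
termination
  by (relation "measure id") (use prod_decode_less in \<open>simp_all add: less_imp_neq\<close>)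

declare prog_of.simps [simp del]

lemma surj_prog_of: "surj prog_of"
proof -
  have "\<exists>e. prog_of e = p" for p
  proof (induction p)
    case Zero show ?case by (rule exI[of _ "prod_encode (0, 0)"]) (subst prog_of.simps, simp)
  next
    case Succ show ?case by (rule exI[of _ "prod_encode (1, 0)"]) (subst prog_of.simps, simp)
  next
    case Fst show ?case by (rule exI[of _ "prod_encode (2, 0)"]) (subst prog_of.simps, simp)
  next
    case Snd show ?case by (rule exI[of _ "prod_encode (3, 0)"]) (subst prog_of.simps, simp)
  next
    case Query show ?case by (rule exI[of _ "prod_encode (4, 0)"]) (subst prog_of.simps, simp)
  next
    case (Tuple p q)
    then obtain a b where "prog_of a = p" "prog_of b = q" by blast
    then show ?case
      by (intro exI[of _ "prod_encode (5, prod_encode (a, b))"]) (subst prog_of.simps, simp)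
  next
    case (Comp p q)
    then obtain a b where "prog_of a = p" "prog_of b = q" by blast
    then show ?case
      by (intro exI[of _ "prod_encode (6, prod_encode (a, b))"]) (subst prog_of.simps, simp)
  next
    case (PrimRec p q)
    then obtain a b where "prog_of a = p" "prog_of b = q" by blast
    then show ?case
      by (intro exI[of _ "prod_encode (7, prod_encode (a, b))"]) (subst prog_of.simps, simp)
  next
    case (Search p)
    then obtain a where "prog_of a = p" by blast
    then show ?case
      by (intro exI[of _ "prod_encode (8, a)"]) (subst prog_of.simps, simp)
  qed
  then show ?thesis by (metis surjI)
qed

lemma run_Suc: "run s g p n = Some y \<Longrightarrow> run (Suc s) g p n = Some y"
proof (induction s arbitrary: p n y)
  case 0
  then show ?case by simp
next
  case (Suc s)
  note IH = Suc.IH and prem = Suc.prems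
  show ?case
  proof (cases p)
    case (Tuple p1 p2)
    with prem obtain u v where "run s g p1 n = Some u" "run s g p2 n = Some v"
      "y = prod_encode (u, v)"
      by (auto simp: bind_eq_Some_conv)
    with IH show ?thesis unfolding Tuple by (simp del: run.simps add: run.simps(7))
  next
    case (Comp p1 p2)
    with prem obtain u where "run s g p2 n = Some u" "run s g p1 u = Some y"
      by (auto simp: bind_eq_Some_conv)
    with IH show ?thesis unfolding Comp by (simp del: run.simps add: run.simps(8))
  next
    case (PrimRec p1 p2)
    obtain x k where n: "prod_decode n = (x, k)" by fastforce
    show ?thesis
    proof (cases k)
      case 0
      with prem n PrimRec have "run s g p1 x = Some y" by simp
      with IH n 0 show ?thesis unfolding PrimRec by (simp del: run.simps add: run.simps(9))
    next
      case (Suc l)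
      with prem n PrimRec obtain r where
        "run s g (PrimRec p1 p2) (prod_encode (x, l)) = Some r"
        "run s g p2 (prod_encode (x, prod_encode (l, r))) = Some y"
        by (auto simp: bind_eq_Some_conv)
      with IH n Suc show ?thesis
        unfolding PrimRec by (subst run.simps(9)) (simp del: run.simps)
    qed
  next
    case (Search p1)
    obtain x k where n: "prod_decode n = (x, k)" by fastforce
    with prem Search obtain r where "run s g p1 n = Some r"
      "(if r = 0 then Some k else run s g (Search p1) (prod_encode (x, Suc k))) = Some y"
      by (auto simp: bind_eq_Some_conv)
    with IH n show ?thesis
      unfolding Search by (subst run.simps(10)) (simp del: run.simps split: if_splits)
  qed (use prem in auto)
qed

lemma run_mono: "run s g p n = Some y \<Longrightarrow> s \<le> s' \<Longrightarrow> run s' g p n = Some y"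
  by (rotate_tac, induction s' rule: dec_induct) (auto intro: run_Suc)

lemma computes_unique: "computes g p n y \<Longrightarrow> computes g p n z \<Longrightarrow> y = z"
  unfolding computes_def by (metis nle_le option.inject run_mono)

text \<open>\<open>\<Phi>\<close>: the partial function \<open>\<Phi> e\<close> is defined at \<open>g\<close> iff the \<open>e\<close>-th program with oracle \<open>g\<close>
  computes a total function.\<close>

definition Phi :: "nat \<Rightarrow> (nat \<Rightarrow> nat) \<rightharpoonup> (nat \<Rightarrow> nat)" where
  "Phi e g =
     (if \<forall>n. \<exists>y. computes g (prog_of e) n y
      then Some (\<lambda>n. THE y. computes g (prog_of e) n y)
      else None)"

lemma Phi_eq_Some_iff: "Phi e g = Some h \<longleftrightarrow> (\<forall>n. computes g (prog_of e) n (h n))"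
proof
  assume h: "Phi e g = Some h"
  show "\<forall>n. computes g (prog_of e) n (h n)"
  proof
    fix n
    from h obtain y where y: "computes g (prog_of e) n y"
      unfolding Phi_def by (metis option.distinct(1))
    from h have "h n = (THE y. computes g (prog_of e) n y)"
      unfolding Phi_def by (auto split: if_splits)
    then show "computes g (prog_of e) n (h n)"
      using y computes_unique by (metis the_equality)
  qed
next
  assume h: "\<forall>n. computes g (prog_of e) n (h n)"
  then have "(\<lambda>n. THE y. computes g (prog_of e) n y) = h"
    using computes_unique by (intro ext the_equality) auto
  with h show "Phi e g = Some h"
    unfolding Phi_def by auto
qed


section \<open>Learners\<close>

definition prefix :: "(nat \<Rightarrow> nat) \<Rightarrow> nat \<Rightarrow> nat list"  (infix "\<restriction>" 100) where
  "f \<restriction> n = map f [0..<n]"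

text \<open>Recursion depth \<open>s\<close> of the \<open>c\<close>-th partial computable function on finite strings; the
  oracle plays no role.\<close>

definition string_run :: "nat \<Rightarrow> nat \<Rightarrow> nat list \<Rightarrow> nat option" where
  "string_run s c \<sigma> = run s (\<lambda>_. 0) (prog_of c) (list_encode \<sigma>)"

text \<open>The effective enumeration \<open>\<Psi>\<close> of total learners. The index is a pair \<open>(d, c)\<close>; the value at
  \<open>\<sigma>\<close> is that of the \<open>c\<close>-th partial computable function at the longest prefix of \<open>\<sigma>\<close> at which
  it is seen to converge with recursion depth \<open>length \<sigma>\<close>, and the initial guess \<open>d\<close> while there
  is no such prefix. If the \<open>c\<close>-th function is total and has value \<open>d\<close> at the empty string, then
  its guesses are only delayed, so neither the number of mind changes nor the set of guesses grows.\<close>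

definition converged :: "nat \<Rightarrow> nat list \<Rightarrow> nat set" where
  "converged c \<sigma> = {k. k \<le> length \<sigma> \<and> string_run (length \<sigma>) c (take k \<sigma>) \<noteq> None}"

definition Psi :: "nat \<Rightarrow> nat list \<Rightarrow> nat" where
  "Psi e \<sigma> =
     (case prod_decode e of (d, c) \<Rightarrow>
        if converged c \<sigma> = {} then d
        else the (string_run (length \<sigma>) c (take (Max (converged c \<sigma>)) \<sigma>)))"

lemma Psi_dominating:
  fixes c :: nat
  shows "\<exists>e. \<forall>f v. (\<forall>\<^sub>F n in sequentially. \<exists>s. string_run s c (f \<restriction> n) = Some v)
               \<longrightarrow> (\<forall>\<^sub>F n in sequentially. Psi e (f \<restriction> n) = v)"
proof (intro exI[of _ "prod_encode (0, c)"] allI impI)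
  fix f v
  assume "\<forall>\<^sub>F n in sequentially. \<exists>s. string_run s c (f \<restriction> n) = Some v"
  then obtain N where N: "\<And>n. n \<ge> N \<Longrightarrow> \<exists>s. string_run s c (f \<restriction> n) = Some v"
    unfolding eventually_sequentially by blast
  then obtain t where t: "string_run t c (f \<restriction> N) = Some v" by blast
  have take_prefix: "take k (f \<restriction> n) = f \<restriction> k" if "k \<le> n" for k n
    using that by (simp add: prefix_def take_map)
  have "Psi (prod_encode (0, c)) (f \<restriction> n) = v" if n: "n \<ge> max N t" for n
  proof -
    let ?K = "converged c (f \<restriction> n)"
    have len: "length (f \<restriction> n) = n" by (simp add: prefix_def)
    have fin: "finite ?K" unfolding converged_def by simp
    have "string_run n c (f \<restriction> N) = Some v"
      using run_mono[of t _ _ _ _ n] t n unfolding string_run_def by simp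
    then have NK: "N \<in> ?K"
      using n by (simp add: converged_def len take_prefix)
    then have M: "Max ?K \<in> ?K" "N \<le> Max ?K"
      using fin by (auto intro: Max_in)
    then have Mn: "Max ?K \<le> n" by (simp add: converged_def len)
    with M(1) obtain w where w: "string_run n c (f \<restriction> Max ?K) = Some w"
      by (auto simp: converged_def len take_prefix)
    obtain s where "string_run s c (f \<restriction> Max ?K) = Some v"
      using N M(2) by blast
    with w have "w = v"
      unfolding string_run_def using computes_unique computes_def by blast
    with w NK Mn show ?thesis
      by (auto simp: Psi_def len take_prefix)
  qed
  then show "\<forall>\<^sub>F n in sequentially. Psi (prod_encode (0, c)) (f \<restriction> n) = v"
    unfolding eventually_sequentially by blast
qed

lemma Psi_delay:
  assumes total: "\<And>\<sigma>. \<exists>s. string_run s c \<sigma> = Some (\<psi> \<sigma>)"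
  shows "\<exists>k. mono k \<and> (\<forall>n. Psi (prod_encode (\<psi> [], c)) (g \<restriction> n) = \<psi> (g \<restriction> k n))"
proof -
  let ?K = "\<lambda>n. converged c (g \<restriction> n)"
  let ?k = "\<lambda>n. if ?K n = {} then 0 else Max (?K n)"
  have len: "length (g \<restriction> n) = n" for n by (simp add: prefix_def)
  have fin: "finite (?K n)" for n unfolding converged_def by simp
  have take_prefix: "take k (g \<restriction> n) = g \<restriction> k" if "k \<le> n" for k n
    using that by (simp add: prefix_def take_map)
  have K: "?K n = {k. k \<le> n \<and> string_run n c (g \<restriction> k) \<noteq> None}" for n
    by (auto simp: converged_def len take_prefix)
  have sub: "?K n \<subseteq> ?K n'" if "n \<le> n'" for n n'
  proof
    fix k assume "k \<in> ?K n"
    then obtain y where "k \<le> n" "string_run n c (g \<restriction> k) = Some y" by (auto simp: K)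
    moreover from this(2) have "string_run n' c (g \<restriction> k) = Some y"
      unfolding string_run_def using that by (rule run_mono)
    ultimately show "k \<in> ?K n'" using that by (simp add: K)
  qed
  have "mono ?k"
  proof (rule monoI)
    fix n n' :: nat assume "n \<le> n'"
    from sub[OF this] show "?k n \<le> ?k n'"
      using fin by (auto intro: Max_mono)
  qed
  moreover have "Psi (prod_encode (\<psi> [], c)) (g \<restriction> n) = \<psi> (g \<restriction> ?k n)" for n
  proof (cases "?K n = {}")
    case True
    then show ?thesis by (simp add: Psi_def) (simp add: prefix_def)
  next
    case False
    then have "Max (?K n) \<in> ?K n" using fin by (rule_tac Max_in)
    then obtain y where M: "Max (?K n) \<le> n" and y: "string_run n c (g \<restriction> Max (?K n)) = Some y"
      by (subst (asm) (2) K) auto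
    obtain s where "string_run s c (g \<restriction> Max (?K n)) = Some (\<psi> (g \<restriction> Max (?K n)))"
      using total by blast
    with y have "y = \<psi> (g \<restriction> Max (?K n))"
      unfolding string_run_def using computes_unique computes_def by blast
    with False M y show ?thesis by (simp add: Psi_def len take_prefix)
  qed
  ultimately show ?thesis by blast
qed

definition mcl :: "(nat list \<Rightarrow> nat) \<Rightarrow> (nat \<Rightarrow> nat) \<Rightarrow> nat set" where
  "mcl \<psi> g = {n. \<psi> (g \<restriction> (n + 1)) \<noteq> \<psi> (g \<restriction> n)}"

definition indx :: "(nat list \<Rightarrow> nat) \<Rightarrow> (nat \<Rightarrow> nat) \<Rightarrow> nat set" where
  "indx \<psi> g = {\<psi> (g \<restriction> n) | n. True}"


section \<open>Reducibility\<close>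

text \<open>The cardinals up to \<open>\<omega>\<close> are the elements of \<^typ>\<open>enat\<close>.\<close>

definition ecard :: "'a set \<Rightarrow> enat" where
  "ecard A = (if finite A then enat (card A) else \<infinity>)"

definition learn_computable ::
  "enat \<Rightarrow> enat \<Rightarrow> enat \<Rightarrow> ((nat \<Rightarrow> nat) \<rightharpoonup> (nat \<Rightarrow> nat)) \<Rightarrow> bool" where
  "learn_computable \<alpha> \<beta> \<gamma> \<Gamma> \<longleftrightarrow>
     (\<exists>I :: nat set. ecard I = \<alpha> \<and>
        (\<forall>g \<in> dom \<Gamma>. \<exists>e \<in> I.
           (\<exists>i. (\<forall>\<^sub>F n in sequentially. Psi e (g \<restriction> n) = i) \<and> Phi i g = \<Gamma> g) \<and>
           ecard (mcl (Psi e) g) < \<beta> \<and>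
           ecard (indx (Psi e) g) \<le> \<gamma>))"

definition reducible ::
  "enat \<Rightarrow> enat \<Rightarrow> enat \<Rightarrow> (nat \<Rightarrow> nat) set \<Rightarrow> (nat \<Rightarrow> nat) set \<Rightarrow> bool" where
  "reducible \<alpha> \<beta> \<gamma> P Q \<longleftrightarrow>
     (\<exists>\<Gamma>. learn_computable \<alpha> \<beta> \<gamma> \<Gamma> \<and> Q \<subseteq> dom \<Gamma> \<and> (\<forall>g \<in> Q. the (\<Gamma> g) \<in> P))"

abbreviation medvedev_reducible :: "(nat \<Rightarrow> nat) set \<Rightarrow> (nat \<Rightarrow> nat) set \<Rightarrow> bool" where
  "medvedev_reducible P Q \<equiv> reducible 1 1 \<infinity> P Q"

lemma medvedev_reducible_iff:
  "medvedev_reducible P Q \<longleftrightarrow> (\<exists>e. Q \<subseteq> dom (Phi e) \<and> (\<forall>g \<in> Q. the (Phi e g) \<in> P))"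
proof
  assume "medvedev_reducible P Q"
  then obtain \<Gamma> I where I: "ecard I = 1"
    and G: "\<And>g. g \<in> dom \<Gamma> \<Longrightarrow> \<exists>e \<in> I. (\<exists>i. (\<forall>\<^sub>F n in sequentially. Psi e (g \<restriction> n) = i) \<and> Phi i g = \<Gamma> g)
                 \<and> ecard (mcl (Psi e) g) < 1"
    and Q: "Q \<subseteq> dom \<Gamma>" "\<forall>g \<in> Q. the (\<Gamma> g) \<in> P"
    unfolding reducible_def learn_computable_def by blast
  from I have "card I = 1"
    by (auto simp: ecard_def one_enat_def split: if_splits)
  then obtain e where e: "I = {e}" by (rule card_1_singletonE)
  have "Phi (Psi e []) g = \<Gamma> g" if "g \<in> Q" for g
  proof -
    from that Q G e obtain i where
      i: "\<forall>\<^sub>F n in sequentially. Psi e (g \<restriction> n) = i" "Phi i g = \<Gamma> g"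
      and m: "ecard (mcl (Psi e) g) < 1" by blast
    from m have "mcl (Psi e) g = {}"
      by (auto simp: ecard_def one_enat_def split: if_splits)
    then have "Psi e (g \<restriction> n) = Psi e []" for n
      by (induction n) (auto simp: mcl_def prefix_def)
    with i show ?thesis by (auto simp: eventually_sequentially)
  qed
  with Q show "\<exists>e. Q \<subseteq> dom (Phi e) \<and> (\<forall>g \<in> Q. the (Phi e g) \<in> P)"
    by (intro exI[of _ "Psi e []"]) (auto simp: domIff)
next
  assume "\<exists>e. Q \<subseteq> dom (Phi e) \<and> (\<forall>g \<in> Q. the (Phi e g) \<in> P)"
  then obtain i where i: "Q \<subseteq> dom (Phi i)" "\<forall>g \<in> Q. the (Phi i g) \<in> P" by blast
  obtain c where c: "prog_of c = Search Succ" using surj_prog_of by (metis surjD)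
  have "run s g (Search Succ) n = None" for s g n
  proof (induction s arbitrary: n)
    case (Suc s)
    have "run s g Succ n \<noteq> Some 0" by (cases s) auto
    with Suc show ?case
      by (cases "prod_decode n"; cases "run s g Succ n") auto
  qed simp
  then have P: "Psi (prod_encode (i, c)) \<sigma> = i" for \<sigma>
    by (simp add: Psi_def converged_def string_run_def c)
  have "learn_computable 1 1 \<infinity> (Phi i)"
    unfolding learn_computable_def
    by (rule exI[of _ "{prod_encode (i, c)}"])
      (auto simp: P ecard_def mcl_def one_enat_def)
  with i show "medvedev_reducible P Q" unfolding reducible_def by blast
qed


section \<open>Backtracking\<close>

text \<open>The alphabet \<open>\<nat> \<union> {\<sharp>}\<close> is \<^typ>\<open>nat option\<close> with \<^const>\<open>None\<close> in the role of \<open>\<sharp>\<close>.\<close>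

definition sharps :: "(nat \<Rightarrow> nat option) \<Rightarrow> nat set" where
  "sharps f = {n. f n = None}"

definition tail :: "(nat \<Rightarrow> nat option) \<Rightarrow> nat \<Rightarrow> nat" where
  "tail f k = the (f ((LEAST n. \<forall>j \<ge> n. f j \<noteq> None) + k))"

fun option_code :: "nat option \<Rightarrow> nat" where
  "option_code None = 0"
| "option_code (Some n) = Suc n"

lemma bij_option_code: "bij option_code"
proof (rule o_bij)
  show "(\<lambda>n. case n of 0 \<Rightarrow> None | Suc k \<Rightarrow> Some k) \<circ> option_code = id"
  proof
    fix x :: "nat option"
    show "((\<lambda>n. case n of 0 \<Rightarrow> None | Suc k \<Rightarrow> Some k) \<circ> option_code) x = id x"
      by (cases x) auto
  qed
  show "option_code \<circ> (\<lambda>n. case n of 0 \<Rightarrow> None | Suc k \<Rightarrow> Some k) = id"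
    by (rule ext) (auto split: nat.split)
qed

definition LCM3_seqs :: "(nat \<Rightarrow> nat) set \<Rightarrow> (nat \<Rightarrow> nat option) set" where
  "LCM3_seqs P = {f. finite (sharps f) \<and> tail f 0 \<in> {0, 1} \<and> (\<lambda>k. tail f (Suc k)) \<in> P}"

definition LCM3 :: "(nat \<Rightarrow> nat) set \<Rightarrow> (nat \<Rightarrow> nat) set" where
  "LCM3 P = (\<lambda>f. option_code \<circ> f) ` LCM3_seqs P"

definition LCM3_bounded :: "nat \<Rightarrow> (nat \<Rightarrow> nat) set \<Rightarrow> (nat \<Rightarrow> nat) set" where
  "LCM3_bounded m P = (\<lambda>f. option_code \<circ> f) ` {f \<in> LCM3_seqs P. card (sharps f) < m}"


section \<open>Several tapes\<close>

definition tape :: "nat \<Rightarrow> (nat \<Rightarrow> nat \<times> nat) \<Rightarrow> nat set" where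
  "tape i f = {n. fst (f n) = i}"

text \<open>\<open>pr i f\<close> is meaningful only if \<^term>\<open>tape i f\<close> is infinite.\<close>

definition pr :: "nat \<Rightarrow> (nat \<Rightarrow> nat \<times> nat) \<Rightarrow> nat \<Rightarrow> nat" where
  "pr i f k = snd (f (enumerate (tape i f) k))"

definition mc :: "(nat \<Rightarrow> nat \<times> nat) \<Rightarrow> enat" where
  "mc f = ecard {n. fst (f n) \<noteq> fst (f (n + 1))}"

text \<open>Each alphabet \<open>m \<times> \<nat>\<close> with \<open>m > 0\<close> is identified with \<open>\<nat>\<close> by its own bijection,
  division with remainder by \<open>m\<close>. In particular, the members of a union over \<open>m\<close> of sets of
  sequences over \<open>m \<times> \<nat>\<close> are read with a bijection depending on \<open>m\<close>.\<close>

definition tape_code :: "nat \<Rightarrow> nat \<times> nat \<Rightarrow> nat" where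
  "tape_code m = (\<lambda>(i, v). m * v + i)"

lemma bij_betw_tape_code:
  assumes "m > 0"
  shows "bij_betw (tape_code m) ({..<m} \<times> UNIV) UNIV"
  by (rule bij_betw_byWitness[where f' = "\<lambda>n. (n mod m, n div m)"])
    (use assms in \<open>auto simp: tape_code_def\<close>)

definition CL2_seqs :: "nat \<Rightarrow> (nat \<Rightarrow> nat) set \<Rightarrow> (nat \<Rightarrow> nat \<times> nat) set" where
  "CL2_seqs m P =
     {f. (\<forall>n. fst (f n) < m) \<and> (\<exists>i < m. infinite (tape i f) \<and> pr i f \<in> P)}"

definition CL2 :: "nat \<Rightarrow> (nat \<Rightarrow> nat) set \<Rightarrow> (nat \<Rightarrow> nat) set" where
  "CL2 m P = (\<lambda>f. tape_code m \<circ> f) ` CL2_seqs m P"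

definition LCM2 :: "nat \<Rightarrow> (nat \<Rightarrow> nat) set \<Rightarrow> (nat \<Rightarrow> nat) set" where
  "LCM2 m P = (\<lambda>f. tape_code m \<circ> f) ` {f \<in> CL2_seqs m P. mc f < \<infinity>}"

end

theory Submission
  imports Defs
begin

text \<open>
  In one direction a computable function simulates the learners and writes down the values of the
  functions with the guessed indices. While it waits for the next value it watches for a mind
  change, so it gets stuck only if a limit index yields a partial function. A mind change becomes
  \<open>\<sharp>\<close> and a restart, or a switch to the tape that belongs to the new guess; finitely many functions
  are dovetailed, each on its own tape. For infinitely many functions the tapes
  \<open>2 ^ j\<close> out of \<open>2 ^ (j + 1)\<close> are used: under the codings of the alphabets they are disjoint.

  In the other direction a learner simulates the given reduction with the finite part of the oracle
  that it has seen, and guesses that the last \<open>\<sharp>\<close>, or the last used tape, seen so far is final. The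
  number of its mind changes is at most the number of \<open>\<sharp>\<close>, and it has at most one guess for each tape.
  Statement (5) is obtained from (3) and (4) applied one after the other.

  Both need a universal function: the value of a program at a given recursion depth is found by a
  search for a finite set of intermediate values in which each is justified by the others.
\<close>

section \<open>Computable functions relative to an oracle\<close>

text \<open>The bounds have to survive, not only the limits. The enumerated learners
  \<open>Psi\<close> give every guess with a delay, so each learner constructed below is compared
  with the intended one through a delay that is monotone, which adds no mind changes, and unbounded,
  which keeps the limit. Partiality is treated by relativizing computability to a set
  \<open>D\<close> of oracles: a construction has to yield an infinite output only where some limit
  index gives a total function. Evaluation accepts a partial oracle. One universal function thus
  serves both for the whole oracle, when values are written down, and for a finite prefix, when a
  learner has to act. Certificates replace a simultaneous recursion on depth, programs and inputs,
  whereas primitive recursion as available here runs on a single number; undefinedness at a given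
  depth is certified as well, so the search for a certificate always ends. For infinitely many
  functions the obstacle is that the coding of the tapes depends on their number, while a reduction
  cannot know with which number its output will be read. The symbols written for one function must
  therefore be recognizable modulo a number that belongs to this function alone.\<close>

abbreviation pfst :: "nat \<Rightarrow> nat" where "pfst n \<equiv> fst (prod_decode n)"
abbreviation psnd :: "nat \<Rightarrow> nat" where "psnd n \<equiv> snd (prod_decode n)"

section \<open>Evaluation rules for single program constructors\<close>

lemma computes_Tuple:
  assumes "computes g p n x" "computes g q n y"
  shows "computes g (Tuple p q) n (prod_encode (x, y))"
proof -
  from assms obtain s t where "run s g p n = Some x" "run t g q n = Some y"
    by (auto simp: computes_def)
  then have "run (max s t) g p n = Some x" "run (max s t) g q n = Some y"
    by (auto intro: run_mono)
  then show ?thesis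
    by (auto simp: computes_def intro!: exI[of _ "Suc (max s t)"])
qed

lemma computes_Comp:
  assumes "computes g q n x" "computes g p x y"
  shows "computes g (Comp p q) n y"
proof -
  from assms obtain s t where "run s g q n = Some x" "run t g p x = Some y"
    by (auto simp: computes_def)
  then have "run (max s t) g q n = Some x" "run (max s t) g p x = Some y"
    by (auto intro: run_mono)
  then show ?thesis
    by (auto simp: computes_def intro!: exI[of _ "Suc (max s t)"])
qed

lemma computes_PrimRec_0:
  assumes "computes g p x y"
  shows "computes g (PrimRec p q) (prod_encode (x, 0)) y"
proof -
  from assms obtain s where "run s g p x = Some y"
    by (auto simp: computes_def)
  then show ?thesis
    by (auto simp: computes_def intro!: exI[of _ "Suc s"])
qed

lemma computes_PrimRec_Suc:
  assumes "computes g (PrimRec p q) (prod_encode (x, k)) r"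
    and "computes g q (prod_encode (x, prod_encode (k, r))) y"
  shows "computes g (PrimRec p q) (prod_encode (x, Suc k)) y"
proof -
  from assms obtain s t where "run s g (PrimRec p q) (prod_encode (x, k)) = Some r"
    "run t g q (prod_encode (x, prod_encode (k, r))) = Some y"
    by (auto simp: computes_def)
  then have "run (max s t) g (PrimRec p q) (prod_encode (x, k)) = Some r"
    "run (max s t) g q (prod_encode (x, prod_encode (k, r))) = Some y"
    by (auto intro: run_mono)
  then show ?thesis
    unfolding computes_def by (intro exI[of _ "Suc (max s t)"]) simp
qed

lemma computes_Search_0:
  assumes "computes g p (prod_encode (x, k)) 0"
  shows "computes g (Search p) (prod_encode (x, k)) k"
proof -
  from assms obtain s where "run s g p (prod_encode (x, k)) = Some 0"
    by (auto simp: computes_def)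
  then show ?thesis
    by (auto simp: computes_def intro!: exI[of _ "Suc s"])
qed

lemma computes_Search_Suc:
  assumes "computes g p (prod_encode (x, k)) (Suc r)"
    and "computes g (Search p) (prod_encode (x, Suc k)) y"
  shows "computes g (Search p) (prod_encode (x, k)) y"
proof -
  from assms obtain s t where "run s g p (prod_encode (x, k)) = Some (Suc r)"
    "run t g (Search p) (prod_encode (x, Suc k)) = Some y"
    by (auto simp: computes_def)
  then have "run (max s t) g p (prod_encode (x, k)) = Some (Suc r)"
    "run (max s t) g (Search p) (prod_encode (x, Suc k)) = Some y"
    by (auto intro: run_mono)
  then show ?thesis
    unfolding computes_def by (intro exI[of _ "Suc (max s t)"]) simp
qed

lemma computes_basic:
  "computes g Zero n 0" "computes g Succ n (Suc n)" "computes g Fst n (pfst n)"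
  "computes g Snd n (psnd n)" "computes g Query n (g n)"
  by (auto simp: computes_def intro!: exI[of _ "Suc 0"])

text \<open>In the closure rules for binders the bound variable is paired with the input.\<close>

definition rec_on :: "(nat \<Rightarrow> nat) set \<Rightarrow> ((nat \<Rightarrow> nat) \<Rightarrow> nat \<Rightarrow> nat) \<Rightarrow> bool" where
  "rec_on D F \<longleftrightarrow> (\<exists>p. \<forall>g \<in> D. \<forall>n. computes g p n (F g n))"

lemma rec_onI: "(\<And>g n. g \<in> D \<Longrightarrow> computes g p n (F g n)) \<Longrightarrow> rec_on D F"
  unfolding rec_on_def by blast

lemma rec_onE:
  assumes "rec_on D F"
  obtains p where "\<And>g n. g \<in> D \<Longrightarrow> computes g p n (F g n)"
  using assms unfolding rec_on_def by blast

lemma rec_on_Phi: "rec_on D F \<longleftrightarrow> (\<exists>e. \<forall>g \<in> D. Phi e g = Some (F g))"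
  unfolding rec_on_def Phi_eq_Some_iff by (metis surj_prog_of surjD)

lemma rec_on_cong: "rec_on D F \<Longrightarrow> (\<And>g n. g \<in> D \<Longrightarrow> F g n = G g n) \<Longrightarrow> rec_on D G"
  unfolding rec_on_def by auto

lemma rec_on_mono: "rec_on D F \<Longrightarrow> D' \<subseteq> D \<Longrightarrow> rec_on D' F"
  unfolding rec_on_def by blast

section \<open>Closure properties of functions computable on a set of oracles\<close>

named_theorems rec_intros

lemma rec_id [rec_intros]: "rec_on D (\<lambda>g n. n)"
  \<comment> \<open>Pairing is onto, so taking a number apart and pairing again is the
    identity.\<close>
  using computes_Tuple[OF computes_basic(3,4)] by (intro rec_onI[of _ "Tuple Fst Snd"]) simp

lemma rec_comp: "rec_on D F \<Longrightarrow> rec_on D A \<Longrightarrow> rec_on D (\<lambda>g n. F g (A g n))"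
  by (elim rec_onE, rule rec_onI, rule computes_Comp)

lemma rec_pair [rec_intros]:
  "rec_on D A \<Longrightarrow> rec_on D B \<Longrightarrow> rec_on D (\<lambda>g n. prod_encode (A g n, B g n))"
  by (elim rec_onE, rule rec_onI, rule computes_Tuple)

lemma rec_Suc [rec_intros]: "rec_on D A \<Longrightarrow> rec_on D (\<lambda>g n. Suc (A g n))"
  using rec_comp[of D "\<lambda>g n. Suc n"] rec_onI[OF computes_basic(2)] by blast

lemma rec_pfst [rec_intros]: "rec_on D A \<Longrightarrow> rec_on D (\<lambda>g n. pfst (A g n))"
  using rec_comp[of D "\<lambda>g n. pfst n"] rec_onI[OF computes_basic(3)] by blast

lemma rec_psnd [rec_intros]: "rec_on D A \<Longrightarrow> rec_on D (\<lambda>g n. psnd (A g n))"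
  using rec_comp[of D "\<lambda>g n. psnd n"] rec_onI[OF computes_basic(4)] by blast

lemma rec_query [rec_intros]: "rec_on D A \<Longrightarrow> rec_on D (\<lambda>g n. g (A g n))"
  using rec_comp[of D "\<lambda>g n. g n"] rec_onI[OF computes_basic(5)] by blast

lemma rec_const [rec_intros]: "rec_on D (\<lambda>g n. c)"
proof (induction c)
  case 0 show ?case by (rule rec_onI[OF computes_basic(1)])
qed (rule rec_Suc)

lemma rec_comp2:
  assumes "rec_on D (\<lambda>g m. B g (pfst m) (psnd m))" "rec_on D A" "rec_on D C"
  shows "rec_on D (\<lambda>g n. B g (A g n) (C g n))"
  using rec_comp[OF assms(1) rec_pair[OF assms(2,3)]] by simp

lemma rec_rec_nat [rec_intros]:
  assumes A: "rec_on D A" and B: "rec_on D (\<lambda>g m. B g (pfst m) (pfst (psnd m)) (psnd (psnd m)))"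
    and K: "rec_on D K"
  shows "rec_on D (\<lambda>g n. rec_nat (A g n) (\<lambda>k r. B g n k r) (K g n))"
proof -
  from A obtain p where p: "\<And>g n. g \<in> D \<Longrightarrow> computes g p n (A g n)"
    unfolding rec_on_def by blast
  from B obtain q where
    q: "\<And>g m. g \<in> D \<Longrightarrow> computes g q m (B g (pfst m) (pfst (psnd m)) (psnd (psnd m)))"
    unfolding rec_on_def by blast
  have "computes g (PrimRec p q) (prod_encode (n, k)) (rec_nat (A g n) (\<lambda>k r. B g n k r) k)"
    if "g \<in> D" for g n k
  proof (induction k)
    case 0
    show ?case using p[OF that] by (simp add: computes_PrimRec_0)
  next
    case (Suc k)
    from computes_PrimRec_Suc[OF Suc] q[OF that]
    show ?case by (metis (no_types, lifting) fst_conv snd_conv prod_encode_inverse old.nat.simps(7))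
  qed
  then have "rec_on D (\<lambda>g m. rec_nat (A g (pfst m)) (\<lambda>k r. B g (pfst m) k r) (psnd m))"
    by (intro rec_onI[of _ "PrimRec p q"]) (metis (no_types) prod.collapse prod_decode_inverse)
  from rec_comp2[OF this rec_id K] show ?thesis .
qed

lemma rec_if [rec_intros]:
  assumes "rec_on D (\<lambda>g n. of_bool (P g n))" "rec_on D A" "rec_on D B"
  shows "rec_on D (\<lambda>g n. if P g n then A g n else B g n)"
proof -
  \<comment> \<open>A truth value is 0 or 1, so recursion on it is a case distinction.\<close>
  have "rec_on D (\<lambda>g n. rec_nat (B g n) (\<lambda>k r. A g n) (of_bool (P g n)))"
    by (intro rec_rec_nat assms rec_comp[OF assms(2)] rec_intros)
  then show ?thesis by (rule rec_on_cong) auto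
qed

lemma rec_bool_if [rec_intros]:
  assumes "rec_on D (\<lambda>g n. of_bool (P g n))" "rec_on D (\<lambda>g n. of_bool (A g n))"
    "rec_on D (\<lambda>g n. of_bool (B g n))"
  shows "rec_on D (\<lambda>g n. of_bool (if P g n then A g n else B g n))"
  by (rule rec_on_cong[OF rec_if[OF assms]]) auto

lemma rec_not [rec_intros]:
  assumes "rec_on D (\<lambda>g n. of_bool (P g n))"
  shows "rec_on D (\<lambda>g n. of_bool (\<not> P g n))"
  by (rule rec_on_cong[OF rec_if[OF assms rec_const[of _ 0] rec_const[of _ 1]]]) auto

lemma rec_conj [rec_intros]:
  assumes "rec_on D (\<lambda>g n. of_bool (P g n))" "rec_on D (\<lambda>g n. of_bool (Q g n))"
  shows "rec_on D (\<lambda>g n. of_bool (P g n \<and> Q g n))"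
  by (rule rec_on_cong[OF rec_if[OF assms rec_const[of _ 0]]]) auto

lemma rec_disj [rec_intros]:
  assumes "rec_on D (\<lambda>g n. of_bool (P g n))" "rec_on D (\<lambda>g n. of_bool (Q g n))"
  shows "rec_on D (\<lambda>g n. of_bool (P g n \<or> Q g n))"
  by (rule rec_on_cong[OF rec_if[OF assms(1) rec_const[of _ 1] assms(2)]]) auto

lemma rec_imp [rec_intros]:
  assumes "rec_on D (\<lambda>g n. of_bool (P g n))" "rec_on D (\<lambda>g n. of_bool (Q g n))"
  shows "rec_on D (\<lambda>g n. of_bool (P g n \<longrightarrow> Q g n))"
  by (rule rec_on_cong[OF rec_if[OF assms rec_const[of _ 1]]]) auto

lemma rec_Least [rec_intros]:
  assumes P: "rec_on D (\<lambda>g m. of_bool (P g (pfst m) (psnd m)))"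
    and ex: "\<And>g n. g \<in> D \<Longrightarrow> \<exists>k. P g n k"
  shows "rec_on D (\<lambda>g n. LEAST k. P g n k)"
proof -
  \<comment> \<open>\<open>Search\<close> stops at the value 0, hence the negation.\<close>
  from rec_not[OF P] obtain p where
    p: "\<And>g m. g \<in> D \<Longrightarrow> computes g p m (of_bool (\<not> P g (pfst m) (psnd m)))"
    unfolding rec_on_def by blast
  \<comment> \<open>\<open>Search\<close> counts upwards, so the induction is on the distance
    \<open>j\<close> from the least witness.\<close>
  have *: "computes g (Search p) (prod_encode (n, (LEAST k. P g n k) - j)) (LEAST k. P g n k)"
    if g: "g \<in> D" and "j \<le> (LEAST k. P g n k)" for g n j
    using that(2)
  proof (induction j)
    case 0
    have "P g n (LEAST k. P g n k)" using ex[OF g] by (rule LeastI_ex)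
    with p[OF g, of "prod_encode (n, LEAST k. P g n k)"]
    have "computes g p (prod_encode (n, LEAST k. P g n k)) 0" by simp
    then show ?case by (simp add: computes_Search_0)
  next
    case (Suc j)
    let ?k = "(LEAST k. P g n k) - Suc j"
    have "\<not> P g n ?k" using Suc.prems by (intro not_less_Least) auto
    with p[OF g, of "prod_encode (n, ?k)"]
    have "computes g p (prod_encode (n, ?k)) (Suc 0)" by simp
    moreover have "computes g (Search p) (prod_encode (n, Suc ?k)) (LEAST k. P g n k)"
      using Suc.IH Suc.prems by (simp only: Suc_diff_Suc Suc_le_lessD less_imp_le)
    ultimately show ?case by (rule computes_Search_Suc)
  qed
  obtain q where q: "\<And>g n. g \<in> D \<Longrightarrow> computes g q n (prod_encode (n, 0))"
    by (rule rec_onE[OF rec_pair[OF rec_id rec_const[of D 0]]]) blast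
  have "computes g (Comp (Search p) q) n (LEAST k. P g n k)" if "g \<in> D" for g n
    using *[OF that order_refl] by (intro computes_Comp[OF q[OF that]]) simp
  then show ?thesis by (rule rec_onI)
qed

section \<open>Arithmetic, comparisons and bounded quantifiers\<close>

lemma rec_add [rec_intros]: "rec_on D A \<Longrightarrow> rec_on D B \<Longrightarrow> rec_on D (\<lambda>g n. A g n + B g n)"
proof (goal_cases)
  case 1
  have "rec_on D (\<lambda>g n. rec_nat (A g n) (\<lambda>k r. Suc r) (B g n))"
    by (intro 1 rec_intros)
  moreover have "rec_nat a (\<lambda>k r. Suc r) b = a + b" for a b by (induction b) auto
  ultimately show ?case by simp
qed

lemma rec_diff [rec_intros]: "rec_on D A \<Longrightarrow> rec_on D B \<Longrightarrow> rec_on D (\<lambda>g n. A g n - B g n)"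
proof (goal_cases)
  case 1
  \<comment> \<open>The inner recursion is the predecessor: at \<open>Suc k\<close> its last counter
    is \<open>k\<close>, and at 0 it gives 0.\<close>
  have "rec_on D (\<lambda>g n. rec_nat (A g n) (\<lambda>k r. rec_nat 0 (\<lambda>k r. k) r) (B g n))"
    by (intro 1 rec_intros)
  moreover have "rec_nat 0 (\<lambda>k r. k) r = r - 1" for r by (cases r) auto
  moreover have "rec_nat a (\<lambda>k r. r - 1) b = a - b" for a b :: nat by (induction b) auto
  ultimately show ?case by simp
qed

lemma rec_mult [rec_intros]: "rec_on D A \<Longrightarrow> rec_on D B \<Longrightarrow> rec_on D (\<lambda>g n. A g n * B g n)"
proof (goal_cases)
  case 1
  have "rec_on D (\<lambda>g n. rec_nat 0 (\<lambda>k r. A g n + r) (B g n))"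
    by (intro 1 rec_intros rec_comp[OF 1(1)])
  moreover have "rec_nat 0 (\<lambda>k r. a + r) b = a * b" for a b :: nat by (induction b) auto
  ultimately show ?case by simp
qed

lemma rec_power [rec_intros]: "rec_on D A \<Longrightarrow> rec_on D B \<Longrightarrow> rec_on D (\<lambda>g n. A g n ^ B g n)"
proof (goal_cases)
  case 1
  have "rec_on D (\<lambda>g n. rec_nat 1 (\<lambda>k r. A g n * r) (B g n))"
    by (intro 1 rec_intros rec_comp[OF 1(1)])
  moreover have "rec_nat 1 (\<lambda>k r. a * r) b = a ^ b" for a b :: nat by (induction b) auto
  ultimately show ?case by simp
qed

lemma rec_eq0: "rec_on D A \<Longrightarrow> rec_on D (\<lambda>g n. of_bool (A g n = 0))"
proof (goal_cases)
  case 1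
  have "rec_on D (\<lambda>g n. rec_nat 1 (\<lambda>k r. 0) (A g n))"
    by (intro 1 rec_intros)
  moreover have "rec_nat 1 (\<lambda>k r. 0) a = (of_bool (a = 0) :: nat)" for a by (cases a) auto
  ultimately show ?case by simp
qed

lemma rec_le [rec_intros]:
  "rec_on D A \<Longrightarrow> rec_on D B \<Longrightarrow> rec_on D (\<lambda>g n. of_bool (A g n \<le> B g n))"
  using rec_eq0[OF rec_diff, of D A B] by simp

lemma rec_less [rec_intros]:
  "rec_on D A \<Longrightarrow> rec_on D B \<Longrightarrow> rec_on D (\<lambda>g n. of_bool (A g n < B g n))"
  using rec_not[OF rec_le, of D B A] by (simp add: not_le)

lemma rec_eq [rec_intros]:
  "rec_on D A \<Longrightarrow> rec_on D B \<Longrightarrow> rec_on D (\<lambda>g n. of_bool (A g n = B g n))"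
  using rec_conj[OF rec_le rec_le, of D A B B A] by (simp add: eq_iff)

lemma rec_div [rec_intros]:
  assumes "rec_on D A" "rec_on D B"
  shows "rec_on D (\<lambda>g n. A g n div B g n)"
proof -
  \<comment> \<open>The disjunct \<open>b = 0\<close> keeps the search total and yields 0, the value
    of a division by 0.\<close>
  have ex: "\<exists>k. b = 0 \<or> a < b * Suc k" for a b :: nat
    by (cases b) (auto intro!: exI[of _ a])
  have "(LEAST k. b = 0 \<or> a < b * Suc k) = a div b" for a b :: nat
  proof (cases "b = 0")
    case False
    then have "a < b * Suc (a div b)" using dividend_less_times_div[of b a] by simp
    moreover have "a div b \<le> k" if "a < b * Suc k" for k
    proof -
      have "a div b < Suc k" using that by (intro less_mult_imp_div_less) (simp only: mult.commute)
      then show ?thesis by simp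
    qed
    ultimately show ?thesis using False by (intro Least_equality) auto
  qed simp
  moreover have "rec_on D (\<lambda>g n. LEAST k. B g n = 0 \<or> A g n < B g n * Suc k)"
    by (intro rec_intros rec_comp[OF assms(1)] rec_comp[OF assms(2)] ex)
  ultimately show ?thesis by simp
qed

lemma rec_mod [rec_intros]:
  assumes "rec_on D A" "rec_on D B"
  shows "rec_on D (\<lambda>g n. A g n mod B g n)"
proof -
  have "rec_on D (\<lambda>g n. A g n - B g n * (A g n div B g n))"
    by (intro rec_intros assms)
  then show ?thesis by (simp add: minus_mult_div_eq_mod)
qed

lemma rec_Bex_less [rec_intros]:
  assumes "rec_on D (\<lambda>g m. of_bool (P g (pfst m) (psnd m)))" "rec_on D K"
  shows "rec_on D (\<lambda>g n. of_bool (\<exists>k < K g n. P g n k))"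
proof -
  have "rec_nat 0 (\<lambda>k r. if P k \<or> 0 < r then 1 else 0) K = (of_bool (\<exists>k < K. P k) :: nat)" for P K
    by (induction K) (auto simp: less_Suc_eq)
  moreover have "rec_on D (\<lambda>g n. rec_nat 0 (\<lambda>k r. if P g n k \<or> 0 < r then 1 else 0) (K g n))"
    by (intro rec_intros assms rec_comp2[OF assms(1)])
  ultimately show ?thesis by simp
qed

lemma rec_Ball_less [rec_intros]:
  assumes "rec_on D (\<lambda>g m. of_bool (P g (pfst m) (psnd m)))" "rec_on D K"
  shows "rec_on D (\<lambda>g n. of_bool (\<forall>k < K g n. P g n k))"
  using rec_not[OF rec_Bex_less[OF rec_not[OF assms(1)] assms(2)]] by simp

lemma rec_card [rec_intros]:
  assumes "rec_on D (\<lambda>g m. of_bool (P g (pfst m) (psnd m)))" "rec_on D K"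
  shows "rec_on D (\<lambda>g n. card {k. k < K g n \<and> P g n k})"
proof -
  have "rec_nat 0 (\<lambda>k r. if P k then Suc r else r) K = card {k. k < K \<and> P k}" for P K
  proof (induction K)
    case (Suc K)
    have "{k. k < Suc K \<and> P k} = (if P K then insert K {k. k < K \<and> P k} else {k. k < K \<and> P k})"
      by (auto simp: less_Suc_eq)
    with Suc show ?case by simp
  qed simp
  moreover have "rec_on D (\<lambda>g n. rec_nat 0 (\<lambda>k r. if P g n k then Suc r else r) (K g n))"
    by (intro rec_intros assms rec_comp2[OF assms(1)])
  ultimately show ?thesis by simp
qed

lemma rec_set_decode [rec_intros]:
  assumes "rec_on D A" "rec_on D B"
  shows "rec_on D (\<lambda>g n. of_bool (A g n \<in> set_decode (B g n)))"
proof -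
  have "rec_on D (\<lambda>g n. of_bool (\<not> B g n div 2 ^ A g n mod 2 = 0))"
    by (intro rec_intros assms)
  then show ?thesis by (simp add: set_decode_def even_iff_mod_2_eq_zero)
qed

section \<open>Functions with optional values\<close>

lemma rec_Some [rec_intros]: "rec_on D A \<Longrightarrow> rec_on D (\<lambda>g n. option_code (Some (A g n)))"
  by (simp add: rec_Suc)

lemma rec_option_if [rec_intros]:
  assumes "rec_on D (\<lambda>g n. of_bool (P g n))" "rec_on D (\<lambda>g n. option_code (A g n))"
    "rec_on D (\<lambda>g n. option_code (B g n))"
  shows "rec_on D (\<lambda>g n. option_code (if P g n then A g n else B g n))"
  by (rule rec_on_cong[OF rec_if[OF assms]]) auto

lemma rec_case_option [rec_intros]:
  assumes "rec_on D (\<lambda>g n. option_code (A g n))" "rec_on D C"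
    "rec_on D (\<lambda>g m. B g (pfst m) (psnd m))"
  shows "rec_on D (\<lambda>g n. case A g n of None \<Rightarrow> C g n | Some v \<Rightarrow> B g n v)"
proof -
  \<comment> \<open>\<open>Some v\<close> has the code \<open>Suc v\<close>, so the last counter of
    the recursion is \<open>v\<close>.\<close>
  have "rec_on D (\<lambda>g n. rec_nat (C g n) (\<lambda>k r. B g n k) (option_code (A g n)))"
    by (intro rec_intros assms rec_comp2[OF assms(3)])
  then show ?thesis by (rule rec_on_cong) (auto split: option.split)
qed

lemma rec_eq_None [rec_intros]:
  assumes "rec_on D (\<lambda>g n. option_code (A g n))"
  shows "rec_on D (\<lambda>g n. of_bool (A g n = None))"
proof -
  have "rec_on D (\<lambda>g n. of_bool (option_code (A g n) = 0))"
    by (intro rec_intros assms)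
  moreover have "option_code x = 0 \<longleftrightarrow> x = None" for x by (cases x) auto
  ultimately show ?thesis by simp
qed

section \<open>A universal function\<close>

text \<open>\<open>R\<close> supplies the results at the next smaller depth. The oracle
  \<open>h\<close> is partial, and a query that it does not answer is undefined; this permits
  evaluation from a finite part of an oracle.\<close>

definition eval_step ::
  "(nat \<Rightarrow> nat \<Rightarrow> nat option) \<Rightarrow> (nat \<Rightarrow> nat option) \<Rightarrow> nat \<Rightarrow> nat \<Rightarrow> nat option" where
  "eval_step R h p x =
     (if pfst p = 0 then Some 0
      else if pfst p = 1 then Some (Suc x)
      else if pfst p = 2 then Some (pfst x)
      else if pfst p = 3 then Some (psnd x)
      else if pfst p = 4 then h x
      else if pfst p = 5 then
        Option.bind (R (pfst (psnd p)) x) (\<lambda>u.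
          Option.bind (R (psnd (psnd p)) x) (\<lambda>v. Some (prod_encode (u, v))))
      else if pfst p = 6 then Option.bind (R (psnd (psnd p)) x) (R (pfst (psnd p)))
      else if pfst p = 7 then
        (if psnd x = 0 then R (pfst (psnd p)) (pfst x)
         else Option.bind (R p (prod_encode (pfst x, psnd x - 1)))
           (\<lambda>r. R (psnd (psnd p)) (prod_encode (pfst x, prod_encode (psnd x - 1, r)))))
      else Option.bind (R (psnd p) x)
        (\<lambda>r. if r = 0 then Some (psnd x) else R p (prod_encode (pfst x, Suc (psnd x)))))"

primrec eval :: "nat \<Rightarrow> (nat \<Rightarrow> nat option) \<Rightarrow> nat \<Rightarrow> nat \<Rightarrow> nat option" where
  "eval 0 h = (\<lambda>p x. None)"
| "eval (Suc s) h = eval_step (eval s h) h"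

lemma eval_eq_run: "eval s (\<lambda>q. Some (g q)) p x = run s g (prog_of p) x"
proof (induction s arbitrary: p x)
  case (Suc s)
  have *: "eval s (\<lambda>q. Some (g q)) = (\<lambda>p. run s g (prog_of p))" using Suc by blast
  consider "pfst p < 7" | "pfst p = 7" | "pfst p > 7" by linarith
  then show ?case
  proof cases
    case 1
    then have "pfst p \<in> {0, 1, 2, 3, 4, 5, 6}" by auto
    then show ?thesis
      by (subst prog_of.simps) (auto simp: * eval_step_def split: prod.split)
  next
    case 2
    then have p: "prog_of p = PrimRec (prog_of (pfst (psnd p))) (prog_of (psnd (psnd p)))"
      by (subst prog_of.simps) (auto split: prod.split)
    show ?thesis
      using 2 by (auto simp: * eval_step_def p split: prod.split nat.split)
  next
    case 3
    then have p: "prog_of p = Search (prog_of (psnd p))"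
      by (subst prog_of.simps) (auto split: prod.split)
    show ?thesis
      using 3 by (simp add: * eval_step_def p case_prod_beta cong: if_cong)
  qed
qed simp

text \<open>A defined value rests on finitely many values of \<open>R\<close> and \<open>h\<close>.
  Stated for an arbitrary filter, this continuity covers monotonicity in the oracle and in the depth
  (constant families) as well as convergence along growing prefixes.\<close>

lemma eval_step_eventually:
  assumes y: "eval_step R h p x = Some y"
    and h: "\<And>q v. h q = Some v \<Longrightarrow> \<forall>\<^sub>F i in F. h' i q = Some v"
    and R: "\<And>p x v. R p x = Some v \<Longrightarrow> \<forall>\<^sub>F i in F. R' i p x = Some v"
  shows "\<forall>\<^sub>F i in F. eval_step (R' i) (h' i) p x = Some y"
proof -
  consider "pfst p < 4" | "pfst p = 4" | "pfst p = 5" | "pfst p = 6" | "pfst p = 7" | "pfst p > 7"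
    by linarith
  then show ?thesis
  proof cases
    case 1
    then have "pfst p \<in> {0, 1, 2, 3}" by auto
    with y show ?thesis by (auto simp: eval_step_def)
  next
    case 2
    with y h show ?thesis by (simp add: eval_step_def)
  next
    case 3
    with y obtain u v where "R (pfst (psnd p)) x = Some u" "R (psnd (psnd p)) x = Some v"
      and yv: "y = prod_encode (u, v)"
      by (auto simp: eval_step_def bind_eq_Some_conv)
    from this(1,2)[THEN R] show ?thesis
      by eventually_elim (simp add: eval_step_def 3 yv)
  next
    case 4
    with y obtain u where "R (psnd (psnd p)) x = Some u" "R (pfst (psnd p)) u = Some y"
      by (auto simp: eval_step_def bind_eq_Some_conv)
    from this[THEN R] show ?thesis
      by eventually_elim (simp add: eval_step_def 4)
  next
    case 5
    show ?thesis
    proof (cases "psnd x = 0")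
      case True
      with y 5 have "R (pfst (psnd p)) (pfst x) = Some y" by (simp add: eval_step_def)
      from this[THEN R] show ?thesis by eventually_elim (simp add: eval_step_def 5 True)
    next
      case False
      with y 5 obtain r where "R p (prod_encode (pfst x, psnd x - 1)) = Some r"
        "R (psnd (psnd p)) (prod_encode (pfst x, prod_encode (psnd x - 1, r))) = Some y"
        by (auto simp: eval_step_def bind_eq_Some_conv)
      from this[THEN R] show ?thesis by eventually_elim (use False in \<open>simp add: eval_step_def 5\<close>)
    qed
  next
    case 6
    with y obtain r where r: "R (psnd p) x = Some r"
      and *: "(if r = 0 then Some (psnd x) else R p (prod_encode (pfst x, Suc (psnd x)))) = Some y"
      by (auto simp: eval_step_def bind_eq_Some_conv)
    show ?thesis
    proof (cases "r = 0")
      case True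
      from R[OF r] show ?thesis by eventually_elim (use * 6 True in \<open>simp add: eval_step_def\<close>)
    next
      case False
      with * have "R p (prod_encode (pfst x, Suc (psnd x))) = Some y" by simp
      from R[OF r] R[OF this] show ?thesis
        by eventually_elim (use 6 False in \<open>simp add: eval_step_def\<close>)
    qed
  qed
qed

lemma eval_eventually:
  assumes "eval s h p x = Some y"
    and "\<And>q v. h q = Some v \<Longrightarrow> \<forall>\<^sub>F i in F. h' i q = Some v"
  shows "\<forall>\<^sub>F i in F. eval s (h' i) p x = Some y"
  using assms(1)
proof (induction s arbitrary: p x y)
  case (Suc s)
  from Suc.prems have "eval_step (eval s h) h p x = Some y" by simp
  from eval_step_eventually[OF this assms(2) Suc.IH] show ?case by simp
qed simp

lemma eval_oracle_mono:
  assumes "eval s h p x = Some y" "\<And>q v. h q = Some v \<Longrightarrow> h' q = Some v"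
  shows "eval s h' p x = Some y"
  using eval_eventually[where F = sequentially and h' = "\<lambda>_. h'", OF assms(1)] assms(2) by simp

lemma eval_depth_Suc: "eval s h p x = Some y \<Longrightarrow> eval (Suc s) h p x = Some y"
proof (induction s arbitrary: p x y)
  case (Suc s)
  from Suc.prems have "eval_step (eval s h) h p x = Some y" by simp
  from eval_step_eventually[where F = sequentially and h' = "\<lambda>_. h" and R' = "\<lambda>_. eval (Suc s) h", OF this]
  show ?case using Suc.IH by (simp del: eval.simps(2) add: eval.simps(2)[of "Suc s"])
qed simp

lemma eval_depth_mono: "eval s h p x = Some y \<Longrightarrow> s \<le> s' \<Longrightarrow> eval s' h p x = Some y"
  by (rotate_tac, induction s' rule: dec_induct) (auto intro: eval_depth_Suc simp del: eval.simps)

section \<open>Certificates of evaluations\<close>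

text \<open>A finite set of codes of quadruples (depth, program, input, result) certifies the values of
  \<^const>\<open>eval\<close> if each of its elements is justified by other elements of smaller depth.\<close>

abbreviation entry :: "nat \<Rightarrow> nat \<Rightarrow> nat \<Rightarrow> nat \<Rightarrow> nat" where
  "entry s p x r \<equiv> prod_encode (prod_encode (s, prod_encode (p, x)), r)"

text \<open>Results are stored by \<open>option_code\<close>: \<open>u = 0\<close> is an undefined
  intermediate result and forces \<open>r = 0\<close>, otherwise \<open>K\<close> receives the
  value. The bound \<open>N\<close> makes the quantifier over \<open>u\<close> bounded, so that
  justification is decidable.\<close>

definition cert_bind ::
  "nat \<Rightarrow> nat set \<Rightarrow> nat \<Rightarrow> nat \<Rightarrow> nat \<Rightarrow> (nat \<Rightarrow> bool) \<Rightarrow> nat \<Rightarrow> bool" where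
  "cert_bind N T s p x K r \<longleftrightarrow>
     (\<exists>u<N. entry s p x u \<in> T \<and> (if u = 0 then r = 0 else K (u - 1)))"

text \<open>Undefined results need certificates too, since evaluation at a fixed depth always has an
  outcome. They originate at depth 0 and at unanswered queries.\<close>

definition justified ::
  "(nat \<Rightarrow> nat option) \<Rightarrow> nat \<Rightarrow> nat set \<Rightarrow> nat \<Rightarrow> nat \<Rightarrow> nat \<Rightarrow> nat \<Rightarrow> bool" where
  "justified h N T s p x r \<longleftrightarrow>
     (if s = 0 then r = 0
      else if pfst p = 0 then r = 1
      else if pfst p = 1 then r = Suc (Suc x)
      else if pfst p = 2 then r = Suc (pfst x)
      else if pfst p = 3 then r = Suc (psnd x)
      else if pfst p = 4 then r = option_code (h x)
      else if pfst p = 5 then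
        cert_bind N T (s - 1) (pfst (psnd p)) x (\<lambda>u.
          cert_bind N T (s - 1) (psnd (psnd p)) x (\<lambda>v. r = Suc (prod_encode (u, v))) r) r
      else if pfst p = 6 then
        cert_bind N T (s - 1) (psnd (psnd p)) x (\<lambda>u. entry (s - 1) (pfst (psnd p)) u r \<in> T) r
      else if pfst p = 7 then
        (if psnd x = 0 then entry (s - 1) (pfst (psnd p)) (pfst x) r \<in> T
         else cert_bind N T (s - 1) p (prod_encode (pfst x, psnd x - 1)) (\<lambda>u.
           entry (s - 1) (psnd (psnd p)) (prod_encode (pfst x, prod_encode (psnd x - 1, u))) r \<in> T) r)
      else
        cert_bind N T (s - 1) (psnd p) x (\<lambda>u.
          if u = 0 then r = Suc (psnd x)
          else entry (s - 1) p (prod_encode (pfst x, Suc (psnd x))) r \<in> T) r)"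

definition certificate :: "(nat \<Rightarrow> nat option) \<Rightarrow> nat \<Rightarrow> nat set \<Rightarrow> bool" where
  "certificate h N T \<longleftrightarrow>
     finite T \<and> (\<forall>s p x r. entry s p x r \<in> T \<longrightarrow> justified h N T s p x r)"

lemma option_code_simps [simp]: "option_code z = 0 \<longleftrightarrow> z = None" "option_code z = Suc v \<longleftrightarrow> z = Some v"
  by (cases z; auto)+

lemma cert_bind_mono:
  assumes "cert_bind N T s p x K r" "N \<le> N'" "T \<subseteq> T'" "\<And>u. K u \<Longrightarrow> K' u"
  shows "cert_bind N' T' s p x K' r"
proof -
  from assms(1) obtain u where "u < N" "entry s p x u \<in> T" "if u = 0 then r = 0 else K (u - 1)"
    unfolding cert_bind_def by blast
  with assms(2-4) show ?thesis
    unfolding cert_bind_def by (intro exI[of _ u]) (auto split: if_splits)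
qed

lemma justified_mono:
  assumes "justified h N T s p x r" "N \<le> N'" "T \<subseteq> T'"
  shows "justified h N' T' s p x r"
proof -
  note T = subsetD[OF assms(3)] and m = cert_bind_mono[OF _ assms(2,3)]
  consider "s = 0" | "s > 0" "pfst p < 5" | "s > 0" "pfst p = 5" | "s > 0" "pfst p = 6" | "s > 0" "pfst p = 7"
    | "s > 0" "pfst p > 7"
    by linarith
  then show ?thesis
  proof cases
    case 1
    with assms(1) show ?thesis by (simp add: justified_def)
  next
    case 2
    then have "pfst p \<in> {0, 1, 2, 3, 4}" by auto
    with assms(1) 2(1) show ?thesis by (elim insertE) (simp_all add: justified_def)
  next
    case 3
    with assms(1) show ?thesis by (simp add: justified_def) (erule m, erule m, assumption)
  next
    case 4
    with assms(1) show ?thesis by (simp add: justified_def) (erule m, erule T)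
  next
    case 5
    with assms(1) show ?thesis
      by (cases "psnd x = 0") (simp_all add: justified_def T, erule m, erule T)
  next
    case 6
    with assms(1) show ?thesis
      by (simp add: justified_def) (erule m, auto intro: T split: if_splits)
  qed
qed

lemma certificate_union:
  assumes "certificate h N T" "certificate h N' T'"
  shows "certificate h (max N N') (T \<union> T')"
  using assms justified_mono[of h N T _ _ _ _ "max N N'" "T \<union> T'"]
    justified_mono[of h N' T' _ _ _ _ "max N N'" "T \<union> T'"]
  unfolding certificate_def by auto

lemma certificate_bound_mono: "certificate h N T \<Longrightarrow> N \<le> N' \<Longrightarrow> certificate h N' T"
  unfolding certificate_def using justified_mono by blast

lemma certificate_insert:
  assumes "certificate h N T" "justified h N T s p x r"
  shows "certificate h N (insert (entry s p x r) T)"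
proof -
  have "justified h N (insert (entry s p x r) T) s' p' x' r'"
    if "entry s' p' x' r' \<in> insert (entry s p x r) T" for s' p' x' r'
  proof -
    from that have "justified h N T s' p' x' r'"
      using assms unfolding certificate_def by (auto simp: prod_encode_eq)
    then show ?thesis by (rule justified_mono) auto
  qed
  with assms(1) show ?thesis unfolding certificate_def by auto
qed

lemma cert_bind_sound:
  assumes "cert_bind N T s p x K r" "\<And>u. entry s p x u \<in> T \<Longrightarrow> u = option_code z"
    and "\<And>v. K v \<Longrightarrow> r = option_code (k v)"
  shows "r = option_code (Option.bind z k)"
proof -
  from assms(1) obtain u where u: "entry s p x u \<in> T" "if u = 0 then r = 0 else K (u - 1)"
    unfolding cert_bind_def by blast
  from assms(2)[OF u(1)] u(2) assms(3) show ?thesis by (cases z) auto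
qed

lemma cert_bind_complete:
  assumes "entry s p x (option_code z) \<in> T" "option_code z < N"
    and "z = None \<Longrightarrow> r = 0" "\<And>v. z = Some v \<Longrightarrow> K v"
  shows "cert_bind N T s p x K r"
  using assms unfolding cert_bind_def by (intro exI[of _ "option_code z"]) (cases z; auto)

text \<open>Each justification appeals only to entries whose depth is smaller by one, so induction
  on the depth works whatever else \<open>T\<close> contains.\<close>

lemma certificate_sound:
  assumes "certificate h N T" "entry s p x r \<in> T"
  shows "r = option_code (eval s h p x)"
  using assms(2)
proof (induction s arbitrary: p x r)
  case 0
  with assms(1) have "justified h N T 0 p x r" unfolding certificate_def by blast
  then show ?case by (simp add: justified_def)
next
  case (Suc s)
  with assms(1) have j: "justified h N T (Suc s) p x r" unfolding certificate_def by blast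
  note IH = Suc.IH and b = cert_bind_sound[OF _ Suc.IH]
  consider "pfst p < 5" | "pfst p = 5" | "pfst p = 6" | "pfst p = 7" | "pfst p > 7"
    by linarith
  then show ?case
  proof cases
    case 1
    then have "pfst p \<in> {0, 1, 2, 3, 4}" by auto
    with j show ?thesis by (elim insertE) (simp_all add: justified_def eval_step_def)
  next
    case 2
    with j show ?thesis by (simp add: justified_def eval_step_def) (erule b, assumption, erule b, auto)
  next
    case 3
    with j show ?thesis by (simp add: justified_def eval_step_def) (erule b, assumption, erule IH)
  next
    case 4
    with j show ?thesis
      by (cases "psnd x = 0") (simp_all add: justified_def eval_step_def IH, erule b, assumption, erule IH)
  next
    case 5
    with j show ?thesis
      by (simp add: justified_def eval_step_def) (erule b, assumption, auto simp: IH split: if_splits)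
  qed
qed

lemma certificate_exists:
  "\<exists>N T. certificate h N T \<and> entry s p x (option_code (eval s h p x)) \<in> T"
proof (induction s arbitrary: p x)
  case 0
  have "certificate h 0 {entry 0 p x 0}"
    by (auto simp: certificate_def justified_def prod_encode_eq)
  then show ?case by auto
next
  case (Suc s)
  define e where "e = (\<lambda>p x. option_code (eval s h p x))"
  \<comment> \<open>The induction hypothesis certifies one evaluation; for finitely many the
    certificates are united and \<open>N\<close> is raised above the results.\<close>
  have many: "\<exists>N T. certificate h N T \<and> (\<forall>(p, x) \<in> W. entry s p x (e p x) \<in> T \<and> e p x < N)"
    if "finite W" for W
    using that
  proof induction
    case empty
    have "certificate h 0 {}" by (simp add: certificate_def)
    then show ?case by auto
  next
    case (insert w W)
    obtain p x where w: "w = (p, x)" by fastforce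
    from insert obtain N T where 1: "certificate h N T" "\<forall>(p, x) \<in> W. entry s p x (e p x) \<in> T \<and> e p x < N"
      by blast
    obtain N' T' where 2: "certificate h N' T'" "entry s p x (e p x) \<in> T'"
      using Suc.IH[of p x] unfolding e_def by blast
    have "certificate h (max (max N N') (Suc (e p x))) (T \<union> T')"
      by (rule certificate_bound_mono[OF certificate_union[OF 1(1) 2(1)]]) simp
    then show ?case
      using 1(2) 2(2) unfolding w
      by (intro exI[of _ "max (max N N') (Suc (e p x))"] exI[of _ "T \<union> T'"]) auto
  qed
  let ?a = "pfst (psnd p)" and ?b = "psnd (psnd p)"
  let ?y = "prod_encode (pfst x, psnd x - 1)"
  \<comment> \<open>All calls that any kind of program can make at \<open>x\<close>. Two of them
    depend on an intermediate result: \<open>e ?b x - 1\<close> and \<open>e p ?y - 1\<close> are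
    its value if it is defined, and a harmless default otherwise.\<close>
  define W where "W = {(?a, x), (?b, x), (psnd p, x), (?a, pfst x), (p, ?y),
      (p, prod_encode (pfst x, Suc (psnd x))), (?a, e ?b x - 1),
      (?b, prod_encode (pfst x, prod_encode (psnd x - 1, e p ?y - 1)))}"
  have "finite W" by (simp add: W_def)
  from many[OF this] obtain N T where C: "certificate h N T"
    and W: "\<forall>(p, x) \<in> W. entry s p x (e p x) \<in> T \<and> e p x < N" by blast
  note * = W[unfolded W_def]
  have "justified h N T (Suc s) p x (option_code (eval (Suc s) h p x))"
  proof -
    consider "pfst p < 5" | "pfst p = 5" | "pfst p = 6" | "pfst p = 7" | "pfst p > 7"
      by linarith
    then show ?thesis
    proof cases
      case 1
      then have "pfst p \<in> {0, 1, 2, 3, 4}" by auto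
      then show ?thesis by (elim insertE) (simp_all add: justified_def eval_step_def)
    next
      case 2
      with * show ?thesis
        by (auto simp: justified_def eval_step_def e_def intro!: cert_bind_complete)
    next
      case 3
      with * show ?thesis
        by (auto simp: justified_def eval_step_def e_def intro!: cert_bind_complete)
    next
      case 4
      with * show ?thesis
        by (auto simp: justified_def eval_step_def e_def intro!: cert_bind_complete)
    next
      case 5
      with * show ?thesis
        by (auto simp: justified_def eval_step_def e_def intro!: cert_bind_complete)
    qed
  qed
  from certificate_insert[OF C this] show ?case by blast
qed

section \<open>Computability of evaluation\<close>

lemma rec_cert_bind [rec_intros]:
  assumes "rec_on D (\<lambda>g m. of_bool (K g (pfst m) (psnd m)))"
    and "rec_on D N" "rec_on D T" "rec_on D s" "rec_on D p" "rec_on D x" "rec_on D r"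
  shows "rec_on D (\<lambda>g n. of_bool (cert_bind (N g n) (set_decode (T g n)) (s g n) (p g n) (x g n)
           (\<lambda>u. K g n u) (r g n)))"
  unfolding cert_bind_def
  by (intro rec_intros assms rec_comp2[OF assms(1)] assms(2-)[THEN rec_comp])

lemma rec_justified [rec_intros]:
  assumes "rec_on D (\<lambda>g m. option_code (h g (pfst m) (psnd m)))"
    and "rec_on D N" "rec_on D T" "rec_on D s" "rec_on D p" "rec_on D x" "rec_on D r"
  shows "rec_on D (\<lambda>g n. of_bool (justified (h g n) (N g n) (set_decode (T g n)) (s g n) (p g n) (x g n) (r g n)))"
  unfolding justified_def
  by (intro rec_intros assms rec_comp2[OF assms(1)] assms(2-)[THEN rec_comp])

lemma rec_certificate [rec_intros]:
  assumes "rec_on D (\<lambda>g m. option_code (h g (pfst m) (psnd m)))" "rec_on D N" "rec_on D T"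
  shows "rec_on D (\<lambda>g n. of_bool (certificate (h g n) (N g n) (set_decode (T g n))))"
proof -
  let ?J = "\<lambda>g n z. justified (h g n) (N g n) (set_decode (T g n)) (pfst (pfst z))
      (pfst (psnd (pfst z))) (psnd (psnd (pfst z))) (psnd z)"
  have *: "rec_on D (\<lambda>g n. of_bool (\<forall>z < T g n. z \<in> set_decode (T g n) \<longrightarrow> ?J g n z))"
    by (intro rec_intros assms rec_comp2[OF assms(1)] assms(2-)[THEN rec_comp])
  \<comment> \<open>\<open>2 ^ z\<close> is one of the summands of the code of a set containing
    \<open>z\<close>. So the quantifier over all entries becomes bounded.\<close>
  have "z < t" if "z \<in> set_decode t" for z t
  proof -
    have "2 ^ z \<le> t" using that div_less[of t "2 ^ z"] by (cases "t < 2 ^ z") (auto simp: set_decode_def)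
    then show ?thesis using less_exp order_less_le_trans by blast
  qed
  moreover have "z = entry (pfst (pfst z)) (pfst (psnd (pfst z))) (psnd (psnd (pfst z))) (psnd z)" for z
    by simp
  ultimately have "(\<forall>z < t. z \<in> set_decode t \<longrightarrow> justified h N (set_decode t) (pfst (pfst z))
      (pfst (psnd (pfst z))) (psnd (psnd (pfst z))) (psnd z)) \<longleftrightarrow> certificate h N (set_decode t)" for h N t
    unfolding certificate_def by (metis fst_conv snd_conv prod_encode_inverse finite_set_decode)
  with * show ?thesis by simp
qed

text \<open>The search is over codes of triples of result, bound and certificate. It ends because
  certificates exist for every outcome, and by soundness the result is right whichever certificate
  comes first.\<close>

lemma rec_eval [rec_intros]:
  assumes "rec_on D (\<lambda>g m. option_code (h g (pfst m) (psnd m)))"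
    and "rec_on D s" "rec_on D p" "rec_on D x"
  shows "rec_on D (\<lambda>g n. option_code (eval (s g n) (\<lambda>q. h g n q) (p g n) (x g n)))"
proof -
  define C where "C h s p x c \<longleftrightarrow> certificate h (pfst (psnd c)) (set_decode (psnd (psnd c))) \<and>
    entry s p x (pfst c) \<in> set_decode (psnd (psnd c))" for h s p x c
  have ex: "\<exists>c. C h s p x c" for h s p x
  proof -
    from certificate_exists obtain N T where
      "certificate h N T" "entry s p x (option_code (eval s h p x)) \<in> T" by blast
    moreover from this have "finite T" by (simp add: certificate_def)
    ultimately show ?thesis
      by (intro exI[of _ "prod_encode (option_code (eval s h p x), prod_encode (N, set_encode T))"])
        (simp add: C_def)
  qed
  have "pfst (LEAST c. C h s p x c) = option_code (eval s h p x)" for h s p x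
    using LeastI_ex[OF ex[of h s p x]] certificate_sound unfolding C_def by blast
  moreover have "rec_on D (\<lambda>g n. pfst (LEAST c. C (h g n) (s g n) (p g n) (x g n) c))"
    unfolding C_def
    by (intro rec_intros assms rec_comp2[OF assms(1)] assms(2-)[THEN rec_comp] ex[unfolded C_def])
  ultimately show ?thesis by simp
qed

lemma rec_run [rec_intros]:
  assumes "rec_on D s" "rec_on D p" "rec_on D x"
  shows "rec_on D (\<lambda>g n. option_code (run (s g n) g (prog_of (p g n)) (x g n)))"
  unfolding eval_eq_run[symmetric] by (intro rec_intros assms)

section \<open>Parameters, finite strings and learners\<close>

primrec subst_query :: "prog \<Rightarrow> prog \<Rightarrow> prog" where
  "subst_query q Zero = Zero"
| "subst_query q Succ = Succ"
| "subst_query q Fst = Fst"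
| "subst_query q Snd = Snd"
| "subst_query q Query = q"
| "subst_query q (Tuple a b) = Tuple (subst_query q a) (subst_query q b)"
| "subst_query q (Comp a b) = Comp (subst_query q a) (subst_query q b)"
| "subst_query q (PrimRec a b) = PrimRec (subst_query q a) (subst_query q b)"
| "subst_query q (Search a) = Search (subst_query q a)"

lemma computes_subst_query:
  assumes q: "\<And>n. computes g q n (h n)" and "computes h p n y"
  shows "computes g (subst_query q p) n y"
proof -
  from assms(2) obtain s where "run s h p n = Some y" unfolding computes_def by blast
  then show ?thesis
  proof (induction s arbitrary: p n y)
    case (Suc s)
    note IH = Suc.IH and prem = Suc.prems
    show ?case
    proof (cases p)
      case Query
      with prem q[of n] show ?thesis by simp
    next
      case (Tuple a b)
      with prem obtain u v where "run s h a n = Some u" "run s h b n = Some v"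
        "y = prod_encode (u, v)"
        by (auto simp: bind_eq_Some_conv)
      with Tuple IH show ?thesis by (simp add: computes_Tuple)
    next
      case (Comp a b)
      with prem obtain u where "run s h b n = Some u" "run s h a u = Some y"
        by (auto simp: bind_eq_Some_conv)
      with Comp IH[of b n u] IH[of a u y] show ?thesis by (simp add: computes_Comp)
    next
      case (PrimRec a b)
      obtain x k where n: "n = prod_encode (x, k)" by (metis prod_decode_inverse surj_pair)
      show ?thesis
      proof (cases k)
        case 0
        with prem n PrimRec have "run s h a x = Some y" by simp
        with IH n 0 PrimRec show ?thesis by (simp add: computes_PrimRec_0)
      next
        case (Suc l)
        with prem n PrimRec obtain r where
          "run s h (PrimRec a b) (prod_encode (x, l)) = Some r"
          "run s h b (prod_encode (x, prod_encode (l, r))) = Some y"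
          by (auto simp: bind_eq_Some_conv)
        with IH[of "PrimRec a b"] IH[of b] have
          "computes g (PrimRec (subst_query q a) (subst_query q b)) (prod_encode (x, l)) r"
          "computes g (subst_query q b) (prod_encode (x, prod_encode (l, r))) y" by auto
        then show ?thesis unfolding n Suc PrimRec by (simp add: computes_PrimRec_Suc)
      qed
    next
      case (Search a)
      obtain x k where n: "n = prod_encode (x, k)" by (metis prod_decode_inverse surj_pair)
      with prem Search obtain r where r: "run s h a n = Some r"
        "(if r = 0 then Some k else run s h (Search a) (prod_encode (x, Suc k))) = Some y"
        by (auto simp: bind_eq_Some_conv)
      show ?thesis
      proof (cases r)
        case 0
        with r IH[of a n r] n Search show ?thesis by (simp add: computes_Search_0)
      next
        case (Suc r')
        with r IH[of a n r] IH[of "Search a"] n Search show ?thesis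
          by (auto intro: computes_Search_Suc)
      qed
    qed (use prem in \<open>auto intro: computes_basic\<close>)
  qed simp
qed

text \<open>Composition of functionals: replacing queries by the program \<open>prog_of e\<close>,
  which computes \<open>h\<close> from \<open>g\<close>, turns a computation from \<open>h\<close>
  into one from \<open>g\<close>.\<close>

lemma rec_on_oracle:
  assumes "rec_on D F"
  shows "\<exists>e'. \<forall>g h. Phi e g = Some h \<longrightarrow> h \<in> D \<longrightarrow> Phi e' g = Some (F h)"
proof -
  from assms obtain p where p: "\<And>g n. g \<in> D \<Longrightarrow> computes g p n (F g n)"
    using rec_onE[OF assms] by blast
  obtain e' where "prog_of e' = subst_query (prog_of e) p" by (metis surj_prog_of surjD)
  then show ?thesis
    by (intro exI[of _ e']) (auto simp: Phi_eq_Some_iff intro: computes_subst_query p)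
qed

text \<open>\<open>S\<close> is computed without the oracle, because a learner has to put out such
  indices for parameters that it finds while reading a finite string.\<close>

lemma s_m_n:
  assumes "rec_on D F"
  shows "\<exists>S. rec_on UNIV (\<lambda>g. S) \<and> (\<forall>a. \<forall>g \<in> D. Phi (S a) g = Some (\<lambda>x. F g (prod_encode (a, x))))"
proof -
  obtain c where c: "\<And>g n. g \<in> D \<Longrightarrow> computes g (prog_of c) n (F g n)"
    using assms unfolding rec_on_Phi Phi_eq_Some_iff by blast
  obtain i where i: "prog_of i = Tuple Fst Snd" by (metis surj_prog_of surjD)
  obtain z where z: "prog_of z = Zero" by (metis surj_prog_of surjD)
  obtain u where u: "prog_of u = Succ" by (metis surj_prog_of surjD)
  \<comment> \<open>\<open>C a\<close> is an index of the constant \<open>a\<close>, written as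
    \<open>a\<close> successors of zero; 6 is the tag of \<open>Comp\<close>.\<close>
  define C where "C = rec_nat z (\<lambda>k r. prod_encode (6, prod_encode (u, r)))"
  have C: "computes g (prog_of (C a)) x a" for g a x
  proof (induction a)
    case 0
    then show ?case by (simp add: C_def z computes_basic)
  next
    case (Suc a)
    have "prog_of (C (Suc a)) = Comp Succ (prog_of (C a))"
      by (simp add: C_def) (subst prog_of.simps, simp add: u)
    with computes_Comp[OF Suc computes_basic(2)] show ?case by simp
  qed
  \<comment> \<open>The program for \<open>F\<close> applied to the pair of \<open>a\<close> and the
    input; 5 is the tag of \<open>Tuple\<close>, and \<open>i\<close> is an index of the
    identity.\<close>
  define S where "S a = prod_encode (6, prod_encode (c, prod_encode (5, prod_encode (C a, i))))" for a
  have S: "prog_of (S a) = Comp (prog_of c) (Tuple (prog_of (C a)) (Tuple Fst Snd))" for a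
    unfolding S_def by (subst prog_of.simps, simp, subst prog_of.simps, simp add: i)
  have "rec_on UNIV (\<lambda>g. S)"
    unfolding S_def C_def by (intro rec_intros)
  moreover have "Phi (S a) g = Some (\<lambda>x. F g (prod_encode (a, x)))" if "g \<in> D" for a g
  proof -
    have "computes g (Tuple Fst Snd) x x" for x
      using computes_Tuple[OF computes_basic(3,4)] by simp
    from computes_Comp[OF computes_Tuple[OF C this] c[OF that]] show ?thesis
      unfolding Phi_eq_Some_iff S by blast
  qed
  ultimately show ?thesis by blast
qed

lemma rec_enumerate [rec_intros]:
  assumes P: "rec_on D (\<lambda>g m. of_bool (P g (pfst m) (psnd m)))"
    and inf: "\<And>g n. g \<in> D \<Longrightarrow> infinite {k. P g n k}" and K: "rec_on D K"
  shows "rec_on D (\<lambda>g n. enumerate {k. P g n k} (K g n))"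
proof -
  \<comment> \<open>The search for the next element has to end from every value \<open>r\<close>,
    which the infinity of the set guarantees.\<close>
  have "rec_on D (\<lambda>g n. rec_nat (LEAST k. P g n k) (\<lambda>i r. LEAST k. P g n k \<and> r < k) (K g n))"
  proof (intro rec_intros assms rec_comp2[OF P])
    fix g n assume "g \<in> D"
    from inf[OF this] show "\<exists>k. P g n k" by (metis Collect_empty_eq finite.emptyI)
  next
    fix g m assume "g \<in> D"
    from inf[OF this, of "pfst m"] show "\<exists>k. P g (pfst m) k \<and> psnd (psnd m) < k"
      unfolding infinite_nat_iff_unbounded by blast
  qed
  then show ?thesis
  proof (rule rec_on_cong)
    fix g n assume g: "g \<in> D"
    have "rec_nat (LEAST k. P g n k) (\<lambda>i r. LEAST k. P g n k \<and> r < k) i = enumerate {k. P g n k} i" for i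
      by (induction i) (simp_all add: enumerate_0 enumerate_Suc''[OF inf[OF g]])
    then show "rec_nat (LEAST k. P g n k) (\<lambda>i r. LEAST k. P g n k \<and> r < k) (K g n)
      = enumerate {k. P g n k} (K g n)" .
  qed
qed

section \<open>Codes of finite strings\<close>

definition lookup :: "nat list \<Rightarrow> nat \<Rightarrow> nat option" where
  "lookup \<sigma> q = (if q < length \<sigma> then Some (\<sigma> ! q) else None)"

lemma list_encode_eq_0 [simp]: "list_encode \<sigma> = 0 \<longleftrightarrow> \<sigma> = []"
  by (cases \<sigma>) auto

lemma list_encode_drop:
  "list_encode (drop k \<sigma>) = rec_nat (list_encode \<sigma>) (\<lambda>i y. psnd (y - 1)) k"
proof (induction k)
  case (Suc k)
  \<comment> \<open>Since also \<open>0 - 1 = 0\<close>, the iteration stays at 0, the code of the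
    empty list, when the list is used up.\<close>
  have "prod_decode 0 = (0, 0)"
    using prod_encode_inverse[of "(0, 0)"] by (simp add: prod_encode_def)
  then have "list_encode (tl \<tau>) = psnd (list_encode \<tau> - 1)" for \<tau>
    by (cases \<tau>) auto
  from this[of "drop k \<sigma>"] Suc show ?case by (simp add: drop_Suc tl_drop)
qed simp

lemma rec_list_encode_drop [rec_intros]:
  assumes "rec_on D A" "rec_on D B"
  shows "rec_on D (\<lambda>g n. list_encode (drop (B g n) (list_decode (A g n))))"
  unfolding list_encode_drop list_decode_inverse by (intro rec_intros assms)

lemma rec_lookup [rec_intros]:
  assumes "rec_on D A" "rec_on D B"
  shows "rec_on D (\<lambda>g n. option_code (lookup (list_decode (A g n)) (B g n)))"
proof -
  have "rec_on D (\<lambda>g n. let y = list_encode (drop (B g n) (list_decode (A g n))) in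
      if y = 0 then 0 else Suc (pfst (y - 1)))"
    unfolding Let_def by (intro rec_intros assms)
  moreover have "(let y = list_encode (drop k \<sigma>) in if y = 0 then 0 else Suc (pfst (y - 1)))
      = option_code (lookup \<sigma> k)" for k \<sigma>
    by (cases "k < length \<sigma>") (auto simp: lookup_def Cons_nth_drop_Suc[symmetric])
  ultimately show ?thesis by simp
qed

lemma rec_length [rec_intros]:
  assumes "rec_on D A"
  shows "rec_on D (\<lambda>g n. length (list_decode (A g n)))"
proof -
  have ex: "\<exists>k. lookup \<sigma> k = None" for \<sigma>
    by (rule exI[of _ "length \<sigma>"]) (simp add: lookup_def)
  have "rec_on D (\<lambda>g n. LEAST k. lookup (list_decode (A g n)) k = None)"
    by (intro rec_intros rec_comp[OF assms] ex)
  moreover have "(LEAST k. lookup \<sigma> k = None) = length \<sigma>" for \<sigma>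
    by (intro Least_equality) (auto simp: lookup_def split: if_splits)
  ultimately show ?thesis by simp
qed

lemma rec_list_encode_map [rec_intros]:
  assumes "rec_on D (\<lambda>g m. A g (pfst m) (psnd m))" "rec_on D K"
  shows "rec_on D (\<lambda>g n. list_encode (map (\<lambda>k. A g n k) [0..<K g n]))"
proof -
  \<comment> \<open>The list is built from its end: step \<open>j\<close> prepends the entry at
    \<open>K g n - Suc j\<close>.\<close>
  have "rec_on D (\<lambda>g n. rec_nat 0 (\<lambda>j r. Suc (prod_encode (A g n (K g n - Suc j), r))) (K g n))"
    by (intro rec_intros assms rec_comp2[OF assms(1)] rec_comp[OF assms(2)])
  moreover have "rec_nat 0 (\<lambda>j r. Suc (prod_encode (f (k - Suc j), r))) i = list_encode (map f [k - i..<k])"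
    if "i \<le> k" for f k i
    using that
  proof (induction i)
    case (Suc i)
    then have "[k - Suc i..<k] = (k - Suc i) # [k - i..<k]"
      by (subst upt_conv_Cons) (auto simp: Suc_diff_Suc)
    with Suc show ?case by simp
  qed simp
  ultimately show ?thesis by simp
qed

lemma rec_prefix [rec_intros]:
  assumes "rec_on D K"
  shows "rec_on D (\<lambda>g n. list_encode (g \<restriction> K g n))"
  unfolding prefix_def by (intro rec_intros assms)

lemma length_prefix [simp]: "length (g \<restriction> n) = n"
  by (simp add: prefix_def)

lemma nth_prefix [simp]: "k < n \<Longrightarrow> (g \<restriction> n) ! k = g k"
  by (simp add: prefix_def)

lemma take_prefix [simp]: "k \<le> n \<Longrightarrow> take k (g \<restriction> n) = g \<restriction> k"
  by (simp add: prefix_def take_map)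

section \<open>Computing and constructing learners\<close>

lemma converged_prefix:
  "converged c (g \<restriction> n) = {k. k \<le> n \<and> string_run n c (g \<restriction> k) \<noteq> None}"
  by (auto simp: converged_def)

lemma rec_string_run [rec_intros]:
  assumes "rec_on D s" "rec_on D K"
  shows "rec_on D (\<lambda>g n. option_code (string_run (s g n) c (g \<restriction> K g n)))"
  unfolding string_run_def eval_eq_run[symmetric] by (intro rec_intros assms)

lemma rec_Psi: "rec_on D (\<lambda>g n. Psi e (g \<restriction> n))"
proof -
  obtain d c where e: "prod_decode e = (d, c)" by fastforce
  let ?r = "\<lambda>g n j. string_run n c (g \<restriction> (n - j))"
  \<comment> \<open>The longest convergent prefix is found by shortening, \<open>j\<close> being the
    number of dropped entries. The disjunct \<open>n \<le> j\<close> ends the search; at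
    \<open>j = n\<close> the empty prefix is tested as well, and \<open>None\<close> there means the
    initial guess \<open>d\<close>.\<close>
  have ex: "\<exists>j. ?r g n j \<noteq> None \<or> n \<le> j" for g n by blast
  have "rec_on D (\<lambda>g n. case ?r g n (LEAST j. ?r g n j \<noteq> None \<or> n \<le> j) of None \<Rightarrow> d | Some v \<Rightarrow> v)"
    by (intro rec_intros ex)
  then show ?thesis
  proof (rule rec_on_cong)
    fix g n
    let ?j = "LEAST j. ?r g n j \<noteq> None \<or> n \<le> j" and ?K = "converged c (g \<restriction> n)"
    have j: "?r g n ?j \<noteq> None \<or> n \<le> ?j" by (rule LeastI[of _ n]) simp
    have below: "?r g n i = None" if "i < ?j" for i using not_less_Least[OF that] by blast
    show "(case ?r g n ?j of None \<Rightarrow> d | Some v \<Rightarrow> v) = Psi e (g \<restriction> n)"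
    proof (cases "?r g n ?j")
      case None
      have "string_run n c (g \<restriction> k) = None" if "k \<le> n" for k
      proof (cases "n - k < ?j")
        case True
        from below[OF this] that show ?thesis by simp
      next
        case False
        moreover from None j have "n \<le> ?j" by blast
        ultimately have "k = 0 \<and> ?j = n \<or> n = 0 \<and> k = 0"
          using that Least_le[of "\<lambda>j. ?r g n j \<noteq> None \<or> n \<le> j" n] by auto
        with None show ?thesis by auto
      qed
      then have "?K = {}" by (auto simp: converged_prefix)
      with None e show ?thesis by (simp add: Psi_def)
    next
      case (Some v)
      have "Max ?K = n - ?j"
      proof (rule Max_eqI)
        show "finite ?K" by (simp add: converged_def)
        show "n - ?j \<in> ?K" using Some by (simp add: converged_prefix)
        fix k assume k: "k \<in> ?K"
        show "k \<le> n - ?j"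
        proof (rule ccontr)
          assume "\<not> k \<le> n - ?j"
          with k have "n - k < ?j" by (auto simp: converged_prefix)
          from below[OF this] k show False by (simp add: converged_prefix)
        qed
      qed
      moreover have "n - ?j \<in> ?K" using Some by (simp add: converged_prefix)
      ultimately show ?thesis using Some e by (auto simp: Psi_def)
    qed
  qed
qed

text \<open>The enumerated learner lags behind \<open>\<psi>\<close>. Monotonicity of
  \<open>k\<close> prevents additional mind changes and its divergence to infinity preserves the
  limit; one and the same \<open>k\<close> must have both properties.\<close>

lemma learner_exists:
  assumes "rec_on UNIV (\<lambda>g n. \<psi> (list_decode n))"
  shows "\<exists>e. \<forall>g. \<exists>k. mono k \<and> filterlim k at_top sequentially \<and> (\<forall>n. Psi e (g \<restriction> n) = \<psi> (g \<restriction> k n))"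
proof -
  obtain c where "\<And>n. computes (\<lambda>_. 0) (prog_of c) n (\<psi> (list_decode n))"
    using assms unfolding rec_on_Phi Phi_eq_Some_iff by blast
  then have total: "\<exists>s. string_run s c \<sigma> = Some (\<psi> \<sigma>)" for \<sigma>
    unfolding string_run_def computes_def by (metis list_encode_inverse)
  have det: "y = \<psi> \<sigma>" if "string_run s c \<sigma> = Some y" for s \<sigma> y
    using total[of \<sigma>] that computes_unique unfolding string_run_def computes_def by blast
  have "\<exists>k. mono k \<and> filterlim k at_top sequentially \<and> (\<forall>n. Psi (prod_encode (\<psi> [], c)) (g \<restriction> n) = \<psi> (g \<restriction> k n))" for g
  proof -
    let ?K = "\<lambda>n. converged c (g \<restriction> n)"
    let ?k = "\<lambda>n. if ?K n = {} then 0 else Max (?K n)"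
    have fin: "finite (?K n)" for n unfolding converged_def by simp
    have sub: "?K n \<subseteq> ?K n'" if "n \<le> n'" for n n'
      using that run_mono[of n _ _ _ _ n'] by (fastforce simp: converged_prefix string_run_def)
    have mono: "mono ?k"
    proof (rule monoI)
      fix n n' :: nat assume "n \<le> n'"
      from sub[OF this] show "?k n \<le> ?k n'"
        using fin by (auto intro: Max_mono)
    qed
    have "\<exists>n0. \<forall>n \<ge> n0. N \<le> ?k n" for N
    proof -
      from total obtain s where s: "string_run s c (g \<restriction> N) = Some (\<psi> (g \<restriction> N))" by blast
      have "N \<in> ?K n" if "n \<ge> max N s" for n
        using that s run_mono[of s _ _ _ _ n] by (auto simp: converged_prefix string_run_def)
      then have "N \<le> ?k n" if "n \<ge> max N s" for n
        using that fin by (auto intro!: Max_ge)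
      then show ?thesis by blast
    qed
    then have "filterlim ?k at_top sequentially"
      unfolding filterlim_at_top eventually_sequentially by blast
    moreover have "Psi (prod_encode (\<psi> [], c)) (g \<restriction> n) = \<psi> (g \<restriction> ?k n)" for n
    proof (cases "?K n = {}")
      \<comment> \<open>Before anything has converged, the initial guess \<open>\<psi> []\<close> is
        the guess at the prefix of length 0, in agreement with the default 0 of the delay.\<close>
      case True
      then show ?thesis by (simp add: Psi_def) (simp add: prefix_def)
    next
      case False
      then have M: "Max (?K n) \<in> ?K n" using fin by (rule_tac Max_in)
      then obtain y where "Max (?K n) \<le> n" "string_run n c (g \<restriction> Max (?K n)) = Some y"
        by (subst (asm) (2) converged_prefix) auto
      with False det show ?thesis by (auto simp: Psi_def)
    qed
    ultimately show ?thesis using mono by blast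
  qed
  then show ?thesis by blast
qed

section \<open>Output streams\<close>

text \<open>An infinite set of numbers has only one increasing enumeration. Two descriptions of an
  output can thus be identified by comparing the sets of stages at which it is written.\<close>

lemma enumerate_range:
  assumes "strict_mono (\<rho> :: nat \<Rightarrow> nat)"
  shows "enumerate (range \<rho>) = \<rho>"
proof
  have inf: "infinite (range \<rho>)"
    using assms by (simp add: range_inj_infinite strict_mono_imp_inj_on)
  fix n show "enumerate (range \<rho>) n = \<rho> n"
  proof (induction n)
    case 0
    show ?case unfolding enumerate_0
      using assms by (intro Least_equality) (auto simp: strict_mono_less_eq)
  next
    case (Suc n)
    show ?case unfolding enumerate_Suc''[OF inf] Suc
      using assms by (intro Least_equality) (auto simp: strict_mono_less strict_mono_less_eq)
  qed
qed

text \<open>A stage \<open>t\<close> outputs \<open>v\<close> if \<open>E t = Suc v\<close>, and nothing if \<open>E t = 0\<close>.\<close>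

definition squeeze :: "(nat \<Rightarrow> nat) \<Rightarrow> nat \<Rightarrow> nat" where
  "squeeze E n = E (enumerate {t. E t \<noteq> 0} n) - 1"

lemma rec_squeeze:
  assumes "rec_on D E" "\<And>g. g \<in> D \<Longrightarrow> infinite {t. E g t \<noteq> 0}"
  shows "rec_on D (\<lambda>g. squeeze (E g))"
  unfolding squeeze_def by (intro rec_intros assms rec_comp[OF assms(1)])

text \<open>Dropping silent stages preserves the order. So if \<open>A\<close> singles out the
  symbols of one tape and \<open>\<rho>\<close> lists the stages writing them, the tape can be read
  off from \<open>\<rho>\<close> without knowing positions in the squeezed sequence.\<close>

lemma squeeze_subsequence:
  assumes "strict_mono \<rho>" and \<rho>: "{t. E t \<noteq> 0 \<and> A (E t - 1)} = range \<rho>"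
  shows "infinite {n. A (squeeze E n)}"
    and "squeeze E (enumerate {n. A (squeeze E n)} k) = E (\<rho> k) - 1"
proof -
  let ?S = "{t. E t \<noteq> 0}" and ?N = "{n. A (squeeze E n)}"
  have "infinite (range \<rho>)"
    using assms(1) by (simp add: range_inj_infinite strict_mono_imp_inj_on)
  moreover have "range \<rho> \<subseteq> ?S" using \<rho> by blast
  ultimately have inf: "infinite ?S" using finite_subset by blast
  have img: "enumerate ?S ` ?N = range \<rho>"
  proof -
    have "enumerate ?S ` {n. A (E (enumerate ?S n) - 1)} = {t \<in> range (enumerate ?S). A (E t - 1)}"
      by auto
    with \<rho> show ?thesis unfolding squeeze_def range_enumerate[OF inf] by simp
  qed
  with \<open>infinite (range \<rho>)\<close> show infN: "infinite ?N" using finite_imageI[of ?N "enumerate ?S"] by auto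
  have sm: "strict_mono (enumerate ?S \<circ> enumerate ?N)"
    using strict_mono_enumerate[OF inf] strict_mono_enumerate[OF infN] by (rule strict_mono_o)
  have rng: "range (enumerate ?S \<circ> enumerate ?N) = range \<rho>"
    using img by (simp only: image_comp[of "enumerate ?S" "enumerate ?N" UNIV, symmetric] range_enumerate[OF infN])
  have "enumerate ?S \<circ> enumerate ?N = \<rho>"
    using enumerate_range[OF sm, unfolded rng enumerate_range[OF assms(1)]] by (rule sym)
  from fun_cong[OF this, of k] show "squeeze E (enumerate ?N k) = E (\<rho> k) - 1"
    by (simp only: squeeze_def comp_apply)
qed

section \<open>Membership in the coded sets of sequences\<close>

lemma CL2_iff:
  "f \<in> CL2 m P \<longleftrightarrow>
     (\<exists>i<m. infinite {n. f n mod m = i} \<and> (\<lambda>k. f (enumerate {n. f n mod m = i} k) div m) \<in> P)"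
proof
  assume "f \<in> CL2 m P"
  then obtain f' where f: "f = tape_code m \<circ> f'" and lt: "\<And>n. fst (f' n) < m"
    and *: "\<exists>i<m. infinite (tape i f') \<and> pr i f' \<in> P"
    unfolding CL2_def CL2_seqs_def by blast
  have "f n mod m = fst (f' n)" "f n div m = snd (f' n)" for n
    using lt[of n] by (auto simp: f tape_code_def split: prod.split)
  with * show "\<exists>i<m. infinite {n. f n mod m = i} \<and> (\<lambda>k. f (enumerate {n. f n mod m = i} k) div m) \<in> P"
    by (simp add: tape_def pr_def[abs_def])
next
  assume *: "\<exists>i<m. infinite {n. f n mod m = i} \<and> (\<lambda>k. f (enumerate {n. f n mod m = i} k) div m) \<in> P"
  let ?f = "\<lambda>n. (f n mod m, f n div m)"
  have f: "f = tape_code m \<circ> ?f" by (auto simp: tape_code_def)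
  have "?f \<in> CL2_seqs m P"
    using * by (auto simp: CL2_seqs_def tape_def pr_def[abs_def])
  then show "f \<in> CL2 m P" unfolding CL2_def by (subst f) (rule imageI)
qed

lemma LCM2_iff: "f \<in> LCM2 m P \<longleftrightarrow> f \<in> CL2 m P \<and> finite {n. f n mod m \<noteq> f (Suc n) mod m}"
proof -
  have mod: "(tape_code m \<circ> f') n mod m = fst (f' n)" if "f' \<in> CL2_seqs m P" for f' n
  proof -
    from that have "fst (f' n) < m" by (simp add: CL2_seqs_def)
    then show ?thesis by (auto simp: tape_code_def split: prod.split)
  qed
  have mc: "mc f' < \<infinity> \<longleftrightarrow> finite {n. fst (f' n) \<noteq> fst (f' (Suc n))}" for f'
    by (simp add: mc_def ecard_def)
  show ?thesis unfolding LCM2_def CL2_def using mod by (auto simp: mc simp del: enat_ord_simps)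
qed

text \<open>\<open>a\<close> is the start of the tail, and the condition at \<open>a - 1\<close>
  makes it least. The code of \<open>\<sharp>\<close> is 0 and numbers are shifted by one, whence 1
  and 2 for the leading bit.\<close>

lemma LCM3_iff:
  "f \<in> LCM3 P \<longleftrightarrow> (\<exists>a. (\<forall>j\<ge>a. f j \<noteq> 0) \<and> (a = 0 \<or> f (a - 1) = 0) \<and> f a \<in> {1, 2} \<and>
     (\<lambda>k. f (a + Suc k) - 1) \<in> P)"
  (is "_ \<longleftrightarrow> (\<exists>a. ?R a)")
proof
  assume "f \<in> LCM3 P"
  then obtain f' where f: "f = option_code \<circ> f'" and fin: "finite (sharps f')"
    and t: "tail f' 0 \<in> {0, 1}" "(\<lambda>k. tail f' (Suc k)) \<in> P"
    unfolding LCM3_def LCM3_seqs_def by blast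
  define a where "a = (LEAST n. \<forall>j\<ge>n. f' j \<noteq> None)"
  from fin obtain b where "\<forall>j \<in> sharps f'. j < b" by (auto simp: finite_nat_set_iff_bounded)
  then have "\<forall>j\<ge>b. f' j \<noteq> None" by (auto simp: sharps_def)
  then have a: "\<forall>j\<ge>a. f' j \<noteq> None" unfolding a_def by (rule LeastI)
  have val: "tail f' k = f (a + k) - 1" for k
    using a[rule_format, of "a + k"] by (auto simp: tail_def f a_def)
  have "a = 0 \<or> f (a - 1) = 0"
  proof (rule ccontr)
    assume "\<not> (a = 0 \<or> f (a - 1) = 0)"
    then have a0: "a \<noteq> 0" and n: "f' (a - 1) \<noteq> None" by (simp_all add: f)
    have "\<forall>j\<ge>a - 1. f' j \<noteq> None"
    proof (intro allI impI)
      fix j assume "j \<ge> a - 1"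
      then have "j = a - 1 \<or> j \<ge> a" by linarith
      with n a show "f' j \<noteq> None" by blast
    qed
    then have "a \<le> a - 1" unfolding a_def by (rule Least_le)
    with a0 show False by simp
  qed
  moreover have pos: "\<forall>j\<ge>a. f j \<noteq> 0" using a by (simp add: f)
  moreover have "f a \<in> {1, 2}" using t(1) val[of 0] pos by auto
  ultimately have "?R a" using t(2) by (simp add: val)
  then show "\<exists>a. ?R a" ..
next
  assume "\<exists>a. ?R a"
  then obtain a where a: "?R a" ..
  define f' where "f' n = (case f n of 0 \<Rightarrow> None | Suc k \<Rightarrow> Some k)" for n
  have f: "f = option_code \<circ> f'" by (rule ext) (simp add: f'_def split: nat.split)
  have N: "f' n = None \<longleftrightarrow> f n = 0" for n by (auto simp: f'_def split: nat.split)
  have L: "(LEAST n. \<forall>j\<ge>n. f' j \<noteq> None) = a"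
  proof (rule Least_equality)
    show "\<forall>j\<ge>a. f' j \<noteq> None" using a by (simp add: N)
    fix b assume b: "\<forall>j\<ge>b. f' j \<noteq> None"
    show "a \<le> b"
    proof (rule ccontr)
      assume "\<not> a \<le> b"
      with b have "f (a - 1) \<noteq> 0" "a \<noteq> 0" by (auto simp: N)
      with a show False by blast
    qed
  qed
  have "tail f' k = f (a + k) - 1" for k
  proof -
    from a have "f (a + k) \<noteq> 0" by simp
    then show ?thesis unfolding tail_def L by (auto simp: f'_def split: nat.split)
  qed
  moreover have "finite (sharps f')"
  proof (rule finite_subset)
    show "sharps f' \<subseteq> {..<a}"
    proof
      fix n assume "n \<in> sharps f'"
      then have "f n = 0" by (simp add: sharps_def N)
      with a show "n \<in> {..<a}" by (meson lessThan_iff not_le)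
    qed
  qed simp
  ultimately have "f' \<in> LCM3_seqs P" using a by (auto simp: LCM3_seqs_def)
  then show "f \<in> LCM3 P" unfolding LCM3_def by (subst f) (rule imageI)
qed

lemma LCM3_bounded_iff: "f \<in> LCM3_bounded m P \<longleftrightarrow> f \<in> LCM3 P \<and> card {n. f n = 0} < m"
proof -
  have "{n. (option_code \<circ> f') n = 0} = sharps f'" for f' by (auto simp: sharps_def)
  then show ?thesis unfolding LCM3_bounded_def LCM3_def by (auto simp del: comp_apply)
qed

lemma LCM3_mono: "P \<subseteq> P' \<Longrightarrow> LCM3 P \<subseteq> LCM3 P'"
  unfolding LCM3_def LCM3_seqs_def by (intro image_mono) auto

text \<open>Together with monotonicity this reduces the conversions of indices to a single target
  \<open>h\<close>, so that they can be carried out independently of \<open>P\<close>.\<close>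

lemma LCM3_single:
  assumes "f \<in> LCM3 P"
  shows "\<exists>h \<in> P. f \<in> LCM3 {h}"
proof -
  from assms obtain a where "\<forall>j\<ge>a. f j \<noteq> 0" "a = 0 \<or> f (a - 1) = 0" "f a \<in> {1, 2}"
    and P: "(\<lambda>k. f (a + Suc k) - 1) \<in> P"
    unfolding LCM3_iff by (elim exE conjE)
  then have "f \<in> LCM3 {\<lambda>k. f (a + Suc k) - 1}"
    unfolding LCM3_iff by (intro exI[of _ a]) simp
  with P show ?thesis by blast
qed

section \<open>Streams of values\<close>

lemma prod_encode_less:
  assumes "a \<le> a'" "b \<le> b'" "(a, b) \<noteq> (a', b')"
  shows "prod_encode (a, b) < prod_encode (a', b')"
proof -
  have mono: "triangle i \<le> triangle j" if "i \<le> j" for i j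
    using that by (rule lift_Suc_mono_le[rotated]) simp
  show ?thesis
  proof (cases "a = a'")
    case True
    with assms have "Suc (a + b) \<le> a' + b'" by auto
    from mono[OF this] True show ?thesis by (simp add: prod_encode_def)
  next
    case False
    with assms mono[of "a + b" "a' + b'"] show ?thesis by (simp add: prod_encode_def)
  qed
qed

text \<open>A pair \<open>(k, s)\<close> is a stage of \<open>stream g i\<close> at which the \<open>k\<close>-th value of \<open>\<Phi> i g\<close> appears if
  \<open>s\<close> is the least depth at which the first \<open>k + 1\<close> values are all obtained. As this depth is
  nondecreasing in \<open>k\<close>, the values appear in their order.\<close>

definition stream :: "(nat \<Rightarrow> nat) \<Rightarrow> nat \<Rightarrow> nat \<Rightarrow> nat option" where
  "stream g i u =
     (if (\<forall>l < Suc (pfst u). run (psnd u) g (prog_of i) l \<noteq> None) \<and>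
         (\<forall>s < psnd u. \<exists>l < Suc (pfst u). run s g (prog_of i) l = None)
      then run (psnd u) g (prog_of i) (pfst u) else None)"

lemma rec_stream [rec_intros]:
  assumes "rec_on D I" "rec_on D U"
  shows "rec_on D (\<lambda>g n. option_code (stream g (I g n) (U g n)))"
  unfolding stream_def by (intro rec_intros assms assms[THEN rec_comp])

text \<open>If all values exist, the \<open>k\<close>-th has exactly one stage, the one with depth
  \<open>d k\<close>. So nothing is written twice, and the stages in increasing order spell out
  \<open>h\<close>.\<close>

lemma stream_Phi:
  assumes "Phi i g = Some h"
  obtains \<tau> where "strict_mono \<tau>" "{u. stream g i u \<noteq> None} = range \<tau>"
    "\<And>k. stream g i (\<tau> k) = Some (h k)"
proof -
  let ?r = "\<lambda>s l. run s g (prog_of i) l"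
  define d where "d k = (LEAST s. \<forall>l < Suc k. ?r s l \<noteq> None)" for k
  have comp: "computes g (prog_of i) l (h l)" for l using assms by (simp add: Phi_eq_Some_iff)
  have val: "y = h l" if "?r s l = Some y" for s l y
    using comp[of l] that computes_unique unfolding computes_def by blast
  have ex: "\<exists>s. \<forall>l < Suc k. ?r s l \<noteq> None" for k
  proof -
    from comp obtain s where s: "\<And>l. ?r (s l) l = Some (h l)" unfolding computes_def by metis
    have "?r (Max (s ` {..k})) l = Some (h l)" if "l < Suc k" for l
      using run_mono[OF s[of l], of "Max (s ` {..k})"] that by simp
    then show ?thesis by (metis option.distinct(1))
  qed
  have d: "?r (d k) l \<noteq> None" if "l < Suc k" for k l
    using LeastI_ex[OF ex[of k]] that unfolding d_def by simp
  have d_min: "\<exists>l < Suc k. ?r s l = None" if "s < d k" for s k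
    using not_less_Least[of s "\<lambda>s. \<forall>l < Suc k. ?r s l \<noteq> None"] that unfolding d_def by meson
  have d_mono: "d k \<le> d k'" if "k \<le> k'" for k k'
    unfolding d_def[of k] using d that by (intro Least_le) auto
  have iff: "stream g i u \<noteq> None \<longleftrightarrow> psnd u = d (pfst u)" for u
  proof
    assume "stream g i u \<noteq> None"
    then have "\<forall>l < Suc (pfst u). ?r (psnd u) l \<noteq> None"
      "\<forall>s < psnd u. \<exists>l < Suc (pfst u). ?r s l = None"
      by (auto simp: stream_def split: if_splits)
    then show "psnd u = d (pfst u)"
      using d[of _ "pfst u"] d_min[of "psnd u" "pfst u"] by (meson linorder_neqE_nat)
  next
    assume "psnd u = d (pfst u)"
    with d d_min show "stream g i u \<noteq> None" by (auto simp: stream_def)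
  qed
  let ?\<tau> = "\<lambda>k. prod_encode (k, d k)"
  \<comment> \<open>\<open>k\<close> grows strictly and \<open>d k\<close> weakly, while pairing
    increases in both components.\<close>
  have "strict_mono ?\<tau>"
    by (rule strict_monoI) (auto intro!: prod_encode_less d_mono)
  moreover have "{u. stream g i u \<noteq> None} = range ?\<tau>"
  proof -
    have "u = ?\<tau> (pfst u)" if "psnd u = d (pfst u)" for u
      using that by (metis prod.collapse prod_decode_inverse)
    then show ?thesis unfolding iff by auto
  qed
  moreover have "stream g i (?\<tau> k) = Some (h k)" for k
  proof -
    have "stream g i (?\<tau> k) \<noteq> None" unfolding iff by simp
    then obtain y where y: "stream g i (?\<tau> k) = Some y" by blast
    then have "?r (d k) k = Some y" by (simp add: stream_def split: if_splits)
    with val y show ?thesis by blast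
  qed
  ultimately show thesis by (rule that)
qed

section \<open>From learners to sequences\<close>

text \<open>The time since the guess last changed, with the very start treated like a change. It is
  the clock of the simulation, which thereby restarts at every mind change.\<close>

definition age :: "(nat \<Rightarrow> nat) \<Rightarrow> nat \<Rightarrow> nat" where
  "age w t = rec_nat 0 (\<lambda>k r. if w (Suc k) = w k then Suc r else 0) t"

lemma age_simps: "age w 0 = 0" "age w (Suc t) = (if w (Suc t) = w t then Suc (age w t) else 0)"
  by (simp_all add: age_def)

lemma age_eq_0_iff: "age w t = 0 \<longleftrightarrow> t = 0 \<or> (\<exists>k. t = Suc k \<and> w (Suc k) \<noteq> w k)"
  by (cases t) (auto simp: age_simps)

lemma age_last:
  assumes "\<forall>\<^sub>F t in sequentially. w t = i"
  obtains L where "age w L = 0" "\<And>d. age w (L + d) = d" "\<And>d. w (L + d) = i"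
    and "finite {t. age w t = 0}"
proof -
  from assms obtain N where N: "\<And>t. t \<ge> N \<Longrightarrow> w t = i"
    unfolding eventually_sequentially by blast
  let ?Z = "{t. age w t = 0}"
  have "?Z \<subseteq> {..N}"
  proof
    fix t assume "t \<in> ?Z"
    then have "t = 0 \<or> (\<exists>k. t = Suc k \<and> w (Suc k) \<noteq> w k)" by (simp add: age_eq_0_iff)
    then show "t \<in> {..N}"
      using N by (metis atMost_iff le_SucI not_less_eq_eq zero_le)
  qed
  then have fin: "finite ?Z" by (rule finite_subset) simp
  have "0 \<in> ?Z" by (simp add: age_simps)
  define L where "L = Max ?Z"
  have L: "age w L = 0" using Max_in[OF fin] \<open>0 \<in> ?Z\<close> unfolding L_def by blast
  have pos: "age w t \<noteq> 0" if "t > L" for t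
    using Max_ge[OF fin, of t] that unfolding L_def by auto
  have d: "age w (L + d) = d \<and> w (L + d) = w L" for d
  proof (induction d)
    case (Suc d)
    have "age w (Suc (L + d)) \<noteq> 0" by (rule pos) simp
    with Suc show ?case by (auto simp: age_simps split: if_splits)
  qed (simp add: L)
  have "w L = i" using d[of N] N[of "L + N"] by simp
  with L d fin that show thesis by metis
qed

text \<open>The guess is inspected at every stage, even while a value is awaited, so a wrong index
  of a partial function does no harm. After the last mind change exactly the leading bit and
  \<open>h\<close> are written. Each mind change costs one \<open>\<sharp>\<close> and so does the
  start, which accounts for \<open>Suc\<close>.\<close>

lemma backtracking_of_learner:
  "\<exists>e'. \<forall>g i h. (\<forall>\<^sub>F n in sequentially. Psi e (g \<restriction> n) = i) \<longrightarrow> Phi i g = Some h \<longrightarrow>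
     (\<exists>f. Phi e' g = Some f \<and> f \<in> LCM3 {h} \<and> card {n. f n = 0} \<le> Suc (card (mcl (Psi e) g)))"
proof -
  define w where "w g t = Psi e (g \<restriction> t)" for g t
  \<comment> \<open>Nonzero values are symbols raised by one: 1 writes \<open>\<sharp>\<close>, 2
    the leading bit 0, and \<open>Suc (Suc v)\<close> the number \<open>v\<close>. The stream starts
    at age 2.\<close>
  define E where "E g t = (if age (w g) t = 0 then 1 else if age (w g) t = 1 then 2
    else case stream g (w g t) (age (w g) t - 2) of None \<Rightarrow> 0 | Some v \<Rightarrow> Suc (Suc v))" for g t
  \<comment> \<open>The oracles on which the output has to be infinite.\<close>
  define D where "D = {g. \<exists>i h. (\<forall>\<^sub>F t in sequentially. w g t = i) \<and> Phi i g = Some h}"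
  have main: "infinite {t. E g t \<noteq> 0}" "squeeze (E g) \<in> LCM3 {h}"
    "card {n. squeeze (E g) n = 0} \<le> Suc (card (mcl (Psi e) g))"
    if lim: "\<forall>\<^sub>F t in sequentially. w g t = i" and h: "Phi i g = Some h" for g i h
  proof -
    obtain L where L: "age (w g) L = 0" "\<And>d. age (w g) (L + d) = d" "\<And>d. w g (L + d) = i"
      and fin: "finite {t. age (w g) t = 0}"
      using age_last[OF lim] by metis
    obtain \<tau> where \<tau>: "strict_mono \<tau>" "{u. stream g i u \<noteq> None} = range \<tau>"
      "\<And>k. stream g i (\<tau> k) = Some (h k)"
      using stream_Phi[OF h] by metis
    \<comment> \<open>The writing stages after the last \<open>\<sharp>\<close>: that of the bit,
      then those of the stream, offset by 2.\<close>
    define \<rho> where "\<rho> k = (case k of 0 \<Rightarrow> L + 1 | Suc j \<Rightarrow> L + (2 + \<tau> j))" for k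
    let ?S = "{t. E g t \<noteq> 0}" and ?f = "squeeze (E g)"
    have EL: "E g L = 1" by (simp add: E_def L)
    have E1: "E g (L + 1) = 2" unfolding E_def L(2) by simp
    have E2: "E g (L + (2 + u)) = (case stream g i u of None \<Rightarrow> 0 | Some v \<Rightarrow> Suc (Suc v))" for u
      unfolding E_def L(2,3) by simp
    have after: "{t \<in> ?S. L < t} = range \<rho>"
    proof (intro set_eqI iffI)
      fix t assume t: "t \<in> {t \<in> ?S. L < t}"
      then obtain d where d: "t = L + Suc d" using less_imp_Suc_add by auto
      show "t \<in> range \<rho>"
      proof (cases d)
        case 0
        then have "t = \<rho> 0" by (simp add: d \<rho>_def)
        then show ?thesis by blast
      next
        case (Suc u)
        then have tu: "t = L + (2 + u)" by (simp add: d)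
        with t E2[of u] have "stream g i u \<noteq> None" by (auto split: option.splits)
        then obtain k where "u = \<tau> k" using \<tau>(2) by blast
        then have "t = \<rho> (Suc k)" by (simp add: tu \<rho>_def)
        then show ?thesis by blast
      qed
    next
      fix t assume "t \<in> range \<rho>"
      then obtain k where k: "t = \<rho> k" by blast
      show "t \<in> {t \<in> ?S. L < t}"
      proof (cases k)
        case 0
        then show ?thesis using E1 by (simp add: k \<rho>_def)
      next
        case (Suc j)
        then show ?thesis using E2[of "\<tau> j"] by (simp add: k \<rho>_def \<tau>(3))
      qed
    qed
    have smr: "strict_mono \<rho>"
      unfolding strict_mono_Suc_iff
      using \<tau>(1) by (auto simp: \<rho>_def strict_mono_Suc_iff split: nat.split)
    have "infinite (range \<rho>)" using smr by (simp add: range_inj_infinite strict_mono_imp_inj_on)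
    then show inf: "infinite ?S" unfolding after[symmetric] by (rule contrapos_nn) simp
    have "L \<in> range (enumerate ?S)" using range_enumerate[OF inf] EL by simp
    then obtain p where p: "enumerate ?S p = L" by (metis imageE)
    have sme: "strict_mono (enumerate ?S)" by (rule strict_mono_enumerate[OF inf])
    \<comment> \<open>Both are increasing enumerations of the writing stages after \<open>L\<close>,
      and \<open>L\<close> itself has position \<open>p\<close> in the output.\<close>
    have "(\<lambda>k. enumerate ?S (Suc p + k)) = \<rho>"
    proof -
      let ?\<eta> = "\<lambda>k. enumerate ?S (Suc p + k)"
      have sm: "strict_mono ?\<eta>" using sme by (simp add: strict_mono_def)
      have "range ?\<eta> = range \<rho>"
        unfolding after[symmetric]
      proof (intro set_eqI iffI)
        fix t assume "t \<in> range ?\<eta>"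
        then obtain k where k: "t = enumerate ?S (Suc p + k)" by blast
        have "enumerate ?S p < t" unfolding k by (rule strict_monoD[OF sme]) simp
        then have "L < t" by (simp only: p)
        moreover have "t \<in> ?S" unfolding k by (rule enumerate_in_set[OF inf])
        ultimately show "t \<in> {t \<in> ?S. L < t}" by simp
      next
        fix t assume t: "t \<in> {t \<in> ?S. L < t}"
        then have "t \<in> range (enumerate ?S)" using range_enumerate[OF inf] by simp
        then obtain q where q: "t = enumerate ?S q" by blast
        have "enumerate ?S p < enumerate ?S q" using t unfolding p q[symmetric] by simp
        then have "p < q" by (simp only: strict_mono_less[OF sme])
        then obtain k where "q = Suc p + k" using less_iff_Suc_add by auto
        then show "t \<in> range ?\<eta>" unfolding q by blast
      qed
      from enumerate_range[OF sm, unfolded this enumerate_range[OF smr]] show ?thesis by (rule sym)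
    qed
    from fun_cong[OF this] have \<eta>: "enumerate ?S (Suc p + k) = \<rho> k" for k .
    have f: "?f (Suc p + k) = E g (\<rho> k) - 1" for k unfolding squeeze_def \<eta> ..
    have f0: "?f (Suc p + 0) = 1" unfolding f using E1 by (simp add: \<rho>_def)
    have f1: "?f (Suc p + Suc k) = Suc (h k)" for k
      unfolding f using E2[of "\<tau> k"] by (simp add: \<rho>_def \<tau>(3))
    have fp: "?f p = 0" unfolding squeeze_def p EL by simp
    show "?f \<in> LCM3 {h}"
      unfolding LCM3_iff
    proof (intro exI[of _ "Suc p"] conjI)
      show "\<forall>j\<ge>Suc p. ?f j \<noteq> 0"
      proof (intro allI impI)
        fix j assume "Suc p \<le> j"
        then obtain k where "j = Suc p + k" using le_Suc_ex by blast
        then show "?f j \<noteq> 0" using f0 f1 by (cases k) auto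
      qed
      show "Suc p = 0 \<or> ?f (Suc p - 1) = 0" using fp by simp
      show "?f (Suc p) \<in> {1, 2}" using f0 by simp
      have "(\<lambda>k. ?f (Suc p + Suc k) - 1) = h" unfolding f1 by simp
      then show "(\<lambda>k. ?f (Suc p + Suc k) - 1) \<in> {h}" by blast
    qed
    have fin': "finite (mcl (Psi e) g)"
      and card': "card {t. age (w g) t = 0} \<le> Suc (card (mcl (Psi e) g))"
    proof -
      \<comment> \<open>A \<open>\<sharp>\<close> is due at stage 0 and right after each mind
        change.\<close>
      have Z: "{t. age (w g) t = 0} = insert 0 (Suc ` mcl (Psi e) g)"
        unfolding age_eq_0_iff mcl_def w_def by auto
      from fin[unfolded Z] have "finite (Suc ` mcl (Psi e) g)" by simp
      then show "finite (mcl (Psi e) g)" by (rule finite_imageD) simp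
      then have "card (insert 0 (Suc ` mcl (Psi e) g)) = Suc (card (mcl (Psi e) g))"
        by (subst card_insert_disjoint) (auto simp: card_image)
      then show "card {t. age (w g) t = 0} \<le> Suc (card (mcl (Psi e) g))" unfolding Z by simp
    qed
    have E_eq_1: "age (w g) t = 0" if "E g t = 1" for t
      using that unfolding E_def by (auto split: if_splits option.splits)
    have age_0: "age (w g) (enumerate ?S n) = 0" if "?f n = 0" for n
    proof -
      have "enumerate ?S n \<in> ?S" by (rule enumerate_in_set[OF inf])
      with that have "E g (enumerate ?S n) = 1" unfolding squeeze_def by simp
      then show ?thesis by (rule E_eq_1)
    qed
    have "enumerate ?S ` {n. ?f n = 0} \<subseteq> {t. age (w g) t = 0}"
      by (intro image_subsetI) (simp only: mem_Collect_eq age_0)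
    then have "card (enumerate ?S ` {n. ?f n = 0}) \<le> card {t. age (w g) t = 0}"
      by (rule card_mono[OF fin])
    moreover have "card (enumerate ?S ` {n. ?f n = 0}) = card {n. ?f n = 0}"
      by (rule card_image) (rule inj_on_subset[OF strict_mono_imp_inj_on[OF sme] subset_UNIV])
    ultimately show "card {n. ?f n = 0} \<le> Suc (card (mcl (Psi e) g))" using card' by simp
  qed
  have "rec_on D E"
    unfolding E_def age_def w_def
    by (intro rec_intros rec_Psi rec_Psi[THEN rec_comp])
  then have "rec_on D (\<lambda>g. squeeze (E g))"
    using main(1) by (intro rec_squeeze) (auto simp: D_def)
  then obtain e' where e': "\<And>g. g \<in> D \<Longrightarrow> Phi e' g = Some (squeeze (E g))"
    unfolding rec_on_Phi by blast
  show ?thesis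
  proof (intro exI[of _ e'] allI impI)
    fix g i h
    assume a: "\<forall>\<^sub>F n in sequentially. Psi e (g \<restriction> n) = i" "Phi i g = Some h"
    then have "g \<in> D" unfolding D_def w_def by blast
    with e' main(2,3)[OF a[folded w_def]]
    show "\<exists>f. Phi e' g = Some f \<and> f \<in> LCM3 {h} \<and> card {n. f n = 0} \<le> Suc (card (mcl (Psi e) g))"
      by (intro exI[of _ "squeeze (E g)"] conjI)
  qed
qed

section \<open>Tapes for boundedly many guesses\<close>

lemma card_below_enumerate:
  fixes W :: "nat set"
  assumes "infinite W"
  shows "card {u. u < enumerate W n \<and> u \<in> W} = n"
proof -
  have sm: "strict_mono (enumerate W)" by (rule strict_mono_enumerate[OF assms])
  have "{u. u < enumerate W n \<and> u \<in> W} = enumerate W ` {..<n}"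
  proof (intro set_eqI iffI)
    fix u assume u: "u \<in> {u. u < enumerate W n \<and> u \<in> W}"
    then have "u \<in> range (enumerate W)" using range_enumerate[OF assms] by simp
    then obtain k where k: "u = enumerate W k" by blast
    with u have "k < n" using sm by (simp add: strict_mono_less)
    then show "u \<in> enumerate W ` {..<n}" unfolding k by simp
  next
    fix u assume "u \<in> enumerate W ` {..<n}"
    then obtain k where "k < n" "u = enumerate W k" by blast
    then show "u \<in> {u. u < enumerate W n \<and> u \<in> W}"
      using sm enumerate_in_set[OF assms] by (simp add: strict_mono_less)
  qed
  then show ?thesis
    by (simp add: card_image inj_on_subset[OF strict_mono_imp_inj_on[OF sm] subset_UNIV])
qed

text \<open>The tape of a guess is the number of different guesses made before its first occurrence.\<close>

definition tape_no :: "(nat \<Rightarrow> nat) \<Rightarrow> nat \<Rightarrow> nat" where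
  "tape_no w t = card {u. u < (LEAST u. w u = w t) \<and> (\<forall>v<u. w v \<noteq> w u)}"

text \<open>The first occurrence of an earlier guess is counted for every later guess but not for
  itself, so numbers grow strictly with the first occurrences.\<close>

lemma tape_no_eq_iff: "tape_no w t = tape_no w t' \<longleftrightarrow> w t = w t'"
proof
  let ?l = "\<lambda>t. LEAST u. w u = w t"
  let ?A = "\<lambda>t. {u. u < ?l t \<and> (\<forall>v<u. w v \<noteq> w u)}"
  have l: "w (?l t) = w t" for t by (rule LeastI[of _ t]) simp
  have less: "tape_no w t < tape_no w t'" if "?l t < ?l t'" for t t'
  proof -
    have "w v \<noteq> w (?l t)" if "v < ?l t" for v
      using not_less_Least[OF that] l[of t] by simp
    then have "?l t \<in> ?A t'" using that by simp
    moreover have "?l t \<notin> ?A t" by simp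
    moreover have "?A t \<subseteq> ?A t'" using that by auto
    ultimately have "?A t \<subset> ?A t'" by blast
    then show ?thesis unfolding tape_no_def by (intro psubset_card_mono) simp_all
  qed
  assume "tape_no w t = tape_no w t'"
  with less[of t t'] less[of t' t] have "?l t = ?l t'"
    by (cases "?l t" "?l t'" rule: linorder_cases) simp_all
  then have "w (?l t) = w (?l t')" by (rule arg_cong)
  then show "w t = w t'" by (simp only: l)
next
  assume "w t = w t'"
  then show "tape_no w t = tape_no w t'" unfolding tape_no_def by simp
qed

text \<open>The counted positions are first occurrences and so carry different guesses, none of
  which is \<open>w t\<close>.\<close>

lemma tape_no_less:
  assumes "finite (range w)"
  shows "tape_no w t < card (range w)"
proof -
  let ?l = "LEAST u. w u = w t"
  let ?A = "{u. u < ?l \<and> (\<forall>v<u. w v \<noteq> w u)}"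
  have "inj_on w ?A"
  proof (rule inj_onI)
    fix u v assume uv: "u \<in> ?A" "v \<in> ?A" "w u = w v"
    from uv(1,2) have "\<forall>x<u. w x \<noteq> w u" "\<forall>x<v. w x \<noteq> w v" by simp_all
    with uv(3) have "\<not> u < v" "\<not> v < u" by auto
    then show "u = v" by simp
  qed
  then have "tape_no w t = card (w ` ?A)" unfolding tape_no_def by (simp add: card_image)
  also have "\<dots> < card (range w)"
  proof (rule psubset_card_mono[OF assms])
    have "w t \<notin> w ` ?A"
    proof
      assume "w t \<in> w ` ?A"
      then obtain u where u: "w u = w t" "u < ?l" by (elim imageE) simp
      from not_less_Least[OF u(2)] u(1) show False by (rule notE)
    qed
    then show "w ` ?A \<subset> range w" by blast
  qed
  finally show ?thesis .
qed

text \<open>A tape cannot be erased. So a guess that returns must resume its function where it was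
  interrupted instead of writing the first values again. At most \<open>c\<close> different guesses
  fit on \<open>c\<close> tapes, and convergence leaves finitely many switches.\<close>

lemma tapes_of_learner:
  "\<exists>e'. \<forall>g i h. (\<forall>\<^sub>F n in sequentially. Psi e (g \<restriction> n) = i) \<longrightarrow> Phi i g = Some h \<longrightarrow>
     ecard (indx (Psi e) g) \<le> enat c \<longrightarrow> (\<exists>f. Phi e' g = Some f \<and> f \<in> LCM2 c {h})"
proof -
  define w where "w g t = Psi e (g \<restriction> t)" for g t
  \<comment> \<open>The clock of a guess is the number of earlier stages at which it was
    active.\<close>
  define E where "E g t = (case stream g (w g t) (card {u. u < t \<and> w g u = w g t}) of None \<Rightarrow> 0
    | Some v \<Rightarrow> Suc (c * v + tape_no (w g) t))" for g t
  define D where "D = {g. \<exists>i h. (\<forall>\<^sub>F t in sequentially. w g t = i) \<and> Phi i g = Some h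
    \<and> ecard (indx (Psi e) g) \<le> enat c}"
  have main: "infinite {t. E g t \<noteq> 0}" "squeeze (E g) \<in> LCM2 c {h}"
    if lim: "\<forall>\<^sub>F t in sequentially. w g t = i" and h: "Phi i g = Some h"
      and c: "ecard (indx (Psi e) g) \<le> enat c" for g i h
  proof -
    have "indx (Psi e) g = range (w g)" unfolding indx_def w_def by auto
    with c have fr: "finite (range (w g))" and cr: "card (range (w g)) \<le> c"
      by (auto simp: ecard_def split: if_splits)
    have tc: "tape_no (w g) t < c" for t
      by (rule order_less_le_trans[OF tape_no_less[OF fr] cr])
    from lim obtain N where N: "\<And>t. t \<ge> N \<Longrightarrow> w g t = i"
      unfolding eventually_sequentially by blast
    define j where "j = tape_no (w g) N"
    have j: "tape_no (w g) t = j \<longleftrightarrow> w g t = i" for t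
      unfolding j_def tape_no_eq_iff using N[of N] by simp
    let ?W = "{t. w g t = i}" and ?f = "squeeze (E g)" and ?S = "{t. E g t \<noteq> 0}"
    have "{N..} \<subseteq> ?W" using N by auto
    then have infW: "infinite ?W" using infinite_Ici finite_subset by blast
    obtain \<tau> where \<tau>: "strict_mono \<tau>" "{u. stream g i u \<noteq> None} = range \<tau>"
      "\<And>k. stream g i (\<tau> k) = Some (h k)"
      using stream_Phi[OF h] by metis
    define \<rho> where "\<rho> k = enumerate ?W (\<tau> k)" for k
    have smr: "strict_mono \<rho>"
      using strict_monoD[OF strict_mono_enumerate[OF infW]] strict_monoD[OF \<tau>(1)]
      unfolding \<rho>_def by (intro strict_monoI) blast
    have mod: "(E g t - 1) mod c = tape_no (w g) t" if "E g t \<noteq> 0" for t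
    proof -
      from that obtain v where "E g t = Suc (c * v + tape_no (w g) t)"
        unfolding E_def by (auto split: option.splits)
      then show ?thesis using tc[of t] by simp
    qed
    have EW: "E g (enumerate ?W u) = (case stream g i u of None \<Rightarrow> 0 | Some v \<Rightarrow> Suc (c * v + j))" for u
    proof -
      have w: "w g (enumerate ?W u) = i" using enumerate_in_set[OF infW, of u] by simp
      then have t: "tape_no (w g) (enumerate ?W u) = j" by (simp add: j)
      \<comment> \<open>At the \<open>u\<close>-th stage with the final guess its clock shows
        \<open>u\<close>, so every stage of the stream is visited once and in order.\<close>
      have "card {v. v < enumerate ?W u \<and> w g v = i} = u"
        using card_below_enumerate[OF infW, of u] by simp
      then show ?thesis unfolding E_def w t by simp
    qed
    have E\<rho>: "E g (\<rho> k) = Suc (c * h k + j)" for k unfolding \<rho>_def EW \<tau>(3) by simp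
    have jc: "j < c" using tc unfolding j_def .
    have range: "{t. E g t \<noteq> 0 \<and> (E g t - 1) mod c = j} = range \<rho>"
    proof (intro set_eqI iffI)
      fix t assume "t \<in> {t. E g t \<noteq> 0 \<and> (E g t - 1) mod c = j}"
      then have t: "E g t \<noteq> 0" "(E g t - 1) mod c = j" by simp_all
      then have "w g t = i" using mod j by simp
      then have "t \<in> range (enumerate ?W)" using range_enumerate[OF infW] by simp
      then obtain u where u: "t = enumerate ?W u" by blast
      with t(1) EW[of u] have "stream g i u \<noteq> None" by (auto split: option.splits)
      then obtain k where "u = \<tau> k" using \<tau>(2) by blast
      then have "t = \<rho> k" by (simp add: u \<rho>_def)
      then show "t \<in> range \<rho>" by blast
    next
      fix t assume "t \<in> range \<rho>"
      then obtain k where "t = \<rho> k" by blast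
      then show "t \<in> {t. E g t \<noteq> 0 \<and> (E g t - 1) mod c = j}" using E\<rho>[of k] jc by simp
    qed
    have sq: "infinite {n. ?f n mod c = j}"
      "\<And>k. ?f (enumerate {n. ?f n mod c = j} k) = E g (\<rho> k) - 1"
      by (rule squeeze_subsequence[where A = "\<lambda>x. x mod c = j", OF smr range])+
    have "infinite (range \<rho>)" using smr by (simp add: range_inj_infinite strict_mono_imp_inj_on)
    then show inf: "infinite ?S" unfolding range[symmetric] by (rule contrapos_nn) (erule finite_subset[rotated], blast)
    have "?f \<in> CL2 c {h}"
      unfolding CL2_iff
    proof (intro exI[of _ j] conjI)
      have "(\<lambda>k. ?f (enumerate {n. ?f n mod c = j} k) div c) = h"
        unfolding sq(2) E\<rho> using jc by simp
      then show "(\<lambda>k. ?f (enumerate {n. ?f n mod c = j} k) div c) \<in> {h}" by blast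
    qed (use jc sq(1) in simp_all)
    moreover have "?f n mod c = j" if "n \<ge> N" for n
    proof -
      \<comment> \<open>Output position \<open>n\<close> is written at stage \<open>n\<close> or
        later, so from position \<open>N\<close> on only tape \<open>j\<close> is used.\<close>
      have "n \<le> enumerate ?S n" by (rule le_enumerate[OF inf])
      with that N have "tape_no (w g) (enumerate ?S n) = j" by (simp add: j)
      moreover have "E g (enumerate ?S n) \<noteq> 0" using enumerate_in_set[OF inf, of n] by (rule CollectD)
      ultimately show ?thesis unfolding squeeze_def using mod by simp
    qed
    then have "{n. ?f n mod c \<noteq> ?f (Suc n) mod c} \<subseteq> {..<N}"
      by (intro subsetI) (rule ccontr, simp)
    then have "finite {n. ?f n mod c \<noteq> ?f (Suc n) mod c}" by (rule finite_subset) simp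
    ultimately show "?f \<in> LCM2 c {h}" unfolding LCM2_iff by blast
  qed
  have ex: "\<exists>u. w g u = w g t" for g t by blast
  have "rec_on D E"
    unfolding E_def tape_no_def w_def
    by (intro rec_intros rec_Psi rec_Psi[THEN rec_comp] ex[unfolded w_def])
  then have "rec_on D (\<lambda>g. squeeze (E g))"
    using main(1) by (intro rec_squeeze) (auto simp: D_def)
  then obtain e' where e': "\<And>g. g \<in> D \<Longrightarrow> Phi e' g = Some (squeeze (E g))"
    unfolding rec_on_Phi by blast
  show ?thesis
  proof (intro exI[of _ e'] allI impI)
    fix g i h
    assume a: "\<forall>\<^sub>F n in sequentially. Psi e (g \<restriction> n) = i" "Phi i g = Some h"
      "ecard (indx (Psi e) g) \<le> enat c"
    then have "g \<in> D" unfolding D_def w_def by blast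
    with e' main(2)[OF a(1)[folded w_def] a(2,3)]
    show "\<exists>f. Phi e' g = Some f \<and> f \<in> LCM2 c {h}" by (intro exI[of _ "squeeze (E g)"] conjI)
  qed
qed

text \<open>\<open>C j v\<close> is the symbol by which function \<open>j\<close> writes
  \<open>v\<close>. Modulo \<open>M j\<close> the residue \<open>r j\<close> marks the symbols of
  \<open>j\<close>, and the quotient returns \<open>v\<close>. The modulus may vary with
  \<open>j\<close>, as a union over all numbers of tapes demands. \<open>J\<close> keeps out indices
  whose symbols might collide.\<close>

lemma dovetail:
  assumes J: "rec_on UNIV (\<lambda>g j. of_bool (J j))"
    and C: "rec_on UNIV (\<lambda>g m. C (pfst m) (psnd m))"
    and mod: "\<And>j j' v. J j \<Longrightarrow> J j' \<Longrightarrow> C j' v mod M j = r j \<longleftrightarrow> j' = j"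
    and div: "\<And>j v. J j \<Longrightarrow> C j v div M j = v"
    and r: "\<And>j. J j \<Longrightarrow> r j < M j"
  shows "\<exists>e. \<forall>g j h. J j \<longrightarrow> Phi j g = Some h \<longrightarrow> (\<exists>f. Phi e g = Some f \<and> f \<in> CL2 (M j) {h})"
proof -
  define E where "E g t = (if J (pfst t) then case stream g (pfst t) (psnd t) of None \<Rightarrow> 0
    | Some v \<Rightarrow> Suc (C (pfst t) v) else 0)" for g t
  \<comment> \<open>One total function among those that are run keeps the output infinite.\<close>
  define D where "D = {g. \<exists>j h. J j \<and> Phi j g = Some h}"
  have main: "infinite {t. E g t \<noteq> 0}" "squeeze (E g) \<in> CL2 (M j) {h}"
    if j: "J j" and h: "Phi j g = Some h" for g j h
  proof -
    let ?f = "squeeze (E g)" and ?A = "\<lambda>x. x mod M j = r j"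
    obtain \<tau> where \<tau>: "strict_mono \<tau>" "{u. stream g j u \<noteq> None} = range \<tau>"
      "\<And>k. stream g j (\<tau> k) = Some (h k)"
      using stream_Phi[OF h] by metis
    define \<rho> where "\<rho> k = prod_encode (j, \<tau> k)" for k
    have smr: "strict_mono \<rho>"
      using strict_monoD[OF \<tau>(1)] unfolding \<rho>_def
      by (intro strict_monoI prod_encode_less) (auto simp: less_imp_le less_imp_neq)
    have E\<rho>: "E g (\<rho> k) = Suc (C j (h k))" for k
      unfolding E_def \<rho>_def by (simp add: j \<tau>(3))
    have range: "{t. E g t \<noteq> 0 \<and> ?A (E g t - 1)} = range \<rho>"
    proof (intro set_eqI iffI)
      fix t assume "t \<in> {t. E g t \<noteq> 0 \<and> ?A (E g t - 1)}"
      then have t: "E g t \<noteq> 0" "?A (E g t - 1)" by simp_all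
      from t(1) obtain v where v: "J (pfst t)" "stream g (pfst t) (psnd t) = Some v"
        "E g t = Suc (C (pfst t) v)"
        unfolding E_def by (auto split: if_splits option.splits)
      with t(2) mod[OF j v(1)] have ft: "pfst t = j" by simp
      with v(2) obtain k where "psnd t = \<tau> k" using \<tau>(2) by blast
      with ft have "t = \<rho> k" unfolding \<rho>_def by (metis prod.collapse prod_decode_inverse)
      then show "t \<in> range \<rho>" by blast
    next
      fix t assume "t \<in> range \<rho>"
      then obtain k where "t = \<rho> k" by blast
      then show "t \<in> {t. E g t \<noteq> 0 \<and> ?A (E g t - 1)}" using E\<rho>[of k] mod[OF j j] by simp
    qed
    have sq: "infinite {n. ?f n mod M j = r j}"
      "\<And>k. ?f (enumerate {n. ?f n mod M j = r j} k) = E g (\<rho> k) - 1"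
      by (rule squeeze_subsequence[where A = ?A, OF smr range])+
    have "infinite (range \<rho>)" using smr by (simp add: range_inj_infinite strict_mono_imp_inj_on)
    then show "infinite {t. E g t \<noteq> 0}"
      unfolding range[symmetric] by (rule contrapos_nn) (erule finite_subset[rotated], blast)
    show "?f \<in> CL2 (M j) {h}"
      unfolding CL2_iff
    proof (intro exI[of _ "r j"] conjI)
      have "(\<lambda>k. ?f (enumerate {n. ?f n mod M j = r j} k) div M j) = h"
        unfolding sq(2) E\<rho> using div[OF j] by simp
      then show "(\<lambda>k. ?f (enumerate {n. ?f n mod M j = r j} k) div M j) \<in> {h}" by blast
    qed (use r[OF j] sq(1) in simp_all)
  qed
  note C' = rec_on_mono[OF C subset_UNIV] and J' = rec_on_mono[OF J subset_UNIV]
  have "rec_on D E"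
    unfolding E_def by (intro rec_intros J'[THEN rec_comp] C'[THEN rec_comp2])
  then have "rec_on D (\<lambda>g. squeeze (E g))"
    using main(1) by (intro rec_squeeze) (auto simp: D_def)
  then obtain e' where e': "\<And>g. g \<in> D \<Longrightarrow> Phi e' g = Some (squeeze (E g))"
    unfolding rec_on_Phi by blast
  show ?thesis
  proof (intro exI[of _ e'] allI impI)
    fix g j h
    assume a: "J j" "Phi j g = Some h"
    then have "g \<in> D" unfolding D_def by blast
    with e' main(2)[OF a] show "\<exists>f. Phi e' g = Some f \<and> f \<in> CL2 (M j) {h}"
      by (intro exI[of _ "squeeze (E g)"] conjI)
  qed
qed

lemma dovetail_finite:
  "\<exists>e. \<forall>g h. \<forall>j<m. Phi j g = Some h \<longrightarrow> (\<exists>f. Phi e g = Some f \<and> f \<in> CL2 m {h})"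
proof -
  have "\<exists>e. \<forall>g j h. j < m \<longrightarrow> Phi j g = Some h \<longrightarrow> (\<exists>f. Phi e g = Some f \<and> f \<in> CL2 m {h})"
    by (rule dovetail[where C = "\<lambda>j v. m * v + j" and r = "\<lambda>j. j"]) (auto intro!: rec_intros)
  then show ?thesis by blast
qed

text \<open>The sets of numbers with residue \<open>2 ^ j\<close> modulo \<open>2 ^ (j + 1)\<close> are disjoint for different \<open>j\<close>, so
  one sequence has room for all \<open>j\<close> even though each \<open>j\<close> is read with a finite number of tapes.\<close>

lemma dovetail_infinite:
  "\<exists>e. \<forall>g j h. Phi j g = Some h \<longrightarrow> (\<exists>f. Phi e g = Some f \<and> f \<in> CL2 (2 ^ Suc j) {h})"
proof -
  \<comment> \<open>The symbol is \<open>2 ^ j'\<close> times an odd number, and the residue says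
    that the exponent of 2 in it is \<open>j\<close>.\<close>
  have mod: "(2 ^ Suc j' * v + 2 ^ j') mod 2 ^ Suc j = (2::nat) ^ j \<longleftrightarrow> j' = j" for j j' v
  proof
    assume *: "(2 ^ Suc j' * v + 2 ^ j') mod 2 ^ Suc j = (2::nat) ^ j"
    show "j' = j"
    proof (rule linorder_cases[of j' j])
      \<comment> \<open>Here \<open>2 ^ Suc j'\<close> would divide modulus and residue, hence the
        symbol.\<close>
      assume "j' < j"
      then have d: "(2::nat) ^ Suc j' dvd 2 ^ j" "(2::nat) ^ Suc j' dvd 2 ^ Suc j"
        by (simp_all only: le_imp_power_dvd Suc_leI less_SucI)
      then have "(2::nat) ^ Suc j' dvd (2 ^ Suc j' * v + 2 ^ j')"
        using * by (metis dvd_mod_iff)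
      then have "(2::nat) ^ Suc j' dvd 2 ^ j'" by (metis dvd_add_right_iff dvd_triv_left)
      then show ?thesis by (metis Suc_n_not_le_n dvd_power_iff_le order_refl)
    next
      \<comment> \<open>Here the symbol is a multiple of the modulus.\<close>
      assume "j < j'"
      then have "(2::nat) ^ Suc j dvd 2 ^ Suc j' * v" "(2::nat) ^ Suc j dvd 2 ^ j'"
        by (auto intro!: dvd_mult2 le_imp_power_dvd simp del: power_Suc)
      then have "(2 ^ Suc j' * v + 2 ^ j') mod 2 ^ Suc j = (0::nat)"
        by (meson dvd_add mod_eq_0_iff_dvd)
      with * show ?thesis by simp
    qed simp
  qed simp
  have "\<exists>e. \<forall>g j h. True \<longrightarrow> Phi j g = Some h \<longrightarrow> (\<exists>f. Phi e g = Some f \<and> f \<in> CL2 (2 ^ Suc j) {h})"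
  proof (rule dovetail[where C = "\<lambda>j v. 2 ^ Suc j * v + 2 ^ j" and r = "\<lambda>j. 2 ^ j"])
    show "rec_on UNIV (\<lambda>g m. 2 ^ Suc (pfst m) * psnd m + 2 ^ pfst m)" by (intro rec_intros)
    show "rec_on UNIV (\<lambda>g j. of_bool True)" by (intro rec_intros)
    show less: "(2::nat) ^ j < 2 ^ Suc j" for j by simp
    show "(2 ^ Suc j' * v + 2 ^ j') mod 2 ^ Suc j = (2::nat) ^ j \<longleftrightarrow> j' = j" for j j' v by (rule mod)
    show "(2 ^ Suc j * v + 2 ^ j) div 2 ^ Suc j = (v::nat)" for j v
      using div_less[OF less[of j]] by (subst div_mult_self4) (simp_all del: power_Suc)
  qed
  then show ?thesis by blast
qed

section \<open>From sequences to learners\<close>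

text \<open>A value obtained from a prefix used only true answers of \<open>g\<close>, so it belongs
  to \<open>f\<close>; by continuity each value of \<open>f\<close> is obtained from some prefix on.
  \<open>V\<close> collects the initial segment obtained so far.\<close>

lemma output_prefix:
  "\<exists>V. rec_on UNIV (\<lambda>g n. list_encode (V (list_decode n))) \<and>
     (\<forall>g f. Phi e g = Some f \<longrightarrow>
        (\<exists>c. mono c \<and> filterlim c at_top sequentially \<and> (\<forall>n. V (g \<restriction> n) = f \<restriction> c n)))"
proof -
  \<comment> \<open>The string is both the partial oracle and, by its length, the depth. So
    evaluation is decidable, and longer prefixes only add values.\<close>
  define ev where "ev \<sigma> l = eval (length \<sigma>) (lookup \<sigma>) e l" for \<sigma> l
  \<comment> \<open>The bound \<open>length \<sigma>\<close> ends the search even if all values are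
    obtained.\<close>
  define C where "C \<sigma> = (LEAST c. length \<sigma> \<le> c \<or> ev \<sigma> c = None)" for \<sigma>
  \<comment> \<open>Below \<open>C \<sigma>\<close> all values are obtained, so the default 0 is
    never taken.\<close>
  define V where "V \<sigma> = map (\<lambda>l. case ev \<sigma> l of None \<Rightarrow> 0 | Some v \<Rightarrow> v) [0..<C \<sigma>]" for \<sigma>
  have ex: "\<exists>c. length \<sigma> \<le> c \<or> ev \<sigma> c = None" for \<sigma> by blast
  have C_least: "l < length \<sigma>" "ev \<sigma> l \<noteq> None" if "l < C \<sigma>" for l \<sigma>
    using not_less_Least[OF that[unfolded C_def]] by (simp_all add: not_le)
  have C_ge: "N \<le> C \<sigma>" if "\<And>l. l < N \<Longrightarrow> l < length \<sigma> \<and> ev \<sigma> l \<noteq> None" for N \<sigma>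
  proof (rule ccontr)
    assume "\<not> N \<le> C \<sigma>"
    then have "C \<sigma> < N" by simp
    from that[OF this] LeastI_ex[OF ex[of \<sigma>], folded C_def] show False by simp
  qed
  have rec: "rec_on UNIV (\<lambda>g n. list_encode (V (list_decode n)))"
    unfolding V_def C_def ev_def by (intro rec_intros ex[unfolded ev_def])
  have "\<exists>c. mono c \<and> filterlim c at_top sequentially \<and> (\<forall>n. V (g \<restriction> n) = f \<restriction> c n)"
    if f: "Phi e g = Some f" for g f
  proof (intro exI[of _ "\<lambda>n. C (g \<restriction> n)"] conjI allI)
    have comp: "computes g (prog_of e) l (f l)" for l using f by (simp add: Phi_eq_Some_iff)
    have val: "y = f l" if "ev (g \<restriction> n) l = Some y" for n l y
    proof -
      have "eval n (\<lambda>q. Some (g q)) e l = Some y"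
        by (rule eval_oracle_mono[of _ "lookup (g \<restriction> n)"])
          (use that in \<open>auto simp: ev_def lookup_def split: if_splits\<close>)
      then have "computes g (prog_of e) l y" unfolding eval_eq_run computes_def by blast
      with comp show ?thesis by (rule computes_unique[rotated])
    qed
    have ev_mono: "ev (g \<restriction> n') l \<noteq> None" if n: "n \<le> n'" and ev: "ev (g \<restriction> n) l \<noteq> None" for n n' l
    proof -
      from ev obtain y where "eval n (lookup (g \<restriction> n)) e l = Some y" by (auto simp: ev_def)
      then have "eval n (lookup (g \<restriction> n')) e l = Some y"
        by (rule eval_oracle_mono) (use n in \<open>auto simp: lookup_def split: if_splits\<close>)
      from eval_depth_mono[OF this n] show ?thesis by (simp add: ev_def)
    qed
    show "mono (\<lambda>n. C (g \<restriction> n))"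
    proof (rule monoI)
      fix n n' :: nat assume n: "n \<le> n'"
      show "C (g \<restriction> n) \<le> C (g \<restriction> n')"
      proof (rule C_ge)
        fix l assume "l < C (g \<restriction> n)"
        from C_least[OF this] n ev_mono[OF n]
        show "l < length (g \<restriction> n') \<and> ev (g \<restriction> n') l \<noteq> None" by simp
      qed
    qed
    show "filterlim (\<lambda>n. C (g \<restriction> n)) at_top sequentially"
      unfolding filterlim_at_top
    proof
      fix N
      have "\<forall>\<^sub>F n in sequentially. ev (g \<restriction> n) l \<noteq> None" for l
      proof -
        from comp[of l] obtain s where s: "eval s (\<lambda>q. Some (g q)) e l = Some (f l)"
          unfolding computes_def eval_eq_run by blast
        have "\<forall>\<^sub>F n in sequentially. eval s (lookup (g \<restriction> n)) e l = Some (f l)"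
        proof (rule eval_eventually[OF s])
          fix q v assume "Some (g q) = Some v"
          then have v: "v = g q" by simp
          show "\<forall>\<^sub>F n in sequentially. lookup (g \<restriction> n) q = Some v"
            using eventually_gt_at_top[of q] by eventually_elim (simp add: lookup_def v)
        qed
        then show ?thesis
          using eventually_ge_at_top[of s]
        proof eventually_elim
          case (elim n)
          from eval_depth_mono[OF elim] show ?case by (simp add: ev_def)
        qed
      qed
      then have "\<forall>\<^sub>F n in sequentially. \<forall>l \<in> {..<N}. ev (g \<restriction> n) l \<noteq> None"
        by (intro eventually_ball_finite) simp_all
      then show "\<forall>\<^sub>F n in sequentially. N \<le> C (g \<restriction> n)"
        using eventually_ge_at_top[of N]
      proof eventually_elim
        case (elim n)
        then show ?case by (intro C_ge) simp
      qed
    qed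
    fix n
    have "(case ev (g \<restriction> n) l of None \<Rightarrow> 0 | Some v \<Rightarrow> v) = f l" if "l < C (g \<restriction> n)" for l
      using C_least(2)[OF that] val[of n l] by (cases "ev (g \<restriction> n) l") simp_all
    then show "V (g \<restriction> n) = f \<restriction> C (g \<restriction> n)" by (simp add: V_def prefix_def)
  qed
  with rec show ?thesis by (intro exI[of _ V]) simp
qed

text \<open>The delay in obtaining \<open>f\<close> and that of the enumerated learner compose to a
  monotone unbounded delay. It remains to describe guesses as a computable function of prefixes of
  \<open>f\<close>.\<close>

lemma learner_of_output:
  assumes "rec_on UNIV (\<lambda>g n. G (list_decode n))"
  shows "\<exists>e'. \<forall>g f. Phi e g = Some f \<longrightarrow>
    (\<exists>k. mono k \<and> filterlim k at_top sequentially \<and> (\<forall>n. Psi e' (g \<restriction> n) = G (f \<restriction> k n)))"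
proof -
  obtain V where V: "rec_on UNIV (\<lambda>g n. list_encode (V (list_decode n)))"
    and pre: "\<And>g f. Phi e g = Some f \<Longrightarrow>
      \<exists>c. mono c \<and> filterlim c at_top sequentially \<and> (\<forall>n. V (g \<restriction> n) = f \<restriction> c n)"
    using output_prefix[of e] by blast
  have "rec_on UNIV (\<lambda>g n. G (V (list_decode n)))"
    using rec_comp[OF assms V] by simp
  from learner_exists[where \<psi> = "\<lambda>\<sigma>. G (V \<sigma>)", OF this]
  obtain e' where e': "\<And>g. \<exists>k. mono k \<and> filterlim k at_top sequentially \<and>
      (\<forall>n. Psi e' (g \<restriction> n) = G (V (g \<restriction> k n)))"
    by blast
  show ?thesis
  proof (rule exI[of _ e'], intro allI impI)
    fix g f assume "Phi e g = Some f"
    from pre[OF this] obtain c where c: "mono c" "filterlim c at_top sequentially"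
      "\<And>n. V (g \<restriction> n) = f \<restriction> c n" by blast
    from e'[of g] obtain k where k: "mono k" "filterlim k at_top sequentially"
      "\<And>n. Psi e' (g \<restriction> n) = G (V (g \<restriction> k n))" by blast
    show "\<exists>k. mono k \<and> filterlim k at_top sequentially \<and> (\<forall>n. Psi e' (g \<restriction> n) = G (f \<restriction> k n))"
    proof (intro exI[of _ "\<lambda>n. c (k n)"] conjI allI)
      show "mono (\<lambda>n. c (k n))" using c(1) k(1) by (simp add: mono_def)
      show "filterlim (\<lambda>n. c (k n)) at_top sequentially" by (rule filterlim_compose[OF c(2) k(2)])
      show "Psi e' (g \<restriction> n) = G (f \<restriction> c (k n))" for n unfolding k(3) c(3) ..
    qed
  qed
qed

text \<open>The guess depends only on the position after the last \<open>\<sharp>\<close> seen, so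
  it can change only when a new \<open>\<sharp>\<close> is read. Mind changes therefore inject into
  occurrences of \<open>\<sharp>\<close>.\<close>

lemma learner_of_backtracking:
  "\<exists>e'. \<forall>g f h. Phi e g = Some f \<longrightarrow> f \<in> LCM3 {h} \<longrightarrow>
     (\<exists>i. (\<forall>\<^sub>F n in sequentially. Psi e' (g \<restriction> n) = i) \<and> Phi i g = Some h \<and>
       finite (mcl (Psi e') g) \<and> card (mcl (Psi e') g) \<le> card {n. f n = 0})"
proof -
  \<comment> \<open>The parameter is the start of the tail: the bit there is skipped, and the shift
    of the coding is undone.\<close>
  have "rec_on UNIV (\<lambda>f x. f (pfst x + Suc (psnd x)) - 1)" by (intro rec_intros)
  from rec_on_oracle[OF this, of e] obtain e1 where
    e1: "\<And>g f. Phi e g = Some f \<Longrightarrow> Phi e1 g = Some (\<lambda>x. f (pfst x + Suc (psnd x)) - 1)" by auto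
  \<comment> \<open>Regarded as a function of \<open>g\<close>, so that the parameter theorem can
    turn each start into an index.\<close>
  have "rec_on {g. Phi e g \<noteq> None} (\<lambda>g x. the (Phi e g) (pfst x + Suc (psnd x)) - 1)"
    unfolding rec_on_Phi using e1 by (intro exI[of _ e1]) auto
  from s_m_n[OF this] obtain S where S: "rec_on UNIV (\<lambda>g. S)"
    and PS: "\<And>a g f. Phi e g = Some f \<Longrightarrow> Phi (S a) g = Some (\<lambda>x. f (a + Suc x) - 1)"
    by auto
  define A where "A f c = (LEAST a. \<forall>l<c. a \<le> l \<longrightarrow> f l \<noteq> 0)" for f :: "nat \<Rightarrow> nat" and c
  \<comment> \<open>A position read so far carries \<open>\<sharp>\<close> iff \<open>lookup\<close>
    gives \<open>Some 0\<close> there, which has the code 1.\<close>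
  define G where
    "G \<sigma> = S (LEAST a. \<forall>l < length \<sigma>. a \<le> l \<longrightarrow> option_code (lookup \<sigma> l) \<noteq> 1)" for \<sigma>
  have exG: "\<exists>a. \<forall>l < length \<sigma>. a \<le> l \<longrightarrow> option_code (lookup \<sigma> l) \<noteq> 1" for \<sigma>
    by (rule exI[of _ "length \<sigma>"]) simp
  have "rec_on UNIV (\<lambda>g n. G (list_decode n))"
    unfolding G_def by (intro rec_intros S[THEN rec_comp] exG)
  from learner_of_output[OF this, of e] obtain e' where e': "\<And>g f. Phi e g = Some f \<Longrightarrow>
    \<exists>k. mono k \<and> filterlim k at_top sequentially \<and> (\<forall>n. Psi e' (g \<restriction> n) = G (f \<restriction> k n))"
    by blast
  have G: "G (f \<restriction> c) = S (A f c)" for f c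
  proof -
    have "(\<forall>l < length (f \<restriction> c). a \<le> l \<longrightarrow> option_code (lookup (f \<restriction> c) l) \<noteq> 1) \<longleftrightarrow>
      (\<forall>l<c. a \<le> l \<longrightarrow> f l \<noteq> 0)" for a
      by (auto simp: lookup_def)
    then show ?thesis unfolding G_def A_def by simp
  qed
  show ?thesis
  proof (rule exI[of _ e'], intro allI impI)
    fix g f h assume f: "Phi e g = Some f" and "f \<in> LCM3 {h}"
    from this(2) obtain a0 where a0: "\<forall>j\<ge>a0. f j \<noteq> 0" "a0 = 0 \<or> f (a0 - 1) = 0"
      and h: "(\<lambda>k. f (a0 + Suc k) - 1) \<in> {h}" unfolding LCM3_iff by (elim exE conjE)
    from e'[OF f] obtain k where k: "mono k" "filterlim k at_top sequentially"
      "\<And>n. Psi e' (g \<restriction> n) = S (A f (k n))" unfolding G by blast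
    have exA: "\<exists>a. \<forall>l<c. a \<le> l \<longrightarrow> f l \<noteq> 0" for c by (rule exI[of _ c]) simp
    have "\<forall>l<c. A f c \<le> l \<longrightarrow> f l \<noteq> 0" for c
      unfolding A_def by (rule LeastI_ex[OF exA])
    then have A: "f l \<noteq> 0" if "l < c" "A f c \<le> l" for l c
      using that by simp
    have A_le: "A f c \<le> a" if "\<And>l. l < c \<Longrightarrow> a \<le> l \<Longrightarrow> f l \<noteq> 0" for a c
      unfolding A_def by (rule Least_le) (intro allI impI, rule that)
    have A_mono: "A f c \<le> A f c'" if "c \<le> c'" for c c'
    proof (rule A_le)
      fix l assume "l < c" "A f c' \<le> l"
      with that show "f l \<noteq> 0" by (intro A[of l c']) simp_all
    qed
    have A_zero: "f (A f c - 1) = 0" if "A f c \<noteq> 0" for c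
    proof (rule ccontr)
      assume n: "f (A f c - 1) \<noteq> 0"
      have "A f c \<le> A f c - 1"
      proof (rule A_le)
        fix l assume "l < c" "A f c - 1 \<le> l"
        then show "f l \<noteq> 0" using A[of l c] n by (cases "l = A f c - 1") simp_all
      qed
      with that show False by simp
    qed
    have A_lim: "A f c = a0" if "a0 \<le> c" for c
    proof (rule antisym)
      show "A f c \<le> a0" by (rule A_le) (use a0(1) in simp)
      show "a0 \<le> A f c"
      proof (rule ccontr)
        assume "\<not> a0 \<le> A f c"
        then have "f (a0 - 1) \<noteq> 0" "a0 \<noteq> 0" using A[of "a0 - 1" c] that by simp_all
        with a0(2) show False by simp
      qed
    qed
    let ?Z = "{n. f n = 0}" and ?B = "{n. A f (k (Suc n)) \<noteq> A f (k n)}"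
    have "?Z \<subseteq> {..<a0}"
    proof
      fix n assume "n \<in> ?Z"
      with a0(1) have "\<not> a0 \<le> n" by auto
      then show "n \<in> {..<a0}" by simp
    qed
    then have finZ: "finite ?Z" by (rule finite_subset) simp
    have less: "A f (k n) < A f (k (Suc n))" if "n \<in> ?B" for n
      using that A_mono[OF monoD[OF k(1), of n "Suc n"]] by simp
    have less2: "A f (k (Suc n)) - 1 < A f (k (Suc n')) - 1" if "n \<in> ?B" "n' \<in> ?B" "n < n'" for n n'
      using less[OF that(1)] less[OF that(2)] A_mono[OF monoD[OF k(1), of "Suc n" n']] that(3) by simp
    \<comment> \<open>A mind change is charged to the newest \<open>\<sharp>\<close>, right before
      the new start of the tail.\<close>
    have inj: "inj_on (\<lambda>n. A f (k (Suc n)) - 1) ?B"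
    proof (rule inj_onI)
      fix n n' assume n: "n \<in> ?B" "n' \<in> ?B" "A f (k (Suc n)) - 1 = A f (k (Suc n')) - 1"
      show "n = n'"
        using less2[OF n(1,2)] less2[OF n(2,1)] n(3) by (cases n n' rule: linorder_cases) simp_all
    qed
    have im: "(\<lambda>n. A f (k (Suc n)) - 1) ` ?B \<subseteq> ?Z"
    proof (rule image_subsetI)
      fix n assume "n \<in> ?B"
      from less[OF this] show "A f (k (Suc n)) - 1 \<in> ?Z" using A_zero[of "k (Suc n)"] by simp
    qed
    have finB: "finite ?B" by (rule inj_on_finite[OF inj im finZ])
    have cardB: "card ?B \<le> card ?Z" by (rule card_inj_on_le[OF inj im finZ])
    have sub: "mcl (Psi e') g \<subseteq> ?B"
      unfolding mcl_def k(3) by (rule subsetI) auto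
    have "\<forall>\<^sub>F n in sequentially. a0 \<le> k n" using k(2) by (simp add: filterlim_at_top)
    then have "\<forall>\<^sub>F n in sequentially. Psi e' (g \<restriction> n) = S a0"
      by eventually_elim (simp add: k(3) A_lim)
    moreover have "Phi (S a0) g = Some h" using PS[OF f, of a0] h by simp
    moreover have "finite (mcl (Psi e') g)" by (rule finite_subset[OF sub finB])
    moreover have "card (mcl (Psi e') g) \<le> card ?Z"
      by (rule order_trans[OF card_mono[OF finB sub] cardB])
    ultimately show "\<exists>i. (\<forall>\<^sub>F n in sequentially. Psi e' (g \<restriction> n) = i) \<and> Phi i g = Some h \<and>
       finite (mcl (Psi e') g) \<and> card (mcl (Psi e') g) \<le> card {n. f n = 0}"
      by (intro exI[of _ "S a0"] conjI)
  qed
qed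

section \<open>Reading off tapes\<close>

lemma read_tape:
  "\<exists>d. \<forall>g f. Phi e g = Some f \<longrightarrow> infinite {n. f n mod m = j} \<longrightarrow>
     Phi d g = Some (\<lambda>k. f (enumerate {n. f n mod m = j} k) div m)"
proof -
  have "rec_on {f. infinite {n. f n mod m = j}} (\<lambda>f k. f (enumerate {n. f n mod m = j} k) div m)"
    by (intro rec_intros) simp
  from rec_on_oracle[OF this, of e] show ?thesis by simp
qed

text \<open>The tape readers are chosen one by one, without uniformity; as only finitely many
  matter, the table of their indices is computable all the same.\<close>

lemma rec_finite_table: "rec_on D (\<lambda>g n. if n < m then d n else 0)"
proof (induction m)
  case 0
  show ?case using rec_const[of D 0] by simp
next
  case (Suc m)
  have "rec_on D (\<lambda>g n. if n = m then d m else if n < m then d n else 0)"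
    by (rule rec_if[OF _ _ Suc]) (intro rec_intros)+
  then show ?case by (rule rec_on_cong) (auto simp: less_Suc_eq)
qed

text \<open>The guess is determined by the tape used last, which leaves at most \<open>m\<close>
  guesses. Finitely many switches make it converge, necessarily to the infinite tape.\<close>

lemma learner_of_tapes:
  "\<exists>e'. \<forall>g f h. Phi e g = Some f \<longrightarrow> f \<in> LCM2 m {h} \<longrightarrow>
     (\<exists>i. (\<forall>\<^sub>F n in sequentially. Psi e' (g \<restriction> n) = i) \<and> Phi i g = Some h \<and>
       ecard (indx (Psi e') g) \<le> enat m)"
proof -
  have "\<forall>j. \<exists>d. \<forall>g f. Phi e g = Some f \<longrightarrow> infinite {n. f n mod m = j} \<longrightarrow>
     Phi d g = Some (\<lambda>k. f (enumerate {n. f n mod m = j} k) div m)"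
    by (intro allI read_tape)
  from choice[OF this] obtain d where d: "\<And>j g f. Phi e g = Some f \<Longrightarrow> infinite {n. f n mod m = j} \<Longrightarrow>
     Phi (d j) g = Some (\<lambda>k. f (enumerate {n. f n mod m = j} k) div m)"
    by blast
  define t where "t j = (if j < m then d j else 0)" for j
  \<comment> \<open>At the empty string \<open>lookup\<close> fails and \<open>t 0\<close> is
    guessed. This is the guess for tape 0, so their number stays within \<open>m\<close>.\<close>
  define G where "G \<sigma> = (case lookup \<sigma> (length \<sigma> - 1) of None \<Rightarrow> t 0 | Some v \<Rightarrow> t (v mod m))" for \<sigma>
  have t: "rec_on UNIV (\<lambda>g. t)" unfolding t_def by (rule rec_finite_table)
  have "rec_on UNIV (\<lambda>g n. G (list_decode n))"
    unfolding G_def by (intro rec_intros t[THEN rec_comp])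
  from learner_of_output[OF this, of e] obtain e' where e': "\<And>g f. Phi e g = Some f \<Longrightarrow>
    \<exists>k. mono k \<and> filterlim k at_top sequentially \<and> (\<forall>n. Psi e' (g \<restriction> n) = G (f \<restriction> k n))"
    by blast
  have G0: "G (f \<restriction> 0) = t 0" for f by (simp add: G_def lookup_def)
  have GS: "G (f \<restriction> Suc c) = t (f c mod m)" for f c by (simp add: G_def lookup_def)
  show ?thesis
  proof (rule exI[of _ e'], intro allI impI)
    fix g f h assume f: "Phi e g = Some f" and "f \<in> LCM2 m {h}"
    from this(2) have CL: "f \<in> CL2 m {h}" and fin: "finite {n. f n mod m \<noteq> f (Suc n) mod m}"
      unfolding LCM2_iff by simp_all
    from CL obtain j where j: "j < m" "infinite {n. f n mod m = j}"
      and h: "(\<lambda>k. f (enumerate {n. f n mod m = j} k) div m) \<in> {h}"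
      unfolding CL2_iff by (elim exE conjE)
    from fin obtain N where N: "\<forall>n \<in> {n. f n mod m \<noteq> f (Suc n) mod m}. n < N"
      unfolding finite_nat_set_iff_bounded by (elim exE)
    have const: "f (N + d) mod m = f N mod m" for d
    proof (induction d)
      case (Suc d)
      have "f (N + d) mod m = f (Suc (N + d)) mod m"
        using N by (metis (mono_tags, lifting) mem_Collect_eq not_add_less1)
      with Suc show ?case by simp
    qed simp
    \<comment> \<open>An infinite tape is used beyond every position, so it is the final
      one.\<close>
    obtain n where "N \<le> n" "f n mod m = j"
      using j(2) unfolding infinite_nat_iff_unbounded_le by (auto elim!: allE[of _ N])
    with const[of "n - N"] have "f N mod m = j" by simp
    with const have tail: "f n mod m = j" if "N \<le> n" for n
      using that by (metis le_add_diff_inverse)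
    from e'[OF f] obtain k where k: "filterlim k at_top sequentially"
      "\<And>n. Psi e' (g \<restriction> n) = G (f \<restriction> k n)" by blast
    have "G (f \<restriction> c) = d j" if "Suc N \<le> c" for c
    proof -
      from that obtain c' where c: "c = Suc c'" "N \<le> c'" by (cases c) auto
      show ?thesis unfolding c(1) GS tail[OF c(2)] using j(1) by (simp add: t_def)
    qed
    moreover have "\<forall>\<^sub>F n in sequentially. Suc N \<le> k n" using k(1) by (simp add: filterlim_at_top)
    ultimately have "\<forall>\<^sub>F n in sequentially. Psi e' (g \<restriction> n) = d j"
      unfolding k(2) by (auto elim: eventually_mono)
    moreover have "Phi (d j) g = Some h" using d[OF f j(2)] h by simp
    moreover have "indx (Psi e') g \<subseteq> t ` {..<m}"
    proof
      fix x assume "x \<in> indx (Psi e') g"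
      then obtain n where "x = G (f \<restriction> k n)" unfolding indx_def k(2) by auto
      then show "x \<in> t ` {..<m}" using j(1) by (cases "k n") (auto simp: G0 GS)
    qed
    then have "finite (indx (Psi e') g)" "card (indx (Psi e') g) \<le> m"
      using finite_subset[of _ "t ` {..<m}"] card_mono[of "t ` {..<m}"] card_image_le[of "{..<m}" t]
      by (auto intro: order_trans)
    then have "ecard (indx (Psi e') g) \<le> enat m" by (simp add: ecard_def)
    ultimately show "\<exists>i. (\<forall>\<^sub>F n in sequentially. Psi e' (g \<restriction> n) = i) \<and> Phi i g = Some h \<and>
       ecard (indx (Psi e') g) \<le> enat m"
      by (intro exI[of _ "d j"] conjI)
  qed
qed

section \<open>The equivalences\<close>

lemma CL2_mono: "P \<subseteq> P' \<Longrightarrow> CL2 m P \<subseteq> CL2 m P'"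
  unfolding CL2_def CL2_seqs_def by (intro image_mono) auto

lemma LCM2_mono: "P \<subseteq> P' \<Longrightarrow> LCM2 m P \<subseteq> LCM2 m P'"
  unfolding LCM2_def CL2_seqs_def by (intro image_mono) auto

lemma LCM2_single:
  assumes "f \<in> LCM2 m P"
  shows "\<exists>h \<in> P. f \<in> LCM2 m {h}"
proof -
  from assms obtain i where i: "i < m" "infinite {n. f n mod m = i}"
    and P: "(\<lambda>k. f (enumerate {n. f n mod m = i} k) div m) \<in> P"
    and fin: "finite {n. f n mod m \<noteq> f (Suc n) mod m}"
    unfolding LCM2_iff CL2_iff by (elim exE conjE)
  have "f \<in> LCM2 m {\<lambda>k. f (enumerate {n. f n mod m = i} k) div m}"
    unfolding LCM2_iff CL2_iff by (intro conjI exI[of _ i] singletonI i fin)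
  then show ?thesis using P by (rule bexI[where P = "\<lambda>h. f \<in> LCM2 m {h}"])
qed

section \<open>Reducibility in terms of indices\<close>

definition learns :: "nat \<Rightarrow> (nat \<Rightarrow> nat) \<Rightarrow> (nat \<Rightarrow> nat) \<Rightarrow> bool" where
  "learns e g h \<longleftrightarrow> (\<exists>i. (\<forall>\<^sub>F n in sequentially. Psi e (g \<restriction> n) = i) \<and> Phi i g = Some h)"

text \<open>The values of \<open>\<Gamma>\<close> can be chosen separately for each
  \<open>g\<close>, since computability is demanded only through the learners with indices in
  \<open>I\<close>.\<close>

lemma reducible_iff:
  "reducible \<alpha> \<beta> \<gamma> P Q \<longleftrightarrow>
     (\<exists>I. ecard I = \<alpha> \<and> (\<forall>g \<in> Q. \<exists>e \<in> I. \<exists>h \<in> P. learns e g h \<and>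
        ecard (mcl (Psi e) g) < \<beta> \<and> ecard (indx (Psi e) g) \<le> \<gamma>))"
  (is "_ \<longleftrightarrow> (\<exists>I. _ \<and> (\<forall>g \<in> Q. ?R I g))")
proof
  assume "reducible \<alpha> \<beta> \<gamma> P Q"
  then obtain \<Gamma> I where I: "ecard I = \<alpha>"
    and G: "\<And>g. g \<in> dom \<Gamma> \<Longrightarrow> \<exists>e \<in> I.
      (\<exists>i. (\<forall>\<^sub>F n in sequentially. Psi e (g \<restriction> n) = i) \<and> Phi i g = \<Gamma> g) \<and>
      ecard (mcl (Psi e) g) < \<beta> \<and> ecard (indx (Psi e) g) \<le> \<gamma>"
    and Q: "Q \<subseteq> dom \<Gamma>" "\<And>g. g \<in> Q \<Longrightarrow> the (\<Gamma> g) \<in> P"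
    unfolding reducible_def learn_computable_def by blast
  have "?R I g" if "g \<in> Q" for g
  proof -
    from that Q(1) obtain h where h: "\<Gamma> g = Some h" by blast
    from Q(2)[OF that] h have "h \<in> P" by simp
    with G[of g] h show ?thesis unfolding learns_def by fastforce
  qed
  with I show "\<exists>I. ecard I = \<alpha> \<and> (\<forall>g \<in> Q. ?R I g)" by blast
next
  assume "\<exists>I. ecard I = \<alpha> \<and> (\<forall>g \<in> Q. ?R I g)"
  then obtain I where I: "ecard I = \<alpha>" "\<forall>g \<in> Q. ?R I g" by blast
  then have "\<forall>g \<in> Q. \<exists>h. \<exists>e \<in> I. h \<in> P \<and> learns e g h \<and>
      ecard (mcl (Psi e) g) < \<beta> \<and> ecard (indx (Psi e) g) \<le> \<gamma>" by blast
  from bchoice[OF this] obtain H where H: "\<forall>g \<in> Q. \<exists>e \<in> I. H g \<in> P \<and> learns e g (H g) \<and>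
      ecard (mcl (Psi e) g) < \<beta> \<and> ecard (indx (Psi e) g) \<le> \<gamma>" by blast
  \<comment> \<open>The domain is exactly \<open>Q\<close>, as a successful learner is demanded at
    every point of the domain.\<close>
  define \<Gamma> where "\<Gamma> g = (if g \<in> Q then Some (H g) else None)" for g
  have dom: "dom \<Gamma> = Q" by (auto simp: \<Gamma>_def split: if_splits)
  have "learn_computable \<alpha> \<beta> \<gamma> \<Gamma>"
    unfolding learn_computable_def dom
  proof (intro exI[of _ I] conjI I(1) ballI)
    fix g assume g: "g \<in> Q"
    with H obtain e where "e \<in> I" "learns e g (H g)"
      "ecard (mcl (Psi e) g) < \<beta>" "ecard (indx (Psi e) g) \<le> \<gamma>" by blast
    with g show "\<exists>e \<in> I. (\<exists>i. (\<forall>\<^sub>F n in sequentially. Psi e (g \<restriction> n) = i) \<and> Phi i g = \<Gamma> g) \<and>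
      ecard (mcl (Psi e) g) < \<beta> \<and> ecard (indx (Psi e) g) \<le> \<gamma>"
      unfolding learns_def by (intro bexI[of _ e]) (simp_all add: \<Gamma>_def)
  qed
  moreover have "\<forall>g \<in> Q. the (\<Gamma> g) \<in> P" using H by (auto simp: \<Gamma>_def)
  ultimately show "reducible \<alpha> \<beta> \<gamma> P Q" unfolding reducible_def using dom by blast
qed

lemma medvedev_iff: "medvedev_reducible P Q \<longleftrightarrow> (\<exists>e. \<forall>g \<in> Q. \<exists>f \<in> P. Phi e g = Some f)"
  unfolding medvedev_reducible_iff by (intro iff_exI) (fastforce simp: subset_iff dom_def)

lemma ecard_eq_1_iff: "ecard I = 1 \<longleftrightarrow> (\<exists>e. I = {e})"
  by (auto simp: ecard_def one_enat_def card_1_singleton_iff)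

lemma reducible_1_iff:
  "reducible 1 \<beta> \<gamma> P Q \<longleftrightarrow>
     (\<exists>e. \<forall>g \<in> Q. \<exists>h \<in> P. learns e g h \<and> ecard (mcl (Psi e) g) < \<beta> \<and> ecard (indx (Psi e) g) \<le> \<gamma>)"
proof -
  have "(\<exists>I. (\<exists>e. I = {e}) \<and> R I) \<longleftrightarrow> (\<exists>e. R {e})" for R :: "nat set \<Rightarrow> bool" by blast
  then show ?thesis unfolding reducible_iff ecard_eq_1_iff by simp
qed

lemma ecard_eq_enat_iff: "(\<exists>a. ecard I = enat a) \<longleftrightarrow> finite I"
  by (auto simp: ecard_def)

lemma ecard_less_infinity_iff: "ecard A < \<infinity> \<longleftrightarrow> finite A"
  by (simp add: ecard_def)

lemma finite_mcl:
  assumes "\<forall>\<^sub>F n in sequentially. \<psi> (g \<restriction> n) = i"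
  shows "finite (mcl \<psi> g)"
proof -
  from assms obtain N where N: "\<And>n. n \<ge> N \<Longrightarrow> \<psi> (g \<restriction> n) = i"
    unfolding eventually_sequentially by blast
  have "n < N" if "n \<in> mcl \<psi> g" for n
    using that N[of n] N[of "n + 1"] unfolding mcl_def by (cases "n < N") simp_all
  then show ?thesis unfolding finite_nat_set_iff_bounded by blast
qed

text \<open>\<open>Search Succ\<close> never finds 0, so a learner built on it keeps its initial
  guess. Injectivity preserves the cardinality of index sets.\<close>

lemma constant_learner: "\<exists>L. inj L \<and> (\<forall>i \<sigma>. Psi (L i) \<sigma> = i)"
proof -
  obtain c where c: "prog_of c = Search Succ" using surj_prog_of by (metis surjD)
  have "run s g (Search Succ) n = None" for s g n
  proof (induction s arbitrary: n)
    case (Suc s)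
    have "run s g Succ n \<noteq> Some 0" by (cases s) auto
    with Suc show ?case
      by (cases "prod_decode n"; cases "run s g Succ n") auto
  qed simp
  then have "Psi (prod_encode (i, c)) \<sigma> = i" for i \<sigma>
    by (simp add: Psi_def converged_def string_run_def c)
  then show ?thesis
    by (intro exI[of _ "\<lambda>i. prod_encode (i, c)"]) (simp add: inj_on_def)
qed

text \<open>Fewer than one mind change means none, so the guess at the empty string is the limit and
  a learner amounts to one index.\<close>

lemma reducible_constant_iff:
  "reducible \<alpha> 1 \<infinity> P Q \<longleftrightarrow>
     (\<exists>I. ecard I = \<alpha> \<and> (\<forall>g \<in> Q. \<exists>e \<in> I. \<exists>h \<in> P. Phi (Psi e []) g = Some h \<and> mcl (Psi e) g = {}))"
proof -
  have ecard_0: "ecard A < 1 \<longleftrightarrow> A = {}" for A :: "nat set"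
    by (auto simp: ecard_def one_enat_def)
  have "learns e g h \<longleftrightarrow> Phi (Psi e []) g = Some h" if "mcl (Psi e) g = {}" for e g h
  proof -
    have "Psi e (g \<restriction> n) = Psi e []" for n
      using that by (induction n) (auto simp: mcl_def prefix_def)
    then show ?thesis by (simp add: learns_def)
  qed
  then have *: "(\<exists>h \<in> P. learns e g h \<and> ecard (mcl (Psi e) g) < 1 \<and> ecard (indx (Psi e) g) \<le> \<infinity>) \<longleftrightarrow>
      (\<exists>h \<in> P. Phi (Psi e []) g = Some h \<and> mcl (Psi e) g = {})" for e g
    by (auto simp: ecard_0)
  show ?thesis unfolding reducible_iff * ..
qed

lemma reducible_constantI:
  assumes "\<And>g. g \<in> Q \<Longrightarrow> \<exists>i \<in> J. \<exists>h \<in> P. Phi i g = Some h"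
  shows "reducible (ecard J) 1 \<infinity> P Q"
proof -
  obtain L where L: "inj L" "\<And>i \<sigma>. Psi (L i) \<sigma> = i" using constant_learner by blast
  have "inj_on L J" using L(1) by (rule inj_on_subset) simp
  then have "ecard (L ` J) = ecard J" by (simp add: ecard_def card_image finite_image_iff)
  moreover have "\<exists>e \<in> L ` J. \<exists>h \<in> P. Phi (Psi e []) g = Some h \<and> mcl (Psi e) g = {}" if "g \<in> Q" for g
    using assms[OF that] by (simp add: L mcl_def)
  ultimately show ?thesis unfolding reducible_constant_iff by blast
qed

section \<open>The six equivalences\<close>

lemma bounded_mind_changes_iff:
  "(\<exists>b::nat. reducible 1 (enat b) \<infinity> P Q) \<longleftrightarrow> (\<exists>m::nat. medvedev_reducible (LCM3_bounded m P) Q)"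
proof
  assume "\<exists>b::nat. reducible 1 (enat b) \<infinity> P Q"
  then obtain b e where e: "\<And>g. g \<in> Q \<Longrightarrow> \<exists>h \<in> P. learns e g h \<and> ecard (mcl (Psi e) g) < enat b"
    unfolding reducible_1_iff by blast
  obtain e' where e': "\<And>g i h. \<forall>\<^sub>F n in sequentially. Psi e (g \<restriction> n) = i \<Longrightarrow> Phi i g = Some h \<Longrightarrow>
     \<exists>f. Phi e' g = Some f \<and> f \<in> LCM3 {h} \<and> card {n. f n = 0} \<le> Suc (card (mcl (Psi e) g))"
    using backtracking_of_learner[of e] by blast
  \<comment> \<open>\<open>Suc b\<close> makes room for the \<open>\<sharp>\<close> at the start of
    the simulation.\<close>
  have "\<exists>f \<in> LCM3_bounded (Suc b) P. Phi e' g = Some f" if g: "g \<in> Q" for g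
  proof -
    from e[OF g] obtain h i where h: "h \<in> P" "\<forall>\<^sub>F n in sequentially. Psi e (g \<restriction> n) = i" "Phi i g = Some h"
      and b: "ecard (mcl (Psi e) g) < enat b" unfolding learns_def by blast
    from e'[OF h(2,3)] obtain f where f: "Phi e' g = Some f" "f \<in> LCM3 {h}"
      "card {n. f n = 0} \<le> Suc (card (mcl (Psi e) g))" by blast
    from b have "card (mcl (Psi e) g) < b" by (simp add: ecard_def split: if_splits)
    with f(3) have "card {n. f n = 0} < Suc b" by simp
    moreover have "f \<in> LCM3 P" using f(2) LCM3_mono[of "{h}" P] h(1) by blast
    ultimately have "f \<in> LCM3_bounded (Suc b) P" by (simp add: LCM3_bounded_iff)
    with f(1) show ?thesis by blast
  qed
  then show "\<exists>m::nat. medvedev_reducible (LCM3_bounded m P) Q" unfolding medvedev_iff by blast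
next
  assume "\<exists>m::nat. medvedev_reducible (LCM3_bounded m P) Q"
  then obtain m e where e: "\<And>g. g \<in> Q \<Longrightarrow> \<exists>f \<in> LCM3_bounded m P. Phi e g = Some f"
    unfolding medvedev_iff by blast
  obtain e' where e': "\<And>g f h. Phi e g = Some f \<Longrightarrow> f \<in> LCM3 {h} \<Longrightarrow>
     \<exists>i. (\<forall>\<^sub>F n in sequentially. Psi e' (g \<restriction> n) = i) \<and> Phi i g = Some h \<and>
       finite (mcl (Psi e') g) \<and> card (mcl (Psi e') g) \<le> card {n. f n = 0}"
    using learner_of_backtracking[of e] by blast
  have "\<exists>h \<in> P. learns e' g h \<and> ecard (mcl (Psi e') g) < enat m \<and> ecard (indx (Psi e') g) \<le> \<infinity>"
    if g: "g \<in> Q" for g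
  proof -
    from e[OF g] obtain f where f: "f \<in> LCM3 P" "card {n. f n = 0} < m" "Phi e g = Some f"
      by (auto simp: LCM3_bounded_iff)
    from LCM3_single[OF f(1)] obtain h where h: "h \<in> P" "f \<in> LCM3 {h}" by blast
    from e'[OF f(3) h(2)] f(2) have "learns e' g h" "ecard (mcl (Psi e') g) < enat m"
      by (auto simp: learns_def ecard_def)
    with h(1) show ?thesis by auto
  qed
  then have "reducible 1 (enat m) \<infinity> P Q"
    unfolding reducible_1_iff by blast
  then show "\<exists>b::nat. reducible 1 (enat b) \<infinity> P Q" ..
qed

lemma bounded_guesses_iff:
  "(\<exists>c::nat. reducible 1 \<infinity> (enat c) P Q) \<longleftrightarrow> (\<exists>m::nat. medvedev_reducible (LCM2 m P) Q)"
proof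
  assume "\<exists>c::nat. reducible 1 \<infinity> (enat c) P Q"
  then obtain c e where e: "\<And>g. g \<in> Q \<Longrightarrow> \<exists>h \<in> P. learns e g h \<and> ecard (indx (Psi e) g) \<le> enat c"
    unfolding reducible_1_iff by blast
  obtain e' where e': "\<And>g i h. \<forall>\<^sub>F n in sequentially. Psi e (g \<restriction> n) = i \<Longrightarrow> Phi i g = Some h \<Longrightarrow>
     ecard (indx (Psi e) g) \<le> enat c \<Longrightarrow> \<exists>f. Phi e' g = Some f \<and> f \<in> LCM2 c {h}"
    using tapes_of_learner[of e c] by blast
  have "\<exists>f \<in> LCM2 c P. Phi e' g = Some f" if g: "g \<in> Q" for g
  proof -
    from e[OF g] obtain h i where h: "h \<in> P" "\<forall>\<^sub>F n in sequentially. Psi e (g \<restriction> n) = i" "Phi i g = Some h"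
      "ecard (indx (Psi e) g) \<le> enat c" unfolding learns_def by blast
    from e'[OF h(2-4)] obtain f where "Phi e' g = Some f" "f \<in> LCM2 c {h}" by blast
    then show ?thesis using LCM2_mono[of "{h}" P c] h(1) by blast
  qed
  then show "\<exists>m::nat. medvedev_reducible (LCM2 m P) Q" unfolding medvedev_iff by blast
next
  assume "\<exists>m::nat. medvedev_reducible (LCM2 m P) Q"
  then obtain m e where e: "\<And>g. g \<in> Q \<Longrightarrow> \<exists>f \<in> LCM2 m P. Phi e g = Some f"
    unfolding medvedev_iff by blast
  obtain e' where e': "\<And>g f h. Phi e g = Some f \<Longrightarrow> f \<in> LCM2 m {h} \<Longrightarrow>
     \<exists>i. (\<forall>\<^sub>F n in sequentially. Psi e' (g \<restriction> n) = i) \<and> Phi i g = Some h \<and>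
       ecard (indx (Psi e') g) \<le> enat m"
    using learner_of_tapes[of e m] by blast
  have "\<exists>h \<in> P. learns e' g h \<and> ecard (mcl (Psi e') g) < \<infinity> \<and> ecard (indx (Psi e') g) \<le> enat m"
    if g: "g \<in> Q" for g
  proof -
    from e[OF g] obtain f where f: "f \<in> LCM2 m P" "Phi e g = Some f" by blast
    from LCM2_single[OF f(1)] obtain h where h: "h \<in> P" "f \<in> LCM2 m {h}" by blast
    from e'[OF f(2) h(2)] obtain i where i: "\<forall>\<^sub>F n in sequentially. Psi e' (g \<restriction> n) = i"
      "Phi i g = Some h" "ecard (indx (Psi e') g) \<le> enat m" by blast
    from finite_mcl[OF i(1)] have "ecard (mcl (Psi e') g) < \<infinity>" by (simp only: ecard_less_infinity_iff)
    with h(1) i show ?thesis unfolding learns_def by blast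
  qed
  then have "reducible 1 \<infinity> (enat m) P Q"
    unfolding reducible_1_iff by blast
  then show "\<exists>c::nat. reducible 1 \<infinity> (enat c) P Q" ..
qed

lemma learns_imp_LCM3: "\<exists>e'. \<forall>g h. learns e g h \<longrightarrow> (\<exists>f \<in> LCM3 {h}. Phi e' g = Some f)"
  using backtracking_of_learner[of e] unfolding learns_def by blast

lemma LCM3_imp_learns:
  "\<exists>e'. \<forall>g. \<forall>f \<in> LCM3 P. Phi e g = Some f \<longrightarrow> (\<exists>h \<in> P. learns e' g h \<and> ecard (mcl (Psi e') g) < \<infinity>)"
proof -
  obtain e' where e': "\<And>g f h. Phi e g = Some f \<Longrightarrow> f \<in> LCM3 {h} \<Longrightarrow>
     \<exists>i. (\<forall>\<^sub>F n in sequentially. Psi e' (g \<restriction> n) = i) \<and> Phi i g = Some h \<and>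
       finite (mcl (Psi e') g) \<and> card (mcl (Psi e') g) \<le> card {n. f n = 0}"
    using learner_of_backtracking[of e] by blast
  have "\<exists>h \<in> P. learns e' g h \<and> ecard (mcl (Psi e') g) < \<infinity>" if f: "f \<in> LCM3 P" "Phi e g = Some f" for g f
  proof -
    from LCM3_single[OF f(1)] obtain h where h: "h \<in> P" "f \<in> LCM3 {h}" by blast
    from e'[OF f(2) h(2)] h(1) show ?thesis unfolding learns_def ecard_less_infinity_iff by blast
  qed
  then show ?thesis by blast
qed

lemma one_learner_iff: "reducible 1 \<infinity> \<infinity> P Q \<longleftrightarrow> medvedev_reducible (LCM3 P) Q"
proof
  assume "reducible 1 \<infinity> \<infinity> P Q"
  then obtain e where e: "\<And>g. g \<in> Q \<Longrightarrow> \<exists>h \<in> P. learns e g h"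
    unfolding reducible_1_iff by blast
  obtain e' where e': "\<And>g h. learns e g h \<Longrightarrow> \<exists>f \<in> LCM3 {h}. Phi e' g = Some f"
    using learns_imp_LCM3[of e] by blast
  have "\<exists>f \<in> LCM3 P. Phi e' g = Some f" if g: "g \<in> Q" for g
  proof -
    from e[OF g] obtain h where h: "h \<in> P" "learns e g h" by blast
    from e'[OF h(2)] show ?thesis using LCM3_mono[of "{h}" P] h(1) by blast
  qed
  then show "medvedev_reducible (LCM3 P) Q" unfolding medvedev_iff by blast
next
  assume "medvedev_reducible (LCM3 P) Q"
  then obtain e where e: "\<And>g. g \<in> Q \<Longrightarrow> \<exists>f \<in> LCM3 P. Phi e g = Some f"
    unfolding medvedev_iff by blast
  obtain e' where e': "\<And>g f. f \<in> LCM3 P \<Longrightarrow> Phi e g = Some f \<Longrightarrow>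
      \<exists>h \<in> P. learns e' g h \<and> ecard (mcl (Psi e') g) < \<infinity>"
    using LCM3_imp_learns[of P e] by blast
  have "\<exists>h \<in> P. learns e' g h \<and> ecard (mcl (Psi e') g) < \<infinity> \<and> ecard (indx (Psi e') g) \<le> \<infinity>"
    if "g \<in> Q" for g
    using e[OF that] e'[of _ g] by (simp only: enat_ord_simps) blast
  then show "reducible 1 \<infinity> \<infinity> P Q"
    unfolding reducible_1_iff by blast
qed

text \<open>Freed from learners, this applies to \<open>P\<close> for finitely many functions, to
  \<open>LCM3 P\<close> for finitely many learners, and to \<open>{g}\<close> in place of
  \<open>Q\<close> for infinitely many functions.\<close>

lemma medvedev_CL2_iff:
  "(\<exists>m. medvedev_reducible (CL2 m P) Q) \<longleftrightarrow>
     (\<exists>J. finite J \<and> (\<forall>g \<in> Q. \<exists>i \<in> J. \<exists>h \<in> P. Phi i g = Some h))"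
proof
  assume "\<exists>m. medvedev_reducible (CL2 m P) Q"
  then obtain m e where e: "\<And>g. g \<in> Q \<Longrightarrow> \<exists>f \<in> CL2 m P. Phi e g = Some f"
    unfolding medvedev_iff by blast
  have "\<forall>j. \<exists>d. \<forall>g f. Phi e g = Some f \<longrightarrow> infinite {n. f n mod m = j} \<longrightarrow>
     Phi d g = Some (\<lambda>k. f (enumerate {n. f n mod m = j} k) div m)"
    by (intro allI read_tape)
  from choice[OF this] obtain d where d: "\<And>j g f. Phi e g = Some f \<Longrightarrow> infinite {n. f n mod m = j} \<Longrightarrow>
     Phi (d j) g = Some (\<lambda>k. f (enumerate {n. f n mod m = j} k) div m)"
    by blast
  have "\<exists>i \<in> d ` {..<m}. \<exists>h \<in> P. Phi i g = Some h" if "g \<in> Q" for g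
  proof -
    from e[OF that] obtain f where f: "f \<in> CL2 m P" "Phi e g = Some f" by blast
    from f(1) obtain j where "j < m" and inf: "infinite {n. f n mod m = j}"
      and P: "(\<lambda>k. f (enumerate {n. f n mod m = j} k) div m) \<in> P"
      unfolding CL2_iff by (elim exE conjE)
    then show ?thesis
      using d[OF f(2) inf] by (intro bexI[of _ "d j"] bexI[OF _ P]) simp_all
  qed
  then show "\<exists>J. finite J \<and> (\<forall>g \<in> Q. \<exists>i \<in> J. \<exists>h \<in> P. Phi i g = Some h)"
    by (intro exI[of _ "d ` {..<m}"]) simp
next
  assume "\<exists>J. finite J \<and> (\<forall>g \<in> Q. \<exists>i \<in> J. \<exists>h \<in> P. Phi i g = Some h)"
  then obtain J where "finite J" and J: "\<And>g. g \<in> Q \<Longrightarrow> \<exists>i \<in> J. \<exists>h \<in> P. Phi i g = Some h" by blast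
  \<comment> \<open>All functions with an index below \<open>m\<close> are run; those outside
    \<open>J\<close> merely fill other tapes.\<close>
  then obtain m where m: "\<And>i. i \<in> J \<Longrightarrow> i < m" unfolding finite_nat_set_iff_bounded by blast
  obtain e where e: "\<And>g h j. j < m \<Longrightarrow> Phi j g = Some h \<Longrightarrow> \<exists>f. Phi e g = Some f \<and> f \<in> CL2 m {h}"
    using dovetail_finite[of m] by blast
  have "\<exists>f \<in> CL2 m P. Phi e g = Some f" if "g \<in> Q" for g
  proof -
    from J[OF that] obtain i h where i: "i \<in> J" "h \<in> P" "Phi i g = Some h" by blast
    from e[OF m[OF i(1)] i(3)] show ?thesis using CL2_mono[of "{h}" P m] i(2) by blast
  qed
  then show "\<exists>m. medvedev_reducible (CL2 m P) Q" unfolding medvedev_iff by blast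
qed

lemma finitely_many_functions_iff:
  "(\<exists>a::nat. reducible (enat a) 1 \<infinity> P Q) \<longleftrightarrow> (\<exists>m::nat. medvedev_reducible (CL2 m P) Q)"
  unfolding medvedev_CL2_iff
proof
  assume "\<exists>a::nat. reducible (enat a) 1 \<infinity> P Q"
  then obtain I a where "ecard I = enat a"
    and I: "\<And>g. g \<in> Q \<Longrightarrow> \<exists>e \<in> I. \<exists>h \<in> P. Phi (Psi e []) g = Some h"
    unfolding reducible_constant_iff by blast
  then have "finite I" using ecard_eq_enat_iff by blast
  then show "\<exists>J. finite J \<and> (\<forall>g \<in> Q. \<exists>i \<in> J. \<exists>h \<in> P. Phi i g = Some h)"
    using I by (intro exI[of _ "(\<lambda>e. Psi e []) ` I"]) simp
next
  assume "\<exists>J. finite J \<and> (\<forall>g \<in> Q. \<exists>i \<in> J. \<exists>h \<in> P. Phi i g = Some h)"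
  then obtain J where "finite J" and J: "\<And>g. g \<in> Q \<Longrightarrow> \<exists>i \<in> J. \<exists>h \<in> P. Phi i g = Some h" by blast
  from reducible_constantI[OF J] \<open>finite J\<close>
  show "\<exists>a::nat. reducible (enat a) 1 \<infinity> P Q" by (auto simp: ecard_def)
qed

lemma finitely_many_learners_iff:
  "(\<exists>a::nat. reducible (enat a) \<infinity> \<infinity> P Q) \<longleftrightarrow> (\<exists>m::nat. medvedev_reducible (CL2 m (LCM3 P)) Q)"
  unfolding medvedev_CL2_iff
proof
  assume "\<exists>a::nat. reducible (enat a) \<infinity> \<infinity> P Q"
  then obtain I a where "ecard I = enat a" and I: "\<And>g. g \<in> Q \<Longrightarrow> \<exists>e \<in> I. \<exists>h \<in> P. learns e g h"
    unfolding reducible_iff by blast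
  then have "finite I" using ecard_eq_enat_iff by blast
  \<comment> \<open>The conversion acts on one index at a time, so finitely many learners become
    finitely many functions.\<close>
  have "\<forall>e. \<exists>e'. \<forall>g h. learns e g h \<longrightarrow> (\<exists>f \<in> LCM3 {h}. Phi e' g = Some f)"
    by (intro allI learns_imp_LCM3)
  from choice[OF this] obtain b where
    b: "\<And>e g h. learns e g h \<Longrightarrow> \<exists>f \<in> LCM3 {h}. Phi (b e) g = Some f" by blast
  have "\<exists>i \<in> b ` I. \<exists>f \<in> LCM3 P. Phi i g = Some f" if "g \<in> Q" for g
  proof -
    from I[OF that] obtain e h where e: "e \<in> I" "h \<in> P" "learns e g h" by blast
    from b[OF e(3)] have "\<exists>f \<in> LCM3 P. Phi (b e) g = Some f"
      using LCM3_mono[of "{h}" P] e(2) by blast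
    with e(1) show ?thesis by blast
  qed
  with \<open>finite I\<close> show "\<exists>J. finite J \<and> (\<forall>g \<in> Q. \<exists>i \<in> J. \<exists>f \<in> LCM3 P. Phi i g = Some f)"
    by (intro exI[of _ "b ` I"]) simp
next
  assume "\<exists>J. finite J \<and> (\<forall>g \<in> Q. \<exists>i \<in> J. \<exists>f \<in> LCM3 P. Phi i g = Some f)"
  then obtain J where "finite J" and J: "\<And>g. g \<in> Q \<Longrightarrow> \<exists>i \<in> J. \<exists>f \<in> LCM3 P. Phi i g = Some f" by blast
  have "\<forall>e. \<exists>e'. \<forall>g. \<forall>f \<in> LCM3 P. Phi e g = Some f \<longrightarrow>
      (\<exists>h \<in> P. learns e' g h \<and> ecard (mcl (Psi e') g) < \<infinity>)"
    by (intro allI LCM3_imp_learns)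
  from choice[OF this] obtain b where
    b: "\<And>i g f. f \<in> LCM3 P \<Longrightarrow> Phi i g = Some f \<Longrightarrow>
      \<exists>h \<in> P. learns (b i) g h \<and> ecard (mcl (Psi (b i)) g) < \<infinity>" by blast
  \<comment> \<open>\<open>b\<close> may identify elements of \<open>J\<close>; some finite
    cardinality is enough.\<close>
  obtain a where a: "ecard (b ` J) = enat a" using \<open>finite J\<close> by (simp add: ecard_def)
  have "\<exists>e \<in> b ` J. \<exists>h \<in> P. learns e g h \<and> ecard (mcl (Psi e) g) < \<infinity> \<and> ecard (indx (Psi e) g) \<le> \<infinity>"
    if "g \<in> Q" for g
  proof -
    from J[OF that] obtain i f where i: "i \<in> J" "f \<in> LCM3 P" "Phi i g = Some f" by blast
    from b[OF i(2,3)] i(1) show ?thesis by (simp only: enat_ord_simps) blast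
  qed
  with a have "reducible (enat a) \<infinity> \<infinity> P Q" unfolding reducible_iff by blast
  then show "\<exists>a::nat. reducible (enat a) \<infinity> \<infinity> P Q" ..
qed

lemma infinitely_many_functions_iff: "reducible \<infinity> 1 \<infinity> P Q \<longleftrightarrow> medvedev_reducible (\<Union>m::nat. CL2 m P) Q"
proof
  assume "reducible \<infinity> 1 \<infinity> P Q"
  then have Q: "\<exists>j. \<exists>h \<in> P. Phi j g = Some h" if "g \<in> Q" for g
    using that unfolding reducible_constant_iff by blast
  obtain e where e: "\<And>g j h. Phi j g = Some h \<Longrightarrow> \<exists>f. Phi e g = Some f \<and> f \<in> CL2 (2 ^ Suc j) {h}"
    using dovetail_infinite by blast
  have "\<exists>f \<in> (\<Union>m::nat. CL2 m P). Phi e g = Some f" if "g \<in> Q" for g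
  proof -
    from Q[OF that] obtain j h where j: "h \<in> P" "Phi j g = Some h" by blast
    from e[OF j(2)] show ?thesis using CL2_mono[of "{h}" P "2 ^ Suc j"] j(1) by blast
  qed
  then show "medvedev_reducible (\<Union>m::nat. CL2 m P) Q" unfolding medvedev_iff by blast
next
  assume "medvedev_reducible (\<Union>m::nat. CL2 m P) Q"
  then obtain e where e: "\<And>g. g \<in> Q \<Longrightarrow> \<exists>f \<in> (\<Union>m::nat. CL2 m P). Phi e g = Some f"
    unfolding medvedev_iff by blast
  \<comment> \<open>Taking all indices makes the index set infinite, as the cardinality is
    prescribed.\<close>
  have "\<exists>i \<in> UNIV. \<exists>h \<in> P. Phi i g = Some h" if "g \<in> Q" for g
  proof -
    from e[OF that] obtain f m where f: "f \<in> CL2 m P" "Phi e g = Some f" by blast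
    then have "medvedev_reducible (CL2 m P) {g}" unfolding medvedev_iff by blast
    then show ?thesis using medvedev_CL2_iff[of P "{g}"] by blast
  qed
  from reducible_constantI[OF this] show "reducible \<infinity> 1 \<infinity> P Q"
    by (simp add: ecard_def)
qed

theorem theorem4p2:
  fixes P Q :: "(nat \<Rightarrow> nat) set"
  shows "((\<exists>b::nat. reducible 1 (enat b) \<infinity> P Q)
            \<longleftrightarrow> (\<exists>m::nat. medvedev_reducible (LCM3_bounded m P) Q))
       \<and> ((\<exists>c::nat. reducible 1 \<infinity> (enat c) P Q)
            \<longleftrightarrow> (\<exists>m::nat. medvedev_reducible (LCM2 m P) Q))
       \<and> (reducible 1 \<infinity> \<infinity> P Q \<longleftrightarrow> medvedev_reducible (LCM3 P) Q)
       \<and> ((\<exists>a::nat. reducible (enat a) 1 \<infinity> P Q)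
            \<longleftrightarrow> (\<exists>m::nat. medvedev_reducible (CL2 m P) Q))
       \<and> ((\<exists>a::nat. reducible (enat a) \<infinity> \<infinity> P Q)
            \<longleftrightarrow> (\<exists>m::nat. medvedev_reducible (CL2 m (LCM3 P)) Q))
       \<and> (reducible \<infinity> 1 \<infinity> P Q \<longleftrightarrow> medvedev_reducible (\<Union>m::nat. CL2 m P) Q)"
  using bounded_mind_changes_iff bounded_guesses_iff one_learner_iff finitely_many_functions_iff
    finitely_many_learners_iff infinitely_many_functions_iff
  by (intro conjI)

end
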